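(* Let $\alpha\in\Bbbk\setminus\mathbb{Z}$, $f=z(z+\alpha)$, $A=A(f)$, and $\Gamma=\mathbb{Z}_{\mathrm{fin}}\times\mathbb{Z}_{\mathrm{fin}}$. The $\Gamma$-graded ring $D=\bigoplus_{\gamma\in\Gamma}\operatorname{Hom}_{\operatorname{gr}\text{-}A}(A,\iota_\gamma A)$ has presentation $$D\cong\frac{\Bbbk[c_n,d_n\mid n\in\mathbb{Z}]}{\left(c_n^2-n=c_m^2-m,\ c_n^2=d_n^2-\alpha\mid m,n\in\mathbb{Z}\right)},$$ where $\deg c_n=(n,\emptyset)$ and $\deg d_n=(\emptyset,n)$.
   Context: $\Bbbk$ is an algebraically closed field of characteristic zero. $\mathbb{Z}_{\mathrm{fin}}$ is the group of finite subsets of $\mathbb{Z}$ under symmetric difference $\oplus$; a singleton $\{n\}$ is written $n$. The sum in $\Gamma$ is $(I,I')+(J,J')=(I\oplus J,I'\oplus J')$. $A=A(f)$ is the $\Bbbk$-algebra generated over $\Bbbk[z]$ by $x,y$ with relations $xz=(z+1)x$, $yz=(z-1)y$, $xy=f(z)$, $yx=f(z-1)$, with $\mathbb{Z}$-grading $\deg x=1$, $\deg y=-1$, $\deg z=0$. $\operatorname{gr}\text{-}A$ is the category of finitely generated $\mathbb{Z}$-graded right $A$-modules with degree-preserving homomorphisms. Shifts: $M\langle n\rangle_i=M_{i-n}$. Put $X_0=A/(x,z)A$, $Y_0=(A/(y,z-1)A)\langle1\rangle$, $X_\alpha=A/(x,z+\alpha)A$, $Y_\alpha=(A/(y,z+\alpha-1)A)\langle1\rangle$.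 Rank one graded projective $A$-modules are regarded as graded submodules of the graded quotient ring $Q_{\mathrm{gr}}(A)=\Bbbk(z)[x^{\pm1};\sigma]$, $\sigma(z)=z+1$; graded homomorphisms between them are given by left multiplication by elements of $\Bbbk(z)$. Each rank one graded projective $P$ surjects, for each $n$, onto exactly one of $X_0\langle n\rangle,Y_0\langle n\rangle$ and exactly one of $X_\alpha\langle n\rangle,Y_\alpha\langle n\rangle$. For $n\in\mathbb{Z}$, $\iota_{(n,\emptyset)}$ (resp. $\iota_{(\emptyset,n)}$) is the autoequivalence of $\operatorname{gr}\text{-}A$ (constructed in earlier work of the author) swapping $X_0\langle n\rangle$ and $Y_0\langle n\rangle$ (resp. $X_\alpha\langle n\rangle$ and $Y_\alpha\langle n\rangle$) up to isomorphism and fixing all other simples. On a rank one graded projective $P$, $\iota_{(n,\emptyset)}P\subseteq P$ (resp. $\iota_{(\emptyset,n)}P\subseteq P$) is the kernel of the nonzero morphism from $P$ to whichever of $X_0\langle n\rangle,Y_0\langle n\rangle$ (resp. $X_\alpha\langle n\rangle,Y_\alpha\langle n\rangle$) it surjects onto; these functors act on morphisms between rank one projectives by restriction. They commute, and $\iota_{(n,\emptyset)}^2P=(z+n)P$, $\iota_{(\emptyset,n)}^2P=(z+n+\alpha)P$. For $(J,J')\in\Gamma$ put $\iota_{(J,J')}=\prod_{j\in J}\iota_{(j,\emptyset)}\prod_{j\in J'}\iota_{(\emptyset,j)}$, $\iota_{(\emptyset,\emptyset)}=\operatorname{Id}$, and $h_{(J,J')}=\prod_{j\in J}(z+j)\prod_{j'\in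 J'}(z+j'+\alpha)$. Let $\sigma_{(J,J')}:\iota_{(J,J')}^2A\to A$ be left multiplication by $h_{(J,J')}^{-1}$, and $$\Theta_{(I,I'),(J,J')}=\iota_{(I\oplus J,I'\oplus J')}(\sigma_{(I\cap J,I'\cap J')}):\ \iota_{(I,I')}\iota_{(J,J')}A=\iota_{(I\oplus J,I'\oplus J')}\iota_{(I\cap J,I'\cap J')}^2A\to\iota_{(I\oplus J,I'\oplus J')}A.$$ Multiplication in $D$: $a\cdot b=\Theta_{\delta,\gamma}\circ\iota_\delta(a)\circ b$ for $a\in D_\gamma=\operatorname{Hom}_{\operatorname{gr}\text{-}A}(A,\iota_\gamma A)$ and $b\in D_\delta$. In the presentation, $c_n$ corresponds to the element of $D_{(n,\emptyset)}$ given by left multiplication by $z+n$ and $d_n$ to the element of $D_{(\emptyset,n)}$ given by left multiplication by $z+n+\alpha$. *)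

theory Defs
  imports
    "HOL-Computational_Algebra.Computational_Algebra"
    "HOL-Library.Poly_Mapping"
    "HOL-Library.Product_Plus"
    "HOL-Algebra.QuotRing"
begin

section \<open>Rings from type classes\<close>

definition class_ring :: "'a::ring_1 ring" where
  "class_ring = \<lparr>carrier = UNIV, mult = (*), one = 1, zero = 0, add = (+)\<rparr>"

lemma class_ring_simps [simp]:
  "carrier class_ring = UNIV" "mult class_ring = (*)" "one class_ring = 1"
  "zero class_ring = 0" "add class_ring = (+)"
  by (simp_all add: class_ring_def)

lemma ring_class_ring: "ring (class_ring :: 'a::ring_1 ring)"
  by unfold_locales
     (auto simp: algebra_simps Units_def intro: exI[of _ "- x" for x])


section \<open>The group of finite subsets of the integers\<close>

typedef zfin = "{S :: int set. finite S}"
  morphisms zset Abs_zfin by auto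

setup_lifting type_definition_zfin

lift_definition zsing :: "int \<Rightarrow> zfin" is "\<lambda>n. {n}" by simp

lift_definition zint :: "zfin \<Rightarrow> zfin \<Rightarrow> zfin" is "(\<inter>)" by simp

instantiation zfin :: ab_group_add
begin

lift_definition zero_zfin :: zfin is "{}" by simp

lift_definition plus_zfin :: "zfin \<Rightarrow> zfin \<Rightarrow> zfin" is "\<lambda>I J. (I - J) \<union> (J - I)" by simp

definition uminus_zfin :: "zfin \<Rightarrow> zfin" where "- I = (I :: zfin)"

definition minus_zfin :: "zfin \<Rightarrow> zfin \<Rightarrow> zfin" where "I - J = I + (J :: zfin)"

instance
proof
  fix a b c :: zfin
  show "a + b + c = a + (b + c)" by transfer auto
  show "a + b = b + a" by transfer auto
  show "0 + a = a" by transfer auto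
  show "- a + a = 0" unfolding uminus_zfin_def by transfer auto
  show "a - b = a + - b" by (simp add: uminus_zfin_def minus_zfin_def)
qed

end

text \<open>The group law on \<open>gam\<close> is the componentwise one of \<^theory>\<open>HOL-Library.Product_Plus\<close>.\<close>

type_synonym gam = "zfin \<times> zfin"

definition gam_inter :: "gam \<Rightarrow> gam \<Rightarrow> gam" where
  "gam_inter \<gamma> \<delta> = (zint (fst \<gamma>) (fst \<delta>), zint (snd \<gamma>) (snd \<delta>))"


section \<open>The graded quotient ring\<close>

text \<open>\<open>shift i\<close> is the \<open>i\<close>-th power of the automorphism \<open>z \<mapsto> z + 1\<close> of the rational functions.\<close>

definition shift :: "int \<Rightarrow> 'k::field poly fract \<Rightarrow> 'k poly fract" where
  "shift i r = (THE s. \<exists>a b. b \<noteq> 0 \<and> r = Fract a b \<and>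
     s = Fract (pcompose a [:of_int i, 1:]) (pcompose b [:of_int i, 1:]))"

lemma shift_Fract:
  fixes a b :: "'k::field poly"
  assumes b: "b \<noteq> 0"
  shows "shift i (Fract a b) = Fract (pcompose a [:of_int i, 1:]) (pcompose b [:of_int i, 1:])"
  unfolding shift_def
proof (rule the_equality)
  let ?l = "[:of_int i, 1:] :: 'k poly"
  show "\<exists>a' b'. b' \<noteq> 0 \<and> Fract a b = Fract a' b' \<and>
      Fract (pcompose a ?l) (pcompose b ?l) = Fract (pcompose a' ?l) (pcompose b' ?l)"
    using b by blast
  fix s
  assume "\<exists>a' b'. b' \<noteq> 0 \<and> Fract a b = Fract a' b' \<and> s = Fract (pcompose a' ?l) (pcompose b' ?l)"
  then obtain a' b' where *: "b' \<noteq> 0" "a * b' = a' * b"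
      "s = Fract (pcompose a' ?l) (pcompose b' ?l)"
    using b by (auto simp: eq_fract)
  then show "s = Fract (pcompose a ?l) (pcompose b ?l)"
    using b by (auto simp: eq_fract pcompose_eq_0_iff simp flip: pcompose_mult)
qed

lemma shift_zero [simp]: "shift i 0 = 0"
  by (simp add: Zero_fract_def shift_Fract pcompose_1)

lemma shift_one [simp]: "shift i 1 = 1"
  by (simp add: One_fract_def shift_Fract pcompose_1)

lemma shift_add: "shift i (a + b) = shift i a + shift i b"
  by (cases a; cases b)
     (simp add: shift_Fract pcompose_add pcompose_mult pcompose_eq_0_iff)

lemma shift_mult: "shift i (a * b) = shift i a * shift i b"
  by (cases a; cases b) (simp add: shift_Fract pcompose_mult)

lemma shift_shift: "shift i (shift j a) = shift (i + j) a"
proof -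
  have *: "[:of_int j, 1:] \<circ>\<^sub>p [:of_int i, 1:] = [:of_int (i + j), 1 :: 'a:]"
    by (simp add: pcompose_pCons)
  have **: "(p \<circ>\<^sub>p [:of_int j, 1:]) \<circ>\<^sub>p [:of_int i, 1:] = p \<circ>\<^sub>p [:of_int (i + j), 1:]" for p :: "'a poly"
    by (simp only: pcompose_assoc [symmetric] *)
  show ?thesis
    by (cases a) (simp add: shift_Fract pcompose_eq_0_iff **)
qed

lemma shift_0 [simp]: "shift 0 a = a"
  by (cases a) (simp add: shift_Fract)

definition skew_times ::
  "(int \<Rightarrow>\<^sub>0 'k::field poly fract) \<Rightarrow> (int \<Rightarrow>\<^sub>0 'k poly fract) \<Rightarrow> (int \<Rightarrow>\<^sub>0 'k poly fract)" where
  "skew_times p q = (\<Sum>i\<in>Poly_Mapping.keys p. \<Sum>j\<in>Poly_Mapping.keys q.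
     Poly_Mapping.single (i + j) (Poly_Mapping.lookup p i * shift i (Poly_Mapping.lookup q j)))"

lemma skew_times_add_left: "skew_times (p + p') q = skew_times p q + skew_times p' q"
  unfolding skew_times_def
  by (rule setsum_keys_plus_distrib)
     (simp_all add: distrib_right single_add sum.distrib)

lemma skew_times_add_right: "skew_times p (q + q') = skew_times p q + skew_times p q'"
proof -
  have "(\<Sum>j\<in>Poly_Mapping.keys (q + q').
     Poly_Mapping.single (i + j) (Poly_Mapping.lookup p i * shift i (Poly_Mapping.lookup (q + q') j))) =
   (\<Sum>j\<in>Poly_Mapping.keys q.
     Poly_Mapping.single (i + j) (Poly_Mapping.lookup p i * shift i (Poly_Mapping.lookup q j))) +
   (\<Sum>j\<in>Poly_Mapping.keys q'.
     Poly_Mapping.single (i + j) (Poly_Mapping.lookup p i * shift i (Poly_Mapping.lookup q' j)))" for i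
    by (rule setsum_keys_plus_distrib)
       (simp_all add: shift_add distrib_left single_add)
  then show ?thesis
    by (simp add: skew_times_def sum.distrib)
qed

lemma skew_times_single:
  "skew_times (Poly_Mapping.single i a) (Poly_Mapping.single j b) =
   Poly_Mapping.single (i + j) (a * shift i b)"
  by (simp add: skew_times_def)

lemma poly_mapping_additive_induct [case_names single add]:
  fixes p :: "'a \<Rightarrow>\<^sub>0 'b::comm_monoid_add"
  assumes s: "\<And>k v. P (Poly_Mapping.single k v)"
    and a: "\<And>p q. P p \<Longrightarrow> P q \<Longrightarrow> P (p + q)"
  shows "P p"
proof (induction p rule: update_induct)
  case const
  then show ?case using s[of undefined 0] by simp
next
  case (update f k v)
  have "Poly_Mapping.update k v f = f + Poly_Mapping.single k v"
    using update.hyps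
    by (intro poly_mapping_eqI)
       (auto simp: lookup_update lookup_add lookup_single in_keys_iff when_def)
  with a[OF update.IH s] show ?case by simp
qed

lemma skew_times_assoc: "skew_times (skew_times p q) r = skew_times p (skew_times q r)"
proof (induction p rule: poly_mapping_additive_induct)
  case (single i a)
  show ?case
  proof (induction q rule: poly_mapping_additive_induct)
    case (single j b)
    show ?case
    proof (induction r rule: poly_mapping_additive_induct)
      case (single k c)
      show ?case
        by (simp add: skew_times_single shift_mult shift_shift mult.assoc add.assoc)
    qed (simp add: skew_times_add_right)
  qed (simp add: skew_times_add_right skew_times_add_left)
qed (simp add: skew_times_add_left)

lemma skew_times_one_left: "skew_times (Poly_Mapping.single 0 1) q = q"
  by (induction q rule: poly_mapping_additive_induct)
     (simp_all add: skew_times_single skew_times_add_right del: single_one)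

lemma skew_times_one_right: "skew_times q (Poly_Mapping.single 0 1) = q"
  by (induction q rule: poly_mapping_additive_induct)
     (simp_all add: skew_times_single skew_times_add_left del: single_one)

text \<open>The skew Laurent polynomial ring over the rational functions: the coefficient family
  \<open>g\<close> stands for the sum of the \<open>g\<^sub>i x\<^sup>i\<close>, coefficients on the left, and \<open>x g = \<sigma>(g) x\<close>.\<close>

typedef (overloaded) 'k qgr = "UNIV :: (int \<Rightarrow>\<^sub>0 'k::field poly fract) set"
  morphisms coeffs_qgr Abs_qgr by simp

setup_lifting type_definition_qgr

instantiation qgr :: (field) ring_1
begin

lift_definition zero_qgr :: "'a qgr" is "0" .
lift_definition one_qgr :: "'a qgr" is "Poly_Mapping.single 0 1" .
lift_definition plus_qgr :: "'a qgr \<Rightarrow> 'a qgr \<Rightarrow> 'a qgr" is "(+)" .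
lift_definition uminus_qgr :: "'a qgr \<Rightarrow> 'a qgr" is "uminus" .
lift_definition minus_qgr :: "'a qgr \<Rightarrow> 'a qgr \<Rightarrow> 'a qgr" is "(-)" .
lift_definition times_qgr :: "'a qgr \<Rightarrow> 'a qgr \<Rightarrow> 'a qgr" is skew_times .

instance
proof
  fix a b c :: "'a qgr"
  show "a * b * c = a * (b * c)" by transfer (rule skew_times_assoc)
  show "1 * a = a" by transfer (rule skew_times_one_left)
  show "a * 1 = a" by transfer (rule skew_times_one_right)
  show "a + b + c = a + (b + c)" by transfer (rule add.assoc)
  show "a + b = b + a" by transfer (rule add.commute)
  show "0 + a = a" by transfer (rule add_0)
  show "- a + a = 0" by transfer (rule left_minus)
  show "a - b = a + - b" by transfer (rule diff_conv_add_uminus)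
  show "(a + b) * c = a * c + b * c" by transfer (rule skew_times_add_left)
  show "a * (b + c) = a * b + a * c" by transfer (rule skew_times_add_right)
  show "(0::'a qgr) \<noteq> 1"
    by transfer (metis lookup_single_eq lookup_zero zero_neq_one)
qed

end

text \<open>\<open>qmon g i\<close> is \<open>g x\<^sup>i\<close>.\<close>

definition qmon :: "'k::field poly fract \<Rightarrow> int \<Rightarrow> 'k qgr" where
  "qmon g i = Abs_qgr (Poly_Mapping.single i g)"

abbreviation qrat :: "'k::field poly fract \<Rightarrow> 'k qgr" where
  "qrat g \<equiv> qmon g 0"

abbreviation qpoly :: "'k::field poly \<Rightarrow> 'k qgr" where
  "qpoly p \<equiv> qrat (Fract p 1)"

lemma qmon_mult: "qmon g i * qmon h j = qmon (g * shift i h) (i + j)"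
  by (simp add: qmon_def times_qgr.abs_eq skew_times_single)

definition qgr_component :: "int \<Rightarrow> 'k::field qgr set" where
  "qgr_component i = range (\<lambda>g. qmon g i)"


section \<open>The algebra \<open>A(f)\<close> by generators and relations\<close>

datatype gen = GX | GY | GZ

datatype wrd = Wrd (letters: "gen list")

instantiation wrd :: monoid_add
begin

definition zero_wrd :: wrd where "0 = Wrd []"

definition plus_wrd :: "wrd \<Rightarrow> wrd \<Rightarrow> wrd" where "v + w = Wrd (letters v @ letters w)"

instance by standard (auto simp: zero_wrd_def plus_wrd_def)

end

text \<open>Since addition of words is concatenation, the convolution product makes \<open>falg\<close> the free
  associative algebra on \<open>x\<close>, \<open>y\<close>, \<open>z\<close>.\<close>

type_synonym 'k falg = "wrd \<Rightarrow>\<^sub>0 'k"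

definition fconst :: "'k::field \<Rightarrow> 'k falg" where
  "fconst c = Poly_Mapping.single 0 c"

definition fgen :: "gen \<Rightarrow> 'k::field falg" where
  "fgen g = Poly_Mapping.single (Wrd [g]) 1"

definition fz :: "'k::field poly \<Rightarrow> 'k falg" where
  "fz p = (\<Sum>i\<le>degree p. fconst (coeff p i) * fgen GZ ^ i)"

definition gwa_rels :: "'k::field poly \<Rightarrow> 'k falg set" where
  "gwa_rels f =
    {fgen GX * fgen GZ - (fgen GZ + 1) * fgen GX,
     fgen GY * fgen GZ - (fgen GZ - 1) * fgen GY,
     fgen GX * fgen GY - fz f,
     fgen GY * fgen GX - fz (pcompose f [:-1, 1:])}"

definition gwa_ideal :: "'k::field poly \<Rightarrow> 'k falg set" where
  "gwa_ideal f = Idl\<^bsub>class_ring\<^esub> (gwa_rels f)"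

definition gwa :: "'k::field poly \<Rightarrow> 'k falg set ring" where
  "gwa f = class_ring Quot gwa_ideal f"

definition gwa_cls :: "'k::field poly \<Rightarrow> 'k falg \<Rightarrow> 'k falg set" where
  "gwa_cls f p = gwa_ideal f +>\<^bsub>class_ring\<^esub> p"

fun gen_deg :: "gen \<Rightarrow> int" where
  "gen_deg GX = 1" | "gen_deg GY = -1" | "gen_deg GZ = 0"

definition wrd_deg :: "wrd \<Rightarrow> int" where
  "wrd_deg w = sum_list (map gen_deg (letters w))"

definition gwa_component :: "'k::field poly \<Rightarrow> int \<Rightarrow> 'k falg set set" where
  "gwa_component f i = gwa_cls f ` {p. \<forall>w\<in>Poly_Mapping.keys p. wrd_deg w = i}"

text \<open>The embedding of \<open>A(f)\<close> into its graded quotient ring; \<open>y\<close> goes to \<open>x\<^sup>-\<^sup>1 f(z)\<close>.\<close>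

fun gen_img :: "'k::field poly \<Rightarrow> gen \<Rightarrow> 'k qgr" where
  "gen_img f GX = qmon 1 1"
| "gen_img f GY = qmon 1 (-1) * qpoly f"
| "gen_img f GZ = qpoly [:0, 1:]"

definition feval :: "'k::field poly \<Rightarrow> 'k falg \<Rightarrow> 'k qgr" where
  "feval f p = (\<Sum>w\<in>Poly_Mapping.keys p.
     qpoly [:Poly_Mapping.lookup p w:] * prod_list (map (gen_img f) (letters w)))"

lemma qmon_add: "qmon (g + h) i = qmon g i + qmon h i"
  by (simp add: qmon_def plus_qgr.abs_eq single_add)

lemma feval_add: "feval f (p + q) = feval f p + feval f q"
proof -
  have *: "qpoly [:a + b:] * r = qpoly [:a:] * r + qpoly [:b:] * r" for a b :: 'a and r
    by (simp flip: qmon_add distrib_right)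
  have "qpoly [:0:] = (0 :: 'a qgr)"
    by (simp add: qmon_def zero_qgr_def flip: Zero_fract_def)
  then show ?thesis
    unfolding feval_def
    by (intro setsum_keys_plus_distrib) (auto simp: *)
qed

lemma feval_single:
  "feval f (Poly_Mapping.single w c) = qpoly [:c:] * prod_list (map (gen_img f) (letters w))"
proof -
  have "qpoly [:0:] = (0 :: 'a qgr)"
    by (simp add: qmon_def zero_qgr_def flip: Zero_fract_def)
  then show ?thesis by (simp add: feval_def)
qed

lemma qmon_one: "qmon 1 0 = 1"
  by (simp add: qmon_def one_qgr_def)

lemma qpoly_const_commute: "qpoly [:c:] * q = q * qpoly [:c:]"
proof -
  have "skew_times (Poly_Mapping.single 0 (Fract [:c:] 1)) p =
      skew_times p (Poly_Mapping.single 0 (Fract [:c:] 1))" for p :: "int \<Rightarrow>\<^sub>0 'a poly fract"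
    by (induction p rule: poly_mapping_additive_induct)
       (simp_all add: skew_times_single shift_Fract pcompose_1 mult.commute
         skew_times_add_left skew_times_add_right)
  then show ?thesis
    unfolding qmon_def by (cases q) (simp add: times_qgr.abs_eq)
qed

lemma feval_mult: "feval f (p * q) = feval f p * feval f q"
proof (induction p rule: poly_mapping_additive_induct)
  case (single v a)
  show ?case
  proof (induction q rule: poly_mapping_additive_induct)
    case (single w b)
    let ?v = "prod_list (map (gen_img f) (letters v))"
    let ?w = "prod_list (map (gen_img f) (letters w))"
    have "qpoly [:a * b:] = qpoly [:a:] * qpoly [:b:]"
      by (simp add: qmon_mult mult.commute)
    then have "qpoly [:a * b:] * (?v * ?w) = qpoly [:a:] * ((qpoly [:b:] * ?v) * ?w)"
      by (simp only: mult.assoc)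
    also have "\<dots> = (qpoly [:a:] * ?v) * (qpoly [:b:] * ?w)"
      by (simp only: qpoly_const_commute[of b ?v] mult.assoc)
    finally show ?case
      by (simp add: mult_single feval_single plus_wrd_def)
  qed (simp add: distrib_left feval_add)
qed (simp add: distrib_right feval_add)

lemma feval_zero [simp]: "feval f 0 = 0"
  by (simp add: feval_def)

lemma feval_uminus: "feval f (- p) = - feval f p"
  using feval_add[of f p "- p"] by (simp add: eq_neg_iff_add_eq_0 add.commute)

lemma feval_diff: "feval f (p - q) = feval f p - feval f q"
  using feval_add[of f p "- q"] by (simp add: feval_uminus)

lemma feval_sum: "feval f (sum g I) = (\<Sum>i\<in>I. feval f (g i))"
  by (induction I rule: infinite_finite_induct) (simp_all add: feval_add)

lemma feval_const: "feval f (fconst c) = qpoly [:c:]"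
  by (simp add: fconst_def feval_single zero_wrd_def)

lemma feval_one [simp]: "feval f 1 = 1"
  using feval_const[of f 1]
  by (simp add: fconst_def qmon_one flip: One_fract_def one_pCons)

lemma feval_gen: "feval f (fgen g) = gen_img f g"
  by (simp add: fgen_def feval_single qmon_one flip: One_fract_def one_pCons)

lemma feval_power: "feval f (p ^ n) = feval f p ^ n"
  by (induction n) (simp_all add: feval_mult)

lemma qpoly_sum: "(\<Sum>i\<in>I. qpoly (g i)) = qpoly (sum g I)"
proof (induction I rule: infinite_finite_induct)
  case (insert x F)
  then show ?case by (simp flip: qmon_add)
qed (simp_all add: qmon_def zero_qgr_def flip: Zero_fract_def)

lemma qpoly_power: "qpoly p ^ n = qpoly (p ^ n)"
  by (induction n) (simp_all add: qmon_mult qmon_one flip: One_fract_def)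

lemma feval_fz: "feval f (fz p) = qpoly p"
proof -
  have "feval f (fz p) = (\<Sum>i\<le>degree p. qpoly ([:coeff p i:] * [:0, 1:] ^ i))"
    by (simp add: fz_def feval_sum feval_mult feval_power feval_const feval_gen
        qpoly_power qmon_mult)
  also have "\<dots> = qpoly (\<Sum>i\<le>degree p. monom (coeff p i) i)"
    by (simp add: qpoly_sum monom_altdef)
  finally show ?thesis by (simp add: poly_as_sum_of_monoms)
qed

lemma feval_gwa_rels:
  assumes "r \<in> gwa_rels f"
  shows "feval f r = 0"
proof -
  have one: "Fract [:1 :: 'a:] 1 = 1"
    by (metis One_fract_def one_pCons)
  have "qpoly [:0, 1:] + qpoly [:1:] = (qpoly [:1, 1:] :: 'a qgr)"
    by (simp flip: qmon_add)
  then have sum: "qpoly [:0, 1:] + 1 = (qpoly [:1, 1:] :: 'a qgr)"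
    by (simp only: one qmon_one)
  have "qpoly [:-1, 1:] + qpoly [:1:] = (qpoly [:0, 1:] :: 'a qgr)"
    by (simp flip: qmon_add)
  then have diff: "qpoly [:0, 1:] - 1 = (qpoly [:-1, 1:] :: 'a qgr)"
    by (simp only: one qmon_one diff_eq_eq)
  have sh: "shift i (Fract p 1) = Fract (pcompose p [:of_int i, 1:]) 1" for i and p :: "'a poly"
    by (simp add: shift_Fract pcompose_1)
  have y: "gen_img f GY = qmon (Fract (pcompose f [:-1, 1:]) 1) (-1)"
    by (simp add: qmon_mult sh)
  have "feval f (fgen GX * fgen GZ) = feval f ((fgen GZ + 1) * fgen GX)"
    unfolding feval_mult feval_add feval_gen feval_one gen_img.simps sum qmon_mult sh
    by (simp add: pcompose_pCons)
  moreover have "feval f (fgen GY * fgen GZ) = feval f ((fgen GZ - 1) * fgen GY)"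
    unfolding feval_mult feval_diff feval_gen feval_one y gen_img.simps(3) diff qmon_mult sh
    by (simp add: pcompose_pCons mult.commute)
  moreover have "feval f (fgen GX * fgen GY) = feval f (fz f)"
    unfolding feval_mult feval_fz feval_gen y gen_img.simps(1) qmon_mult sh
    by (simp add: pcompose_assoc [symmetric] pcompose_pCons)
  moreover have "feval f (fgen GY * fgen GX) = feval f (fz (pcompose f [:-1, 1:]))"
    unfolding feval_mult feval_fz feval_gen y gen_img.simps(1) qmon_mult
    by simp
  ultimately show ?thesis
    using assms by (auto simp: gwa_rels_def feval_diff)
qed

lemma feval_gwa_ideal:
  assumes "p \<in> gwa_ideal f"
  shows "feval f p = 0"
proof -
  interpret ring "class_ring :: 'a falg ring" by (rule ring_class_ring)
  have minv: "\<ominus>\<^bsub>class_ring\<^esub> a = - a" for a :: "'a falg"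
    using minus_equality[of "- a" a] by simp
  have "ideal {p. feval f p = 0} (class_ring :: 'a falg ring)"
  proof (rule idealI)
    show "subgroup {p. feval f p = 0} (add_monoid (class_ring :: 'a falg ring))"
      by (rule add.subgroupI)
         (auto simp: feval_add feval_uminus minv simp flip: a_inv_def intro: exI[of _ 0])
  qed (auto simp: feval_mult ring_class_ring)
  moreover have "gwa_rels f \<subseteq> {p. feval f p = 0}"
    using feval_gwa_rels by auto
  ultimately show ?thesis
    using assms unfolding gwa_ideal_def by (auto dest: genideal_minimal)
qed

definition gwa_emb :: "'k::field poly \<Rightarrow> 'k falg set \<Rightarrow> 'k qgr" where
  "gwa_emb f a = the_elem (feval f ` a)"

lemma gwa_emb_cls: "gwa_emb f (gwa_cls f p) = feval f p"
proof -
  interpret ring "class_ring :: 'a falg ring" by (rule ring_class_ring)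
  have "ideal (gwa_ideal f) (class_ring :: 'a falg ring)"
    unfolding gwa_ideal_def by (rule genideal_ideal) simp
  then have "0 \<in> gwa_ideal f"
    using additive_subgroup.zero_closed[OF ideal.axioms(1)] by fastforce
  then have "feval f ` gwa_cls f p = {feval f p}"
    by (force simp: gwa_cls_def a_r_coset_def' feval_add feval_gwa_ideal)
  then show ?thesis by (simp add: gwa_emb_def)
qed


section \<open>Graded right modules\<close>

text \<open>As for the library's modules, the fields \<open>mult\<close> and \<open>one\<close> of the underlying ring record
  play no role.\<close>

record ('r, 'm) gr_module = "'m ring" +
  ract :: "'m \<Rightarrow> 'r \<Rightarrow> 'm"
  component :: "int \<Rightarrow> 'm set"

definition gr_shift :: "('r, 'm) gr_module \<Rightarrow> int \<Rightarrow> ('r, 'm) gr_module" where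
  "gr_shift M n = M\<lparr>component := (\<lambda>i. component M (i - n))\<rparr>"

text \<open>Degree-preserving homomorphisms of right \<open>A(f)\<close>-modules. As functions they are made
  unique by the value zero outside of the source.\<close>

definition gr_hom :: "'k::field poly \<Rightarrow> ('k falg set, 'm) gr_module \<Rightarrow>
    ('k falg set, 'n) gr_module \<Rightarrow> ('m \<Rightarrow> 'n) set" where
  "gr_hom f M N = {\<phi>.
     (\<forall>m\<in>carrier M. \<phi> m \<in> carrier N) \<and>
     (\<forall>m. m \<notin> carrier M \<longrightarrow> \<phi> m = \<zero>\<^bsub>N\<^esub>) \<and>
     (\<forall>m\<in>carrier M. \<forall>m'\<in>carrier M. \<phi> (m \<oplus>\<^bsub>M\<^esub> m') = \<phi> m \<oplus>\<^bsub>N\<^esub> \<phi> m') \<and>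
     (\<forall>m\<in>carrier M. \<forall>a\<in>carrier (gwa f). \<phi> (ract M m a) = ract N (\<phi> m) a) \<and>
     (\<forall>i. \<forall>m\<in>component M i. \<phi> m \<in> component N i)}"

definition right_ideal2 :: "'k::field poly \<Rightarrow> 'k falg set \<Rightarrow> 'k falg set \<Rightarrow> 'k falg set set" where
  "right_ideal2 f u v = {u \<otimes>\<^bsub>gwa f\<^esub> a \<oplus>\<^bsub>gwa f\<^esub> v \<otimes>\<^bsub>gwa f\<^esub> b | a b.
     a \<in> carrier (gwa f) \<and> b \<in> carrier (gwa f)}"

text \<open>The quotient of the right regular module by a graded right ideal, with the induced grading.\<close>

definition cyclic_module :: "'k::field poly \<Rightarrow> 'k falg set set \<Rightarrow>
    ('k falg set, 'k falg set set) gr_module" where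
  "cyclic_module f K =
    \<lparr>carrier = a_rcosets\<^bsub>gwa f\<^esub> K, mult = undefined, one = undefined,
     zero = K, add = set_add (gwa f),
     ract = (\<lambda>C a. \<Union>c\<in>C. K +>\<^bsub>gwa f\<^esub> (c \<otimes>\<^bsub>gwa f\<^esub> a)),
     component = (\<lambda>i. (\<lambda>a. K +>\<^bsub>gwa f\<^esub> a) ` gwa_component f i)\<rparr>"

definition simple_X :: "'k::field poly \<Rightarrow> 'k \<Rightarrow> ('k falg set, 'k falg set set) gr_module" where
  "simple_X f \<beta> = cyclic_module f
     (right_ideal2 f (gwa_cls f (fgen GX)) (gwa_cls f (fgen GZ + fconst \<beta>)))"

definition simple_Y :: "'k::field poly \<Rightarrow> 'k \<Rightarrow> ('k falg set, 'k falg set set) gr_module" where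
  "simple_Y f \<beta> = gr_shift (cyclic_module f
     (right_ideal2 f (gwa_cls f (fgen GY)) (gwa_cls f (fgen GZ + fconst \<beta> - 1)))) 1"

text \<open>A graded right submodule \<open>P\<close> of the graded quotient ring.\<close>

definition qgr_sub :: "'k::field poly \<Rightarrow> 'k qgr set \<Rightarrow> ('k falg set, 'k qgr) gr_module" where
  "qgr_sub f P =
    \<lparr>carrier = P, mult = undefined, one = undefined, zero = 0, add = (+),
     ract = (\<lambda>q a. q * gwa_emb f a),
     component = (\<lambda>i. P \<inter> qgr_component i)\<rparr>"

definition lmul :: "'k::field qgr set \<Rightarrow> 'k poly fract \<Rightarrow> 'k qgr \<Rightarrow> 'k qgr" where
  "lmul P g q = (if q \<in> P then qrat g * q else 0)"


section \<open>The functors \<open>\<iota>\<close> on rank one graded projectives\<close>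

text \<open>For \<open>f = z (z + \<alpha>)\<close>, the parameter \<open>\<beta> = 0\<close> gives \<open>\<iota>\<^bsub>(n,\<emptyset>)\<^esub>\<close> and
  \<open>\<beta> = \<alpha>\<close> gives \<open>\<iota>\<^bsub>(\<emptyset>,n)\<^esub>\<close>. The two modules are simple, so a nonzero morphism onto
  one of them is the same as a surjective one.\<close>

definition iota1 :: "'k::field poly \<Rightarrow> 'k \<Rightarrow> int \<Rightarrow> 'k qgr set \<Rightarrow> 'k qgr set" where
  "iota1 f \<beta> n P = (THE K.
     \<exists>S\<in>{gr_shift (simple_X f \<beta>) n, gr_shift (simple_Y f \<beta>) n}.
     \<exists>\<phi>\<in>gr_hom f (qgr_sub f P) S.
       \<phi> ` P = carrier S \<and> K = {p\<in>P. \<phi> p = \<zero>\<^bsub>S\<^esub>})"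

definition fpoly :: "'k::field \<Rightarrow> 'k poly" where
  "fpoly \<alpha> = [:0, 1:] * [:\<alpha>, 1:]"

text \<open>The functors being composed commute, so their order is immaterial; the factors are taken
  in increasing order.\<close>

definition iota :: "'k::field \<Rightarrow> gam \<Rightarrow> 'k qgr set \<Rightarrow> 'k qgr set" where
  "iota \<alpha> \<gamma> P =
     foldr (iota1 (fpoly \<alpha>) 0) (sorted_list_of_set (zset (fst \<gamma>)))
       (foldr (iota1 (fpoly \<alpha>) \<alpha>) (sorted_list_of_set (zset (snd \<gamma>))) P)"

text \<open>The action of \<open>\<iota>\<^sub>\<gamma>\<close> on a morphism \<open>\<phi>\<close> with source \<open>P\<close>.\<close>

definition iota_mor :: "'k::field \<Rightarrow> gam \<Rightarrow> 'k qgr set \<Rightarrow> ('k qgr \<Rightarrow> 'k qgr) \<Rightarrow> 'k qgr \<Rightarrow> 'k qgr" where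
  "iota_mor \<alpha> \<gamma> P \<phi> q = (if q \<in> iota \<alpha> \<gamma> P then \<phi> q else 0)"

definition Areg :: "'k::field \<Rightarrow> 'k qgr set" where
  "Areg \<alpha> = gwa_emb (fpoly \<alpha>) ` carrier (gwa (fpoly \<alpha>))"

definition hpoly :: "'k::field \<Rightarrow> gam \<Rightarrow> 'k poly" where
  "hpoly \<alpha> \<gamma> = (\<Prod>j\<in>zset (fst \<gamma>). [:of_int j, 1:]) * (\<Prod>j\<in>zset (snd \<gamma>). [:of_int j + \<alpha>, 1:])"

definition sigma_mor :: "'k::field \<Rightarrow> gam \<Rightarrow> 'k qgr \<Rightarrow> 'k qgr" where
  "sigma_mor \<alpha> \<gamma> = lmul (iota \<alpha> \<gamma> (iota \<alpha> \<gamma> (Areg \<alpha>))) (inverse (Fract (hpoly \<alpha> \<gamma>) 1))"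

definition Theta :: "'k::field \<Rightarrow> gam \<Rightarrow> gam \<Rightarrow> 'k qgr \<Rightarrow> 'k qgr" where
  "Theta \<alpha> \<gamma> \<delta> = (let \<epsilon> = gam_inter \<gamma> \<delta> in
     iota_mor \<alpha> (\<gamma> + \<delta>) (iota \<alpha> \<epsilon> (iota \<alpha> \<epsilon> (Areg \<alpha>))) (sigma_mor \<alpha> \<epsilon>))"


section \<open>The graded ring \<open>D\<close>\<close>

definition D_hom :: "'k::field \<Rightarrow> gam \<Rightarrow> ('k qgr \<Rightarrow> 'k qgr) set" where
  "D_hom \<alpha> \<gamma> = gr_hom (fpoly \<alpha>) (qgr_sub (fpoly \<alpha>) (Areg \<alpha>))
     (qgr_sub (fpoly \<alpha>) (iota \<alpha> \<gamma> (Areg \<alpha>)))"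

text \<open>The product of \<open>a\<close> of degree \<open>\<gamma>\<close> with \<open>b\<close> of degree \<open>\<delta>\<close>.\<close>

definition D_hom_mult :: "'k::field \<Rightarrow> gam \<Rightarrow> gam \<Rightarrow>
    ('k qgr \<Rightarrow> 'k qgr) \<Rightarrow> ('k qgr \<Rightarrow> 'k qgr) \<Rightarrow> 'k qgr \<Rightarrow> 'k qgr" where
  "D_hom_mult \<alpha> \<gamma> \<delta> a b = Theta \<alpha> \<delta> \<gamma> \<circ> iota_mor \<alpha> \<delta> (Areg \<alpha>) a \<circ> b"

text \<open>Elements of the direct sum are the finitely supported families of homogeneous elements.\<close>

type_synonym 'k dfam = "gam \<Rightarrow> 'k qgr \<Rightarrow> 'k qgr"

definition dsupp :: "'k::field dfam \<Rightarrow> gam set" where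
  "dsupp d = {\<gamma>. d \<gamma> \<noteq> (\<lambda>_. 0)}"

definition dhomog :: "gam \<Rightarrow> ('k::field qgr \<Rightarrow> 'k qgr) \<Rightarrow> 'k dfam" where
  "dhomog \<gamma> a = (\<lambda>\<delta>. if \<delta> = \<gamma> then a else (\<lambda>_. 0))"

definition D_ring :: "'k::field \<Rightarrow> 'k dfam ring" where
  "D_ring \<alpha> =
    \<lparr>carrier = {d. (\<forall>\<gamma>. d \<gamma> \<in> D_hom \<alpha> \<gamma>) \<and> finite (dsupp d)},
     mult = (\<lambda>d e \<epsilon> q. \<Sum>(\<gamma>, \<delta>) \<in> {(\<gamma>, \<delta>) \<in> dsupp d \<times> dsupp e. \<gamma> + \<delta> = \<epsilon>}.
               D_hom_mult \<alpha> \<gamma> \<delta> (d \<gamma>) (e \<delta>) q),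
     one = dhomog 0 (lmul (Areg \<alpha>) 1),
     zero = (\<lambda>\<gamma> q. 0),
     add = (\<lambda>d e \<gamma> q. d \<gamma> q + e \<gamma> q)\<rparr>"

definition D_component :: "'k::field \<Rightarrow> gam \<Rightarrow> 'k dfam set" where
  "D_component \<alpha> \<gamma> = dhomog \<gamma> ` D_hom \<alpha> \<gamma>"

definition D_scale :: "'k::field \<Rightarrow> 'k dfam \<Rightarrow> 'k dfam" where
  "D_scale c d = (\<lambda>\<gamma> q. qpoly [:c:] * d \<gamma> q)"


section \<open>The presented algebra\<close>

datatype var = C int | D int

type_synonym 'k mpoly = "(var \<Rightarrow>\<^sub>0 nat) \<Rightarrow>\<^sub>0 'k"

definition mconst :: "'k::field \<Rightarrow> 'k mpoly" where
  "mconst c = Poly_Mapping.single 0 c"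

definition mvar :: "var \<Rightarrow> 'k::field mpoly" where
  "mvar v = Poly_Mapping.single (Poly_Mapping.single v 1) 1"

definition pres_rels :: "'k::field \<Rightarrow> 'k mpoly set" where
  "pres_rels \<alpha> =
     {((mvar (C n))\<^sup>2 - of_int n) - ((mvar (C m))\<^sup>2 - of_int m) | m n. True} \<union>
     {(mvar (C n))\<^sup>2 - ((mvar (D n))\<^sup>2 - mconst \<alpha>) | n. True}"

definition pres_ideal :: "'k::field \<Rightarrow> 'k mpoly set" where
  "pres_ideal \<alpha> = Idl\<^bsub>class_ring\<^esub> (pres_rels \<alpha>)"

definition pres_ring :: "'k::field \<Rightarrow> 'k mpoly set ring" where
  "pres_ring \<alpha> = class_ring Quot pres_ideal \<alpha>"

definition pres_cls :: "'k::field \<Rightarrow> 'k mpoly \<Rightarrow> 'k mpoly set" where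
  "pres_cls \<alpha> p = pres_ideal \<alpha> +>\<^bsub>class_ring\<^esub> p"

fun var_deg :: "var \<Rightarrow> gam" where
  "var_deg (C n) = (zsing n, 0)" | "var_deg (D n) = (0, zsing n)"

definition monom_deg :: "(var \<Rightarrow>\<^sub>0 nat) \<Rightarrow> gam" where
  "monom_deg m = (\<Sum>v\<in>Poly_Mapping.keys m. \<Sum>i<Poly_Mapping.lookup m v. var_deg v)"

definition pres_component :: "'k::field \<Rightarrow> gam \<Rightarrow> 'k mpoly set set" where
  "pres_component \<alpha> \<gamma> = pres_cls \<alpha> ` {p. \<forall>m\<in>Poly_Mapping.keys p. monom_deg m = \<gamma>}"

end

theory Submission
  imports Defs
begin

text \<open>A rank one graded projective has the form \<open>P = \<Oplus> p\<^sub>i k[z] x\<^sup>i\<close> with polynomials \<open>p\<^sub>i\<close>. Closure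
  under \<open>x\<close> and \<open>y\<close> means that \<open>p\<^sub>i / p\<^bsub>i+1\<^esub>\<close> is a divisor of \<open>f(z + i) = (z + i) (z + i + \<alpha>)\<close>.
  Hence \<open>P\<close> is determined by a polynomial \<open>h\<close>, the value of \<open>p\<^sub>i\<close> for large \<open>i\<close>, and by the set \<open>T\<close>
  of its jumps, the pairs \<open>(n, b)\<close> with \<open>b \<in> {0, \<alpha>}\<close> for which \<open>z + n + b\<close> divides
  \<open>p\<^sub>n / p\<^bsub>n+1\<^esub>\<close>; in the text below \<open>P = rank_one h T\<close>. For \<open>A\<close> itself \<open>h = 1\<close> and the jumps are all
  pairs with \<open>n < 0\<close> (\<open>Areg_eq\<close>).

  The module \<open>X\<^sub>b\<langle>n\<rangle>\<close> has one-dimensional components in the degrees \<open>i \<le> n\<close>, and \<open>Y\<^sub>b\<langle>n\<rangle>\<close> in the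
  degrees \<open>i > n\<close>; in both of them right multiplication by \<open>z\<close> on degree \<open>i\<close> is the scalar
  \<open>i - n - b\<close>. Therefore the kernel of a surjection from \<open>P\<close> is obtained by replacing
  \<open>p\<^sub>i\<close> by \<open>(z + n + b) p\<^sub>i\<close> in exactly these degrees (\<open>kernel_of_surjection\<close>). The result is a
  submodule only if \<open>(n, b)\<close> is not a jump in the case of \<open>X\<close>, and is a jump in the case of \<open>Y\<close>, and
  then the surjection exists (\<open>surjection_exists\<close>). In terms of jumps, \<open>\<iota>\<close> toggles \<open>(n, b)\<close>, and
  multiplies \<open>h\<close> by \<open>z + n + b\<close> when the jump disappears (\<open>iota1_rank_one\<close>).

  It follows that \<open>\<iota>\<^sub>\<gamma> A\<close> has degree zero part \<open>h\<^sub>\<gamma> k[z]\<close> (\<open>degree_zero_part\<close>), so the maps in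
  \<open>D\<^sub>\<gamma>\<close> are the left multiplications by \<open>h\<^sub>\<gamma> r\<close> with \<open>r \<in> k[z]\<close> (\<open>D_hom_eq\<close>). Since
  \<open>h\<^sub>\<gamma> h\<^sub>\<delta> = h\<^bsub>\<gamma>+\<delta>\<^esub> h\<^bsub>\<gamma>\<inter>\<delta>\<^esub>\<^sup>2\<close> and \<open>\<Theta>\<close> divides by \<open>h\<^bsub>\<gamma>\<inter>\<delta>\<^esub>\<close>, the product of the elements with
  coordinates \<open>(\<gamma>, r)\<close> and \<open>(\<delta>, s)\<close> has coordinates \<open>(\<gamma> + \<delta>, h\<^bsub>\<gamma>\<inter>\<delta>\<^esub> r s)\<close>
  (\<open>D_hom_mult_D_map\<close>): \<open>D\<close> is a twisted group ring of \<open>\<Gamma>\<close> over \<open>k[z]\<close>.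

  In the presented algebra let \<open>z\<close> be the common value of \<open>c\<^sub>n\<^sup>2 - n\<close>. Then
  \<open>c\<^sub>n\<^sup>2 = z + n\<close> and \<open>d\<^sub>n\<^sup>2 = z + n + \<alpha>\<close>, so every element is a combination, with coefficients in \<open>k[z]\<close>,
  of the squarefree monomials \<open>c\<^sub>\<gamma>\<close>, one for each \<open>\<gamma> \<in> \<Gamma>\<close> (\<open>normal_form_cong\<close>). The
  squarefree monomials multiply by the same rule \<open>c\<^sub>\<gamma> c\<^sub>\<delta> = h\<^bsub>\<gamma>\<inter>\<delta>\<^esub>(z) c\<^bsub>\<gamma>+\<delta>\<^esub>\<close> (\<open>coords_mult\<close>). Sending
  \<open>g c\<^sub>\<gamma>\<close> to the element of \<open>D\<close> with coordinates \<open>(\<gamma>, g)\<close> is thus a surjective homomorphism, and its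
  kernel is the ideal of relations because a polynomial with zero coordinates is congruent to
  zero (\<open>coords_eq_zero_iff\<close>).\<close>

section \<open>Skew Laurent polynomials\<close>

definition qcoeff :: "'k::field qgr \<Rightarrow> int \<Rightarrow> 'k poly fract" where
  "qcoeff q i = Poly_Mapping.lookup (coeffs_qgr q) i"

lemma qcoeff_qmon: "qcoeff (qmon g j) i = (if i = j then g else 0)"
  by (simp add: qcoeff_def qmon_def Abs_qgr_inverse lookup_single when_def)

lemma qcoeff_add [simp]: "qcoeff (q + r) i = qcoeff q i + qcoeff r i"
  by (simp add: qcoeff_def plus_qgr.rep_eq lookup_add)

lemma qcoeff_zero [simp]: "qcoeff 0 i = 0"
  by (simp add: qcoeff_def zero_qgr.rep_eq)

lemma qcoeff_eqI: "(\<And>i. qcoeff q i = qcoeff r i) \<Longrightarrow> q = r"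
  by (metis qcoeff_def coeffs_qgr_inject poly_mapping_eqI)

lemma finite_qcoeff_support: "finite {i. qcoeff q i \<noteq> 0}"
  by (simp add: qcoeff_def)

lemma qmon_zero [simp]: "qmon 0 i = 0"
  by (simp add: qmon_def zero_qgr_def)

lemma qgr_induct [case_names qmon add]:
  assumes "\<And>g i. P (qmon g i)" and "\<And>q r. P q \<Longrightarrow> P r \<Longrightarrow> P (q + r)"
  shows "P q"
proof -
  have "P (Abs_qgr p)" for p
  proof (induction p rule: poly_mapping_additive_induct)
    case (single k v)
    then show ?case using assms(1) by (simp add: qmon_def)
  next
    case (add p q)
    then show ?case using assms(2) by (metis plus_qgr.abs_eq)
  qed
  then show ?thesis by (metis coeffs_qgr_inverse)
qed

lemma qcoeff_mult_qmon: "qcoeff (q * qmon g j) i = qcoeff q (i - j) * shift (i - j) g"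
  by (induction q rule: qgr_induct)
     (auto simp: qmon_mult qcoeff_qmon distrib_right)

lemma qcoeff_qrat_mult: "qcoeff (qrat g * q) i = g * qcoeff q i"
  by (induction q rule: qgr_induct)
     (auto simp: qmon_mult qcoeff_qmon distrib_left)

lemma qmon_component_iff: "q \<in> qgr_component i \<longleftrightarrow> (\<forall>j. j \<noteq> i \<longrightarrow> qcoeff q j = 0)"
proof
  show "\<forall>j. j \<noteq> i \<longrightarrow> qcoeff q j = 0 \<Longrightarrow> q \<in> qgr_component i"
    unfolding qgr_component_def
    by (rule image_eqI[of _ _ "qcoeff q i"]) (auto intro: qcoeff_eqI simp: qcoeff_qmon)
qed (auto simp: qgr_component_def qcoeff_qmon)


definition skew_laurent :: "'k::field qgr set" where
  "skew_laurent = {q. \<forall>i. \<exists>g. qcoeff q i = Fract g 1}"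

text \<open>Meaningful on \<open>skew_laurent\<close> only, where the coefficient \<open>qcoeff q i\<close> is a polynomial.\<close>

definition pcoeff :: "'k::field qgr \<Rightarrow> int \<Rightarrow> 'k poly" where
  "pcoeff q i = (THE g. qcoeff q i = Fract g 1)"

lemma Fract_1_inject [simp]: "Fract g 1 = Fract h 1 \<longleftrightarrow> g = (h :: 'a::idom)"
  by (simp add: eq_fract)

lemma Fract_1_eq_0 [simp]: "Fract g 1 = 0 \<longleftrightarrow> g = (0 :: 'a::idom)"
  by (simp add: Zero_fract_def)

lemma Fract_0_1 [simp]: "Fract 0 1 = (0 :: 'a::idom fract)"
  by simp

lemma pcoeffI: "qcoeff q i = Fract g 1 \<Longrightarrow> pcoeff q i = g"
  by (simp add: pcoeff_def)

lemma qcoeff_pcoeff: "q \<in> skew_laurent \<Longrightarrow> qcoeff q i = Fract (pcoeff q i) 1"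
  using pcoeffI by (fastforce simp: skew_laurent_def)

lemma pcoeff_qmon: "pcoeff (qmon (Fract g 1) j) i = (if i = j then g else 0)"
  by (rule pcoeffI) (simp add: qcoeff_qmon)

lemma qmon_skew_laurent [simp]: "qmon (Fract g 1) j \<in> skew_laurent"
  by (auto simp: skew_laurent_def qcoeff_qmon intro: exI[of _ 0])

lemma skew_laurent_add: "q \<in> skew_laurent \<Longrightarrow> r \<in> skew_laurent \<Longrightarrow> q + r \<in> skew_laurent"
  unfolding skew_laurent_def by (auto simp: qcoeff_pcoeff) (metis add_fract mult.right_neutral one_neq_zero)

lemma pcoeff_add: "q \<in> skew_laurent \<Longrightarrow> r \<in> skew_laurent \<Longrightarrow> pcoeff (q + r) i = pcoeff q i + pcoeff r i"
  by (rule pcoeffI) (simp add: qcoeff_pcoeff)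

lemma pcoeff_eqI: "q \<in> skew_laurent \<Longrightarrow> r \<in> skew_laurent \<Longrightarrow> (\<And>i. pcoeff q i = pcoeff r i) \<Longrightarrow> q = r"
  by (rule qcoeff_eqI) (simp add: qcoeff_pcoeff)

lemma finite_pcoeff_support: "q \<in> skew_laurent \<Longrightarrow> finite {i. pcoeff q i \<noteq> 0}"
  using finite_qcoeff_support[of q] by (simp add: qcoeff_pcoeff)

lemma skew_laurent_zero [simp]: "0 \<in> skew_laurent"
  by (auto simp: skew_laurent_def intro: exI[of _ 0])

lemma pcoeff_zero [simp]: "pcoeff 0 i = 0"
  by (rule pcoeffI) simp

lemma pcoeff_qpoly_mult:
  assumes "q \<in> skew_laurent"
  shows "qpoly g * q \<in> skew_laurent" and "pcoeff (qpoly g * q) i = g * pcoeff q i"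
proof -
  have *: "qcoeff (qpoly g * q) i = Fract (g * pcoeff q i) 1" for i
    using assms by (simp add: qcoeff_qrat_mult qcoeff_pcoeff)
  show "qpoly g * q \<in> skew_laurent" "pcoeff (qpoly g * q) i = g * pcoeff q i"
    using * by (auto simp: skew_laurent_def intro: pcoeffI)
qed

lemma pcoeff_mult_qmon:
  assumes "q \<in> skew_laurent"
  shows "q * qmon (Fract g 1) j \<in> skew_laurent"
    and "pcoeff (q * qmon (Fract g 1) j) i = pcoeff q (i - j) * pcompose g [:of_int (i - j), 1:]"
proof -
  have *: "qcoeff (q * qmon (Fract g 1) j) i =
      Fract (pcoeff q (i - j) * pcompose g [:of_int (i - j), 1:]) 1" for i
    using assms by (simp add: qcoeff_mult_qmon qcoeff_pcoeff shift_Fract pcompose_1)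
  show "q * qmon (Fract g 1) j \<in> skew_laurent"
    "pcoeff (q * qmon (Fract g 1) j) i = pcoeff q (i - j) * pcompose g [:of_int (i - j), 1:]"
    using * by (auto simp: skew_laurent_def intro: pcoeffI)
qed


definition translate :: "'k::field poly \<Rightarrow> int \<Rightarrow> 'k poly" where
  "translate f i = pcompose f [:of_int i, 1:]"

lemma poly_translate [simp]: "poly (translate f i) c = poly f (c + of_int i)"
  by (simp add: translate_def poly_pcompose add.commute)

lemma translate_translate: "translate (translate f i) j = translate f (i + j)"
  by (simp add: translate_def pcompose_assoc[symmetric] pcompose_pCons)

lemma feval_GX: "feval f (fgen GX) = qmon (Fract 1 1) 1"
  by (simp add: feval_gen One_fract_def)

lemma feval_GZ: "feval f (fgen GZ) = qmon (Fract [:0, 1:] 1) 0"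
  by (simp add: feval_gen)

lemma feval_GY: "feval f (fgen GY) = qmon (Fract (translate f (-1)) 1) (-1)"
  by (simp add: feval_gen qmon_mult shift_Fract pcompose_1 translate_def)

lemma
  assumes "q \<in> skew_laurent"
  shows pcoeff_mult_GX: "pcoeff (q * feval f (fgen GX)) i = pcoeff q (i - 1)"
    and pcoeff_mult_GY: "pcoeff (q * feval f (fgen GY)) i = pcoeff q (i + 1) * translate f i"
    and pcoeff_mult_GZ: "pcoeff (q * feval f (fgen GZ)) i = [:of_int i, 1:] * pcoeff q i"
    and pcoeff_mult_const: "pcoeff (q * feval f (fconst c)) i = smult c (pcoeff q i)"
proof -
  note * = pcoeff_mult_qmon[OF assms]
  show "pcoeff (q * feval f (fgen GX)) i = pcoeff q (i - 1)"
    unfolding feval_GX * by (simp add: pcompose_1)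
  show "pcoeff (q * feval f (fgen GY)) i = pcoeff q (i + 1) * translate f i"
    unfolding feval_GY * using translate_translate[of f "-1" "i+1"] by (simp add: translate_def)
  show "pcoeff (q * feval f (fgen GZ)) i = [:of_int i, 1:] * pcoeff q i"
    unfolding feval_GZ * by (simp add: pcompose_pCons)
  show "pcoeff (q * feval f (fconst c)) i = smult c (pcoeff q i)"
    unfolding feval_const * by (simp add: pcompose_pCons)
qed

text \<open>The free algebra is generated by constants and letters, so a statement on the right action of
  all its elements need only be checked for these and be stable under sums and products.\<close>

lemma falg_induct [case_names const gen add mult]:
  fixes a :: "'k::field falg"
  assumes c: "\<And>c. P (fconst c)" and g: "\<And>g. P (fgen g)"
    and a: "\<And>a b. P a \<Longrightarrow> P b \<Longrightarrow> P (a + b)" and m: "\<And>a b. P a \<Longrightarrow> P b \<Longrightarrow> P (a * b)"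
  shows "P a"
proof (induction a rule: poly_mapping_additive_induct)
  case (single w v)
  have "P (Poly_Mapping.single (Wrd l) v)" for l
  proof (induction l)
    case Nil
    then show ?case using c[of v] by (simp add: fconst_def zero_wrd_def)
  next
    case (Cons x l)
    have "Poly_Mapping.single (Wrd (x # l)) v = fgen x * Poly_Mapping.single (Wrd l) v"
      by (simp add: fgen_def mult_single plus_wrd_def)
    then show ?case using m[OF g Cons] by simp
  qed
  from this[of "letters w"] show ?case by simp
qed (rule a)


section \<open>Graded submodules cut out by divisibility\<close>

text \<open>A graded right submodule of rank one whose coefficients are polynomials: the component of degree
  \<open>i\<close> is \<open>p\<^sub>i k[z] x\<^sup>i\<close>.\<close>

definition graded_sub :: "(int \<Rightarrow> 'k::field poly) \<Rightarrow> 'k qgr set" where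
  "graded_sub p = {q \<in> skew_laurent. \<forall>i. p i dvd pcoeff q i}"

text \<open>The two divisibilities are the closure under right multiplication by \<open>x\<close> and by \<open>y\<close>: these send
  \<open>p\<^sub>i x\<^sup>i\<close> to \<open>p\<^sub>i x\<^bsup>i+1\<^esup>\<close> and \<open>p\<^bsub>i+1\<^esub> x\<^bsup>i+1\<^esup>\<close> to \<open>p\<^bsub>i+1\<^esub> f(z + i) x\<^sup>i\<close>.\<close>

definition right_stable :: "'k::field poly \<Rightarrow> (int \<Rightarrow> 'k poly) \<Rightarrow> bool" where
  "right_stable f p \<longleftrightarrow> (\<forall>i. p i \<noteq> 0 \<and> p (i + 1) dvd p i \<and> p i dvd p (i + 1) * translate f i)"

lemma graded_sub_add: "q \<in> graded_sub p \<Longrightarrow> r \<in> graded_sub p \<Longrightarrow> q + r \<in> graded_sub p"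
  by (auto simp: graded_sub_def pcoeff_add skew_laurent_add)

lemma graded_sub_zero [simp]: "0 \<in> graded_sub p"
  by (simp add: graded_sub_def)

lemma graded_sub_skew_laurent: "q \<in> graded_sub p \<Longrightarrow> q \<in> skew_laurent"
  by (simp add: graded_sub_def)

lemma graded_sub_mult_feval:
  assumes "right_stable f p" "q \<in> graded_sub p"
  shows "q * feval f a \<in> graded_sub p"
  using assms(2)
proof (induction a arbitrary: q rule: falg_induct)
  case (const c)
  then show ?case
    by (auto simp: graded_sub_def pcoeff_mult_const dvd_smult) (simp add: feval_const pcoeff_mult_qmon)
next
  case (gen g)
  then have q: "q \<in> skew_laurent" and d: "\<And>i. p i dvd pcoeff q i" by (auto simp: graded_sub_def)
  have s: "p (i + 1) dvd p i" "p i dvd p (i + 1) * translate f i" for i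
    using assms(1) by (auto simp: right_stable_def)
  show ?case
  proof (cases g)
    case GX
    have "p i dvd pcoeff q (i - 1)" for i
      using s(1)[of "i - 1"] d[of "i - 1"] by (auto intro: dvd_trans)
    then show ?thesis
      using q unfolding graded_sub_def GX by (auto simp: pcoeff_mult_GX) (simp add: feval_GX pcoeff_mult_qmon)
  next
    case GY
    have "p i dvd pcoeff q (i + 1) * translate f i" for i
      using s(2)[of i] d[of "i + 1"] by (meson dvd_trans dvd_refl mult_dvd_mono)
    then show ?thesis
      using q unfolding graded_sub_def GY by (auto simp: pcoeff_mult_GY) (simp add: feval_GY pcoeff_mult_qmon)
  next
    case GZ
    then show ?thesis
      using q d unfolding graded_sub_def GZ
      by (auto simp: pcoeff_mult_GZ simp del: mult_pCons_left) (simp add: feval_GZ pcoeff_mult_qmon)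
  qed
next
  case (add a b)
  then show ?case by (simp add: feval_add distrib_left graded_sub_add)
next
  case (mult a b)
  then show ?case by (simp add: feval_mult mult.assoc[symmetric])
qed

lemma graded_sub_induct [consumes 1, case_names mon add]:
  assumes q: "q \<in> graded_sub p"
    and m: "\<And>g i. P (qmon (Fract (p i * g) 1) i)"
    and a: "\<And>q r. q \<in> graded_sub p \<Longrightarrow> r \<in> graded_sub p \<Longrightarrow> P q \<Longrightarrow> P r \<Longrightarrow> P (q + r)"
  shows "P q"
proof -
  have "\<forall>q\<in>graded_sub p. {i. pcoeff q i \<noteq> 0} = A \<longrightarrow> P q" if "finite A" for A
    using that
  proof (induction A)
    case empty
    have "q = 0" if "q \<in> graded_sub p" "{i. pcoeff q i \<noteq> 0} = {}" for q
      using that by (intro pcoeff_eqI) (auto simp: graded_sub_skew_laurent)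
    then show ?case using m[of _ 0] by auto
  next
    case (insert j A)
    show ?case
    proof (intro ballI impI)
      fix q assume q: "q \<in> graded_sub p" "{i. pcoeff q i \<noteq> 0} = insert j A"
      define q1 where "q1 = qmon (Fract (pcoeff q j) 1) j"
      define q2 where "q2 = q + qmon (Fract (- pcoeff q j) 1) j"
      have qq: "q \<in> skew_laurent" using q by (simp add: graded_sub_def)
      have q2: "pcoeff q2 i = (if i = j then 0 else pcoeff q i)" for i
        using qq by (simp add: q2_def pcoeff_add pcoeff_qmon)
      have q1: "q1 \<in> graded_sub p" "q2 \<in> graded_sub p"
        using q(1) q2 qq by (auto simp: graded_sub_def q1_def pcoeff_qmon q2_def skew_laurent_add)
      have "q = q1 + q2"
        by (rule pcoeff_eqI) (use q1 qq in \<open>auto simp: graded_sub_skew_laurent skew_laurent_add pcoeff_add q2, auto simp: q1_def pcoeff_qmon\<close>)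
      moreover have "{i. pcoeff q2 i \<noteq> 0} = A"
        using q(2) insert.hyps(2) by (auto simp: q2)
      moreover obtain g where "pcoeff q j = p j * g"
        using q(1) by (auto simp: graded_sub_def elim: dvdE)
      ultimately show "P q"
        using insert.IH q1 a m[of j g] by (auto simp: q1_def)
    qed
  qed
  then show ?thesis
    using q finite_pcoeff_support[OF graded_sub_skew_laurent[OF q]] by blast
qed

section \<open>Surjections onto modules with one-dimensional weight spaces\<close>

lemma gwa_carrier: "carrier (gwa f) = range (gwa_cls f)"
  by (auto simp: gwa_def FactRing_def A_RCOSETS_def' gwa_cls_def)

text \<open>A coordinate description of a graded module: \<open>S\<close> has a basis \<open>\<epsilon>\<^sub>i\<close> (\<open>i \<in> I\<close>) with \<open>\<epsilon>\<^sub>i\<close> of degree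
  \<open>i\<close>, and \<open>\<epsilon>\<^sub>i x = \<epsilon>\<^bsub>i+1\<^esub>\<close>, \<open>\<epsilon>\<^sub>i z = (c + i) \<epsilon>\<^sub>i\<close>, \<open>\<epsilon>\<^sub>i y = f(c + i - 1) \<epsilon>\<^bsub>i-1\<^esub>\<close>, where
  basis vectors with an index outside \<open>I\<close> count as zero. The surjection \<open>\<kappa>\<close> presents \<open>S\<close> as a
  quotient of the free algebra, and \<open>e a\<close> is the coordinate vector of \<open>\<kappa> a\<close>. Both \<open>X\<^sub>b\<langle>n\<rangle>\<close> and
  \<open>Y\<^sub>b\<langle>n\<rangle>\<close> are of this kind with \<open>c = - n - b\<close>; only \<open>I\<close> distinguishes them.\<close>

locale weight_model =
  fixes f :: "'k::field poly" and S :: "('k falg set, 'm) gr_module"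
    and c :: 'k and I :: "int set"
    and \<kappa> :: "'k falg \<Rightarrow> 'm" and e :: "'k falg \<Rightarrow> int \<Rightarrow> 'k"
  assumes carrier_S: "carrier S = range \<kappa>"
    and zero_S: "\<zero>\<^bsub>S\<^esub> = \<kappa> 0"
    and add_S: "\<kappa> a \<oplus>\<^bsub>S\<^esub> \<kappa> b = \<kappa> (a + b)"
    and ract_S: "ract S (\<kappa> a) (gwa_cls f b) = \<kappa> (a * b)"
    and component_S: "component S i = \<kappa> ` {a. \<forall>j. j \<noteq> i \<longrightarrow> e a j = 0}"
    and kappa_eq_iff: "\<kappa> a = \<kappa> b \<longleftrightarrow> e a = e b"
    and e_add: "e (a + b) i = e a i + e b i"
    and e_const: "e (a * fconst x) i = x * e a i"
    and e_GX: "e (a * fgen GX) i = (if i \<in> I then e a (i - 1) else 0)"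
    and e_GY: "e (a * fgen GY) i = (if i \<in> I then poly f (c + of_int i) * e a (i + 1) else 0)"
    and e_GZ: "e (a * fgen GZ) i = (c + of_int i) * e a i"
    and range_e: "range e = {v. finite {i. v i \<noteq> 0} \<and> (\<forall>i. i \<notin> I \<longrightarrow> v i = 0)}"
begin

lemma e_zero [simp]: "e 0 i = 0"
  using e_add[of 0 0 i] by (metis add_0 add_cancel_right_right)

lemma e_outside: "i \<notin> I \<Longrightarrow> e a i = 0"
  and finite_e: "finite {i. e a i \<noteq> 0}"
  using rangeI[of e a] unfolding range_e by auto

context
  fixes p :: "int \<Rightarrow> 'k poly" and \<phi> :: "'k qgr \<Rightarrow> 'm"
  assumes ok: "right_stable f p" and hom: "\<phi> \<in> gr_hom f (qgr_sub f (graded_sub p)) S"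
begin

text \<open>The coordinate vector of \<open>\<phi> q\<close>; it does not depend on the chosen preimage.\<close>

definition hom_value :: "'k qgr \<Rightarrow> int \<Rightarrow> 'k" where
  "hom_value q = e (SOME a. \<kappa> a = \<phi> q)"

lemma hom_value_eq: "\<phi> q = \<kappa> a \<Longrightarrow> hom_value q = e a"
  unfolding hom_value_def by (metis (mono_tags) kappa_eq_iff someI)

lemma hom_in_range:
  assumes "q \<in> graded_sub p" obtains a where "\<phi> q = \<kappa> a" "hom_value q = e a"
proof -
  have "\<phi> q \<in> carrier S" using assms hom by (auto simp: gr_hom_def qgr_sub_def)
  then show ?thesis using that hom_value_eq by (auto simp: carrier_S)
qed

lemma hom_value_add:
  assumes "q \<in> graded_sub p" "r \<in> graded_sub p" shows "hom_value (q + r) i = hom_value q i + hom_value r i"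
proof -
  obtain a b where a: "\<phi> q = \<kappa> a" "hom_value q = e a" and b: "\<phi> r = \<kappa> b" "hom_value r = e b"
    using assms by (metis hom_in_range)
  have "\<phi> (q + r) = \<kappa> (a + b)"
    using hom assms a b by (simp add: gr_hom_def qgr_sub_def add_S)
  then show ?thesis using a b by (simp add: hom_value_eq e_add)
qed

lemma hom_feval:
  assumes "q \<in> graded_sub p" "\<phi> q = \<kappa> a" shows "\<phi> (q * feval f b) = \<kappa> (a * b)"
proof -
  have "\<phi> (q * gwa_emb f (gwa_cls f b)) = ract S (\<phi> q) (gwa_cls f b)"
    using hom assms(1) gwa_carrier[of f] by (auto simp add: gr_hom_def qgr_sub_def)
  then show ?thesis using assms(2) by (simp add: ract_S gwa_emb_cls)
qed

lemma hom_eq_zero_iff: "q \<in> graded_sub p \<Longrightarrow> \<phi> q = \<zero>\<^bsub>S\<^esub> \<longleftrightarrow> (\<forall>i. hom_value q i = 0)"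
  by (metis hom_in_range zero_S kappa_eq_iff e_zero ext)

lemma hom_value_homogeneous:
  assumes "qmon (Fract g 1) i \<in> graded_sub p" "j \<noteq> i" shows "hom_value (qmon (Fract g 1) i) j = 0"
proof -
  have "\<phi> (qmon (Fract g 1) i) \<in> component S i"
    using hom assms(1) by (auto simp add: gr_hom_def qgr_sub_def qgr_component_def)
  then show ?thesis using assms(2) by (auto simp: component_S hom_value_eq)
qed

lemma mon_graded_sub: "qmon (Fract (p i * g) 1) i \<in> graded_sub p"
  by (auto simp: graded_sub_def pcoeff_qmon)

text \<open>Left multiplication by \<open>z\<close> in degree \<open>i\<close> is right multiplication by \<open>z - i\<close>, which acts on the
  component of degree \<open>i\<close> of \<open>S\<close> as the scalar \<open>c\<close>. So left multiplication by a polynomial \<open>g\<close> turns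
  into multiplication by the number \<open>g(c)\<close>.\<close>

lemma hom_value_mon:
  "hom_value (qmon (Fract (p i * g) 1) i) i = poly g c * hom_value (qmon (Fract (p i) 1) i) i"
proof (induction g)
  case 0
  have "hom_value 0 i = e 0 i"
    by (rule arg_cong[where f = "\<lambda>x. x i"], rule hom_value_eq)
      (use hom_feval[of 0 _ 0] hom_in_range[of 0] in \<open>metis mult_zero_left mult_zero_right graded_sub_zero\<close>)
  then show ?case by simp
next
  case (pCons a g)
  let ?b = "qmon (Fract (p i) 1) i" and ?m = "qmon (Fract (p i * g) 1) i"
  have b: "?b \<in> graded_sub p" using mon_graded_sub[of i 1] by simp
  obtain a1 where a1: "\<phi> ?b = \<kappa> a1" "hom_value ?b = e a1" using b hom_in_range by blast
  obtain a2 where a2: "\<phi> ?m = \<kappa> a2" "hom_value ?m = e a2" using mon_graded_sub hom_in_range by blast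
  \<comment> \<open>acts on the right of \<open>x\<^sup>i\<close> as \<open>z\<close> does on the left\<close>
  let ?z = "fgen GZ + fconst (- of_int i) :: 'k falg"
  have z: "feval f ?z = qmon (Fract [:- of_int i, 1:] 1) 0"
    by (simp add: feval_add feval_GZ feval_const flip: qmon_add)
  have c: "feval f (fconst a) = qmon (Fract [:a:] 1) 0"
    by (simp add: feval_const)
  have eq: "qmon (Fract (p i * pCons a g) 1) i = ?b * feval f (fconst a) + ?m * feval f ?z"
    unfolding z c
    by (simp add: qmon_mult shift_Fract pcompose_1 pcompose_pCons flip: qmon_add)
  have "hom_value (qmon (Fract (p i * pCons a g) 1) i) i =
      hom_value (?b * feval f (fconst a)) i + hom_value (?m * feval f ?z) i"
    unfolding eq by (intro hom_value_add graded_sub_mult_feval ok b mon_graded_sub)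
  also have "hom_value (?b * feval f (fconst a)) = e (a1 * fconst a)"
    by (intro hom_value_eq hom_feval b a1)
  also have "hom_value (?m * feval f ?z) = e (a2 * ?z)"
    by (intro hom_value_eq hom_feval mon_graded_sub a2)
  also have "e (a2 * ?z) i = c * e a2 i"
    by (simp add: distrib_left e_add e_GZ e_const algebra_simps)
  also have "e a2 i = poly g c * hom_value ?b i"
    using pCons.IH a2 by simp
  finally show ?case
    using a1 by (simp add: e_const algebra_simps)
qed

lemma hom_value_graded_sub:
  assumes "q \<in> graded_sub p"
  shows "hom_value q i = poly (pcoeff q i div p i) c * hom_value (qmon (Fract (p i) 1) i) i"
  using assms
proof (induction rule: graded_sub_induct)
  case (mon g j)
  have "p i \<noteq> 0" using ok by (simp add: right_stable_def)
  then show ?case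
    using hom_value_homogeneous[OF mon_graded_sub, of i j g] hom_value_mon[of i g] by (auto simp: pcoeff_qmon)
next
  case (add q r)
  then have "p i dvd pcoeff q i" "p i dvd pcoeff r i" by (auto simp: graded_sub_def)
  then show ?case
    using add by (simp add: hom_value_add pcoeff_add graded_sub_skew_laurent div_plus_div_distrib_dvd_left algebra_simps)
qed

text \<open>A homogeneous element \<open>p\<^sub>i g x\<^sup>i\<close> goes to \<open>g(c)\<close> times the image of \<open>p\<^sub>i x\<^sup>i\<close>. For \<open>i \<in> I\<close> that image
  is nonzero, since otherwise the component of degree \<open>i\<close> would not be hit. So the element lies in
  the kernel exactly if \<open>g(c) = 0\<close>.\<close>

lemma kernel_of_surjection:
  assumes surj: "\<phi> ` graded_sub p = carrier S"
  shows "{q \<in> graded_sub p. \<phi> q = \<zero>\<^bsub>S\<^esub>} = {q \<in> graded_sub p. \<forall>i\<in>I. p i * [:- c, 1:] dvd pcoeff q i}"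
proof -
  have nz: "hom_value (qmon (Fract (p i) 1) i) i \<noteq> 0" if "i \<in> I" for i
  proof
    assume 0: "hom_value (qmon (Fract (p i) 1) i) i = 0"
    have "(\<lambda>j. if j = i then 1 else 0) \<in> range e"
      using that unfolding range_e by simp
    then obtain a where a: "e a = (\<lambda>j. if j = i then 1 else 0)" by auto
    obtain q where "q \<in> graded_sub p" "\<phi> q = \<kappa> a"
      using surj by (metis carrier_S imageE rangeI)
    then have "hom_value q i = 1" using a by (metis hom_value_eq)
    moreover have "hom_value q i = 0" using \<open>q \<in> graded_sub p\<close> 0 by (simp add: hom_value_graded_sub)
    ultimately show False by simp
  qed
  have "\<phi> q = \<zero>\<^bsub>S\<^esub> \<longleftrightarrow> (\<forall>i\<in>I. p i * [:- c, 1:] dvd pcoeff q i)" if q: "q \<in> graded_sub p" for q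
  proof -
    have "hom_value q i = 0 \<longleftrightarrow> p i * [:- c, 1:] dvd pcoeff q i" if "i \<in> I" for i
    proof -
      have "p i dvd pcoeff q i" "p i \<noteq> 0" using q ok by (auto simp: graded_sub_def right_stable_def)
      then obtain g where g: "pcoeff q i = p i * g" by (auto elim: dvdE)
      then have "hom_value q i = 0 \<longleftrightarrow> poly g c = 0"
        using \<open>p i \<noteq> 0\<close> nz[OF that] by (simp add: hom_value_graded_sub[OF q])
      moreover have "p i * [:- c, 1:] dvd p i * g \<longleftrightarrow> poly g c = 0"
        using \<open>p i \<noteq> 0\<close> by (simp only: dvd_mult_cancel_left poly_eq_0_iff_dvd) simp
      ultimately show ?thesis using g by simp
    qed
    moreover have "hom_value q i = 0" if "i \<notin> I" for i
      using hom_in_range[OF q] e_outside[OF that] by metis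
    ultimately show ?thesis using hom_eq_zero_iff[OF q] by blast
  qed
  then show ?thesis by blast
qed

lemma kernel_mult_feval:
  assumes "q \<in> graded_sub p" "\<phi> q = \<zero>\<^bsub>S\<^esub>" shows "\<phi> (q * feval f b) = \<zero>\<^bsub>S\<^esub>"
  using hom_feval[of q 0 b] assms by (simp add: zero_S)

end

text \<open>The map takes the value at \<open>c\<close> of each coefficient \<open>q\<^sub>i / p\<^sub>i\<close> with \<open>i \<in> I\<close>, rescaled by
  \<open>lam i\<close> because the quotients \<open>p\<^sub>i / p\<^bsub>i+1\<^esub> = r i\<close> need not have value \<open>1\<close> at \<open>c\<close>. The last two
  hypotheses concern the boundary of \<open>I\<close>: whatever \<open>x\<close> or \<open>y\<close> carries into \<open>I\<close> from outside must
  have value zero at \<open>c\<close>.\<close>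

lemma surjection_exists:
  fixes p r s :: "int \<Rightarrow> 'k poly"
  assumes ok: "right_stable f p"
    and r: "\<And>i. p i = r i * p (i + 1)" and s: "\<And>i. r i * s i = translate f i"
    and lam: "\<And>i. i \<in> I \<Longrightarrow> lam i \<noteq> 0"
    and lam_step: "\<And>i. i \<in> I \<Longrightarrow> i + 1 \<in> I \<Longrightarrow> lam i = poly (r i) c * lam (i + 1)"
    and enter: "\<And>i. i \<notin> I \<Longrightarrow> i + 1 \<in> I \<Longrightarrow> poly (r i) c = 0"
    and leave: "\<And>i. i \<in> I \<Longrightarrow> i + 1 \<notin> I \<Longrightarrow> poly (s i) c = 0"
  shows "\<exists>\<phi>\<in>gr_hom f (qgr_sub f (graded_sub p)) S. \<phi> ` graded_sub p = carrier S"
proof -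
  have p0: "p i \<noteq> 0" for i using ok by (simp add: right_stable_def)
  define cf where "cf q i = pcoeff q i div p i" for q i
  have cf: "pcoeff q i = p i * cf q i" if "q \<in> graded_sub p" for q i
    using that by (simp add: graded_sub_def cf_def)
  have cfI: "cf q i = g" if "pcoeff q i = p i * g" for q i g
    using that p0 by (simp add: cf_def)
  define v where "v q i = (if i \<in> I then lam i * poly (cf q i) c else 0)" for q i
  have v_range: "v q \<in> range e" if "q \<in> graded_sub p" for q
  proof -
    have "{i. v q i \<noteq> 0} \<subseteq> {i. pcoeff q i \<noteq> 0}" by (auto simp: v_def cf_def)
    then have "finite {i. v q i \<noteq> 0}"
      using finite_pcoeff_support[OF graded_sub_skew_laurent[OF that]] by (rule finite_subset)
    then show ?thesis by (simp add: range_e) (simp add: v_def)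
  qed
  define \<psi> where "\<psi> q = (SOME a. e a = v q)" for q
  have psi: "e (\<psi> q) = v q" if "q \<in> graded_sub p" for q
    unfolding \<psi>_def using v_range[OF that] by (metis (mono_tags, lifting) imageE someI)
  define \<phi> where "\<phi> q = (if q \<in> graded_sub p then \<kappa> (\<psi> q) else \<zero>\<^bsub>S\<^esub>)" for q
  have cf_add: "cf (q + r) i = cf q i + cf r i" if "q \<in> graded_sub p" "r \<in> graded_sub p" for q r i
    using that by (intro cfI) (simp add: pcoeff_add graded_sub_skew_laurent cf distrib_left)
  have v_add: "v (q + r) i = v q i + v r i" if "q \<in> graded_sub p" "r \<in> graded_sub p" for q r i
    using that by (simp add: v_def cf_add distrib_left)
  have v_act: "v (q * feval f a) = e (\<psi> q * a)" if "q \<in> graded_sub p" for q a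
    using that
  proof (induction a arbitrary: q rule: falg_induct)
    case (const x)
    have "cf (q * feval f (fconst x)) i = smult x (cf q i)" for i
      by (intro cfI) (simp add: pcoeff_mult_const graded_sub_skew_laurent[OF const] cf[OF const])
    then show ?case using psi[OF const] by (auto simp: v_def e_const)
  next
    case (gen g)
    note q = graded_sub_skew_laurent[OF gen]
    show ?case
    proof (cases g)
      case GX
      have "cf (q * feval f (fgen GX)) i = r (i - 1) * cf q (i - 1)" for i
        using r[of "i - 1"] by (intro cfI) (simp add: pcoeff_mult_GX q cf[OF gen] algebra_simps)
      moreover have "lam i * (poly (r (i - 1)) c) = (if i - 1 \<in> I then lam (i - 1) else 0)"
        if "i \<in> I" for i
        using that lam_step[of "i - 1"] enter[of "i - 1"] by (auto simp: mult.commute)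
      ultimately show ?thesis
        using psi[OF gen] by (auto simp: GX v_def e_GX mult.assoc[symmetric])
    next
      case GY
      have "cf (q * feval f (fgen GY)) i = s i * cf q (i + 1)" for i
        using r[of i] s[of i, symmetric]
        by (intro cfI) (simp add: pcoeff_mult_GY q cf[OF gen] algebra_simps)
      moreover have "lam i * (poly (s i) c) =
          (if i + 1 \<in> I then poly f (c + of_int i) * lam (i + 1) else 0)"
        if "i \<in> I" for i
        using that lam_step[of i] leave[of i] arg_cong[OF s[of i], of "\<lambda>g. poly g c"]
        by (auto simp: mult.commute mult.left_commute)
      ultimately show ?thesis
        using psi[OF gen] by (auto simp: GY v_def e_GY mult.assoc[symmetric])
    next
      case GZ
      have "cf (q * feval f (fgen GZ)) i = [:of_int i, 1:] * cf q i" for i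
        by (intro cfI) (simp add: pcoeff_mult_GZ q cf[OF gen] algebra_simps del: mult_pCons_left)
      then show ?thesis
        using psi[OF gen] by (auto simp: GZ v_def e_GZ algebra_simps)
    qed
  next
    case (add a b)
    have "v (q * feval f (a + b)) i = v (q * feval f a) i + v (q * feval f b) i" for i
      by (simp add: feval_add distrib_left v_add graded_sub_mult_feval ok add.prems)
    then show ?case
      using add by (auto simp: distrib_left e_add)
  next
    case (mult a b)
    have qa: "q * feval f a \<in> graded_sub p" using mult.prems ok by (rule graded_sub_mult_feval[rotated])
    have "v (q * feval f (a * b)) = v (q * feval f a * feval f b)"
      by (simp add: feval_mult mult.assoc)
    also have "\<dots> = e (\<psi> (q * feval f a) * b)" by (rule mult.IH(2)[OF qa])
    also have "\<dots> = e (\<psi> q * a * b)"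
    proof -
      have "\<kappa> (\<psi> (q * feval f a)) = \<kappa> (\<psi> q * a)"
        using psi[OF qa] mult.IH(1)[OF mult.prems] by (simp add: kappa_eq_iff)
      then show ?thesis by (metis ract_S kappa_eq_iff)
    qed
    finally show ?case by (simp add: mult.assoc)
  qed
  have "\<phi> \<in> gr_hom f (qgr_sub f (graded_sub p)) S"
    unfolding gr_hom_def
  proof (intro CollectI conjI ballI allI impI)
    fix q assume "q \<in> carrier (qgr_sub f (graded_sub p))"
    then show "\<phi> q \<in> carrier S" by (simp add: qgr_sub_def \<phi>_def carrier_S)
  next
    fix q assume "q \<notin> carrier (qgr_sub f (graded_sub p))"
    then show "\<phi> q = \<zero>\<^bsub>S\<^esub>" by (simp add: qgr_sub_def \<phi>_def)
  next
    fix q r assume "q \<in> carrier (qgr_sub f (graded_sub p))" "r \<in> carrier (qgr_sub f (graded_sub p))"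
    then have qr: "q \<in> graded_sub p" "r \<in> graded_sub p" by (auto simp: qgr_sub_def)
    have "e (\<psi> (q + r)) = e (\<psi> q + \<psi> r)"
      by (auto simp: psi qr graded_sub_add e_add v_add)
    then show "\<phi> (q \<oplus>\<^bsub>qgr_sub f (graded_sub p)\<^esub> r) = \<phi> q \<oplus>\<^bsub>S\<^esub> \<phi> r"
      by (simp add: qgr_sub_def \<phi>_def qr graded_sub_add add_S kappa_eq_iff)
  next
    fix q a assume "q \<in> carrier (qgr_sub f (graded_sub p))" "a \<in> carrier (gwa f)"
    then obtain b where q: "q \<in> graded_sub p" and b: "a = gwa_cls f b"
      by (auto simp: qgr_sub_def gwa_carrier)
    show "\<phi> (ract (qgr_sub f (graded_sub p)) q a) = ract S (\<phi> q) a"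
      using q graded_sub_mult_feval[OF ok q, of b]
      by (simp add: b qgr_sub_def \<phi>_def gwa_emb_cls ract_S kappa_eq_iff psi v_act)
  next
    fix i q assume "q \<in> component (qgr_sub f (graded_sub p)) i"
    then have q: "q \<in> graded_sub p" "q \<in> qgr_component i" by (auto simp: qgr_sub_def)
    have "v q j = 0" if "j \<noteq> i" for j
    proof -
      have "pcoeff q j = 0"
        using q(2) that by (intro pcoeffI) (simp add: qmon_component_iff)
      then show ?thesis by (simp add: v_def cf_def)
    qed
    then show "\<phi> q \<in> component S i"
      using q(1) by (auto simp: component_S \<phi>_def psi)
  qed
  moreover have "\<phi> ` graded_sub p = carrier S"
  proof
    show "carrier S \<subseteq> \<phi> ` graded_sub p"
    proof
      fix m assume "m \<in> carrier S"
      then obtain a where a: "m = \<kappa> a" by (auto simp: carrier_S)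
      \<comment> \<open>surjectivity by removing one nonzero coordinate at a time\<close>
      have "\<forall>a. {i. e a i \<noteq> 0} = A \<longrightarrow> (\<exists>q\<in>graded_sub p. v q = e a)" if "finite A" for A
        using that
      proof (induction A)
        case empty
        then show ?case by (auto intro!: bexI[of _ 0] simp: v_def cf_def)
      next
        case (insert j A)
        show ?case
        proof (intro allI impI)
          fix a assume a: "{i. e a i \<noteq> 0} = insert j A"
          then have j: "j \<in> I" using e_outside by auto
          have "(\<lambda>i. if i = j then 0 else e a i) \<in> range e"
          proof -
            have "{i. (if i = j then 0 else e a i) \<noteq> 0} = A" using a insert.hyps by auto
            then have "finite {i. (if i = j then 0 else e a i) \<noteq> 0}" using insert.hyps by (simp only:)
            then show ?thesis unfolding range_e using e_outside by simp
          qed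
          then obtain b where b: "e b = (\<lambda>i. if i = j then 0 else e a i)" by auto
          have "{i. e b i \<noteq> 0} = A" using a insert.hyps by (auto simp: b)
          then obtain q where q: "q \<in> graded_sub p" "v q = e b" using insert.IH by blast
          define q' where "q' = qmon (Fract (p j * [:e a j / lam j:]) 1) j"
          have q': "q' \<in> graded_sub p" by (auto simp: q'_def graded_sub_def pcoeff_qmon dvd_smult)
          have "cf q' i = (if i = j then [:e a j / lam j:] else 0)" for i
            by (intro cfI) (simp add: q'_def pcoeff_qmon)
          then have "v q' i = (if i = j then e a j else 0)" for i
            using lam[OF j] j by (simp add: v_def)
          then have "v (q + q') i = e a i" for i
            using v_add[OF q(1) q'] by (simp add: q(2) b)
          then show "\<exists>q\<in>graded_sub p. v q = e a"
            using q q' by (auto intro!: bexI[of _ "q + q'"] graded_sub_add)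
        qed
      qed
      then obtain q where "q \<in> graded_sub p" "v q = e a" using finite_e by blast
      then show "m \<in> \<phi> ` graded_sub p"
        by (auto simp: a \<phi>_def kappa_eq_iff psi intro!: image_eqI[of _ _ q])
    qed
  qed (auto simp: \<phi>_def carrier_S)
  ultimately show ?thesis by blast
qed

end

text \<open>The shift \<open>\<langle>n\<rangle>\<close> moves degree \<open>i\<close> to \<open>i + n\<close> and leaves the eigenvalue of \<open>z\<close> alone; as this
  eigenvalue is \<open>c\<close> plus the degree, \<open>c\<close> decreases by \<open>n\<close>.\<close>

lemma weight_model_shift:
  assumes "weight_model f S c I \<kappa> e"
  shows "weight_model f (gr_shift S n) (c - of_int n) {i. i - n \<in> I} \<kappa> (\<lambda>a i. e a (i - n))"
proof -
  interpret weight_model f S c I \<kappa> e by fact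
  show ?thesis
  proof
    fix a b i
    have "(\<forall>j. j \<noteq> i \<longrightarrow> e a (j - n) = 0) \<longleftrightarrow> (\<forall>j. j \<noteq> i - n \<longrightarrow> e a j = 0)" for a
    proof safe
      fix j assume *: "\<forall>j. j \<noteq> i \<longrightarrow> e a (j - n) = 0" "j \<noteq> i - n"
      show "e a j = 0" using *(1)[rule_format, of "j + n"] *(2) by simp
    qed auto
    then show "component (gr_shift S n) i = \<kappa> ` {a. \<forall>j. j \<noteq> i \<longrightarrow> e a (j - n) = 0}"
      by (simp add: gr_shift_def component_S)
    show "\<kappa> a = \<kappa> b \<longleftrightarrow> (\<lambda>i. e a (i - n)) = (\<lambda>i. e b (i - n))"
    proof
      assume "(\<lambda>i. e a (i - n)) = (\<lambda>i. e b (i - n))"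
      then have "e a i = e b i" for i using fun_cong[of _ _ "i + n"] by fastforce
      then show "\<kappa> a = \<kappa> b" by (auto simp: kappa_eq_iff)
    qed (simp add: kappa_eq_iff)
    show "range (\<lambda>a i. e a (i - n)) =
        {v. finite {i. v i \<noteq> 0} \<and> (\<forall>i. i \<notin> {i. i - n \<in> I} \<longrightarrow> v i = 0)}" (is "?L = ?R")
    proof
      show "?L \<subseteq> ?R"
      proof safe
        fix a
        have "{i. e a (i - n) \<noteq> 0} = (\<lambda>i. i + n) ` {i. e a i \<noteq> 0}"
          by (force simp: image_iff)
        then show "finite {i. e a (i - n) \<noteq> 0}" by (simp only: finite_imageI finite_e)
      qed (use e_outside in auto)
      show "?R \<subseteq> ?L"
      proof safe
        fix v :: "int \<Rightarrow> 'a" assume v: "finite {i. v i \<noteq> 0}" "\<forall>i. i \<notin> {i. i - n \<in> I} \<longrightarrow> v i = 0"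
        have "{i. v (i + n) \<noteq> 0} = (\<lambda>i. i - n) ` {i. v i \<noteq> 0}"
          by (force simp: image_iff)
        then have "finite {i. v (i + n) \<noteq> 0}" using v(1) by (simp only: finite_imageI)
        then have "(\<lambda>i. v (i + n)) \<in> range e"
          using v(2) unfolding range_e by simp
        then obtain a where "e a = (\<lambda>i. v (i + n))" by auto
        then show "v \<in> range (\<lambda>a i. e a (i - n))"
          by (auto intro!: image_eqI[of _ _ a])
      qed
    qed
  qed (auto simp: gr_shift_def carrier_S zero_S add_S ract_S e_add e_const e_GX e_GY e_GZ algebra_simps)
qed

section \<open>Rank one projectives described by jumps\<close>

definition lin :: "int \<times> 'k::field \<Rightarrow> 'k poly" where
  "lin t = [:of_int (fst t) + snd t, 1:]"

lemma lin_nonzero [simp]: "lin t \<noteq> 0"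
  by (simp add: lin_def)

lemma poly_lin: "poly (lin t) c = of_int (fst t) + snd t + c"
  by (simp add: lin_def)

text \<open>The product of the jumps in degrees at least \<open>i\<close>; a jump \<open>(n, b)\<close> enlarges the divisor in all
  degrees up to \<open>n\<close>.\<close>

definition tail_prod :: "(int \<times> 'k::field) set \<Rightarrow> int \<Rightarrow> 'k poly" where
  "tail_prod T i = (\<Prod>t\<in>{t\<in>T. i \<le> fst t}. lin t)"

text \<open>Boundedness above makes the products over tails finite; infinitely many negative jumps are needed
  already for the algebra \<open>A\<close> itself.\<close>

definition jump_set :: "'k::field \<Rightarrow> (int \<times> 'k) set \<Rightarrow> bool" where
  "jump_set \<alpha> T \<longleftrightarrow> T \<subseteq> UNIV \<times> {0, \<alpha>} \<and> (\<exists>N. \<forall>t\<in>T. fst t \<le> N)"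

lemma finite_tail:
  assumes "jump_set \<alpha> T" shows "finite {t\<in>T. i \<le> fst t}"
proof -
  obtain N where N: "\<forall>t\<in>T. fst t \<le> N" and T: "T \<subseteq> UNIV \<times> {0, \<alpha>}"
    using assms by (auto simp: jump_set_def)
  have "{t\<in>T. i \<le> fst t} \<subseteq> {i..N} \<times> {0, \<alpha>}" using N T by auto
  then show ?thesis by (rule finite_subset) simp
qed

lemma jump_set_subset: "jump_set \<alpha> T \<Longrightarrow> T' \<subseteq> T \<Longrightarrow> jump_set \<alpha> T'"
  unfolding jump_set_def by blast

lemma tail_prod_nonzero [simp]: "tail_prod T i \<noteq> 0"
  by (cases "finite {t\<in>T. i \<le> fst t}") (auto simp: tail_prod_def)

lemma tail_prod_insert:
  assumes "jump_set \<alpha> T" "t \<notin> T"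
  shows "tail_prod (insert t T) i = (if i \<le> fst t then lin t else 1) * tail_prod T i"
proof -
  have "{u \<in> insert t T. i \<le> fst u} =
      (if i \<le> fst t then insert t {u \<in> T. i \<le> fst u} else {u \<in> T. i \<le> fst u})" by auto
  then show ?thesis using finite_tail[OF assms(1), of i] assms(2) by (simp add: tail_prod_def)
qed

text \<open>\<open>ratio T i\<close> is \<open>p\<^sub>i / p\<^bsub>i+1\<^esub>\<close>, the factor picked up by \<open>x\<close>; the complementary divisor of \<open>f(z + i)\<close>,
  \<open>coratio \<alpha> T i\<close>, is the factor picked up by \<open>y\<close>.\<close>

definition ratio :: "(int \<times> 'k::field) set \<Rightarrow> int \<Rightarrow> 'k poly" where
  "ratio T i = (\<Prod>t\<in>{t\<in>T. fst t = i}. lin t)"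

definition coratio :: "'k::field \<Rightarrow> (int \<times> 'k) set \<Rightarrow> int \<Rightarrow> 'k poly" where
  "coratio \<alpha> T i = (\<Prod>t\<in>{i} \<times> {0, \<alpha>} - T. lin t)"

lemma jump_set_finite_at: "jump_set \<alpha> T \<Longrightarrow> finite {t\<in>T. fst t = i}"
  by (rule finite_subset[of _ "{i} \<times> {0, \<alpha>}"]) (auto simp: jump_set_def)

lemma tail_prod_step:
  assumes "jump_set \<alpha> T" shows "tail_prod T i = ratio T i * tail_prod T (i + 1)"
proof -
  have "{t\<in>T. i \<le> fst t} = {t\<in>T. fst t = i} \<union> {t\<in>T. i + 1 \<le> fst t}" by auto
  then show ?thesis
    unfolding tail_prod_def ratio_def
    using finite_tail[OF assms, of "i + 1"] jump_set_finite_at[OF assms]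
    by (simp add: prod.union_disjoint disjoint_iff)
qed

lemma ratio_mult_coratio:
  assumes "jump_set \<alpha> T" "\<alpha> \<noteq> 0" shows "ratio T i * coratio \<alpha> T i = translate (fpoly \<alpha>) i"
proof -
  have "{i} \<times> {0, \<alpha>} = {t\<in>T. fst t = i} \<union> ({i} \<times> {0, \<alpha>} - T)"
    using assms(1) by (fastforce simp: jump_set_def)
  moreover have "(\<Prod>t\<in>{t\<in>T. fst t = i} \<union> ({i} \<times> {0, \<alpha>} - T). lin t) = ratio T i * coratio \<alpha> T i"
    unfolding ratio_def coratio_def
    using jump_set_finite_at[OF assms(1)] by (intro prod.union_disjoint) auto
  moreover have "(\<Prod>t\<in>{i} \<times> {0, \<alpha>}. lin t) = lin (i, 0) * lin (i, \<alpha>)"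
    using assms(2) by (simp add: insert_Times_insert)
  moreover have "translate (fpoly \<alpha>) i = lin (i, 0) * lin (i, \<alpha>)"
    by (simp add: fpoly_def translate_def lin_def pcompose_pCons pcompose_mult add.commute)
  ultimately show ?thesis by metis
qed

text \<open>This is where \<open>\<alpha> \<notin> \<int>\<close> enters: the roots \<open>- n - b\<close> for different pairs \<open>(n, b)\<close> are different.\<close>

lemma root_lin_iff:
  fixes \<alpha> :: "'k::field_char_0"
  assumes "\<alpha> \<notin> \<int>" "b \<in> {0, \<alpha>}" "b' \<in> {0, \<alpha>}"
  shows "poly (lin (i, b)) (- of_int n - b') = 0 \<longleftrightarrow> i = n \<and> b = b'"
proof -
  have "of_int i + b - of_int n - b' = 0 \<longleftrightarrow> of_int (i - n) = b' - b"
    by (auto simp: algebra_simps)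
  moreover have "b' - b \<in> {0, \<alpha>, - \<alpha>}" using assms by auto
  moreover have "of_int m \<noteq> \<alpha>" "of_int m \<noteq> - \<alpha>" for m
    using assms(1) Ints_of_int[of m] Ints_of_int[of "-m"] by (auto, metis add.inverse_inverse of_int_minus)
  ultimately have "of_int i + b - of_int n - b' = 0 \<longleftrightarrow> i = n \<and> b = b'"
    using assms(2,3) by (metis eq_iff_diff_eq_0 insert_iff of_int_0 of_int_eq_iff right_minus_eq singletonD)
  then show ?thesis by (simp add: poly_lin algebra_simps)
qed

lemma
  fixes \<alpha> :: "'k::field_char_0"
  assumes "\<alpha> \<notin> \<int>" "b \<in> {0, \<alpha>}" "jump_set \<alpha> T"
  shows ratio_root_iff: "poly (ratio T i) (- of_int n - b) = 0 \<longleftrightarrow> i = n \<and> (n, b) \<in> T"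
    and coratio_root_iff: "poly (coratio \<alpha> T i) (- of_int n - b) = 0 \<longleftrightarrow> i = n \<and> (n, b) \<notin> T"
proof -
  note * = root_lin_iff[OF assms(1) _ assms(2)]
  have T: "T \<subseteq> UNIV \<times> {0, \<alpha>}" using assms(3) by (simp add: jump_set_def)
  have "poly (ratio T i) (- of_int n - b) = 0 \<longleftrightarrow>
      (\<exists>t\<in>{t\<in>T. fst t = i}. poly (lin t) (- of_int n - b) = 0)"
    unfolding ratio_def poly_prod using jump_set_finite_at[OF assms(3)] by (simp only: prod_zero_iff)
  also have "\<dots> \<longleftrightarrow> (\<exists>b'\<in>{0, \<alpha>}. (i, b') \<in> T \<and> poly (lin (i, b')) (- of_int n - b) = 0)"
    using T by fastforce
  also have "\<dots> \<longleftrightarrow> i = n \<and> (n, b) \<in> T" using * assms(2) by auto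
  finally show "poly (ratio T i) (- of_int n - b) = 0 \<longleftrightarrow> i = n \<and> (n, b) \<in> T" .
  have "poly (coratio \<alpha> T i) (- of_int n - b) = 0 \<longleftrightarrow>
      (\<exists>t\<in>{i} \<times> {0, \<alpha>} - T. poly (lin t) (- of_int n - b) = 0)"
    unfolding coratio_def poly_prod by (subst prod_zero_iff) auto
  also have "\<dots> \<longleftrightarrow> (\<exists>b'\<in>{0, \<alpha>}. (i, b') \<notin> T \<and> poly (lin (i, b')) (- of_int n - b) = 0)"
    by blast
  also have "\<dots> \<longleftrightarrow> i = n \<and> (n, b) \<notin> T" using * assms(2) by auto
  finally show "poly (coratio \<alpha> T i) (- of_int n - b) = 0 \<longleftrightarrow> i = n \<and> (n, b) \<notin> T" .
qed

definition rank_one :: "'k::field poly \<Rightarrow> (int \<times> 'k) set \<Rightarrow> 'k qgr set" where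
  "rank_one h T = graded_sub (\<lambda>i. h * tail_prod T i)"

lemma right_stable_tail:
  assumes "jump_set \<alpha> T" "\<alpha> \<noteq> 0" "h \<noteq> 0"
  shows "right_stable (fpoly \<alpha>) (\<lambda>i. h * tail_prod T i)"
  unfolding right_stable_def
proof (intro allI conjI)
  fix i
  note s = tail_prod_step[OF assms(1), of i]
  show "h * tail_prod T i \<noteq> 0" using assms(3) by simp
  show "h * tail_prod T (i + 1) dvd h * tail_prod T i"
    unfolding s by simp
  have "h * tail_prod T (i + 1) * translate (fpoly \<alpha>) i = h * tail_prod T i * coratio \<alpha> T i"
    unfolding s ratio_mult_coratio[OF assms(1,2), symmetric] by simp
  then show "h * tail_prod T i dvd h * tail_prod T (i + 1) * translate (fpoly \<alpha>) i"
    by (metis dvd_triv_left)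
qed

definition neg_jumps :: "'k::field \<Rightarrow> (int \<times> 'k) set" where
  "neg_jumps \<alpha> = {..<0} \<times> {0, \<alpha>}"

lemma jump_set_neg_jumps: "jump_set \<alpha> (neg_jumps \<alpha>)"
  by (auto simp: jump_set_def neg_jumps_def intro!: exI[of _ 0])

lemma tail_neg_jumps_nonneg: "0 \<le> i \<Longrightarrow> tail_prod (neg_jumps \<alpha>) i = 1"
  unfolding tail_prod_def by (rule prod.neutral) (auto simp: neg_jumps_def)

lemma tail_neg_jumps_neg:
  assumes "\<alpha> \<noteq> 0" "i < 0"
  shows "tail_prod (neg_jumps \<alpha>) i = translate (fpoly \<alpha>) i * tail_prod (neg_jumps \<alpha>) (i + 1)"
proof -
  have "{i} \<times> {0, \<alpha>} - neg_jumps \<alpha> = {}" using assms(2) by (auto simp: neg_jumps_def)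
  then have "coratio \<alpha> (neg_jumps \<alpha>) i = 1" by (simp only: coratio_def prod.empty)
  then show ?thesis
    using tail_prod_step[OF jump_set_neg_jumps, of \<alpha> i] ratio_mult_coratio[OF jump_set_neg_jumps assms(1), of i]
    by simp
qed

lemma qgr_one: "1 = qmon (Fract 1 1) 0"
  by (simp add: qmon_one One_fract_def[symmetric])

lemma one_skew_laurent [simp]: "1 \<in> skew_laurent" and pcoeff_one: "pcoeff 1 i = (if i = 0 then 1 else 0)"
  unfolding qgr_one by (simp_all add: pcoeff_qmon)

lemma Areg_range: "Areg \<alpha> = range (feval (fpoly \<alpha>))"
  by (simp add: Areg_def gwa_carrier image_image gwa_emb_cls)

text \<open>\<open>A\<^sub>i = k[z] x\<^sup>i\<close> for \<open>i \<ge> 0\<close>, and \<open>A\<^bsub>-j\<^esub>\<close> is generated by \<open>y\<^sup>j = f(z - 1) \<cdots> f(z - j) x\<^bsup>-j\<^esup>\<close>. One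
  inclusion holds since the right-hand side is a right submodule containing \<open>1\<close>; for the other it
  suffices to produce the powers of \<open>x\<close> and \<open>y\<close>.\<close>

lemma Areg_eq:
  fixes \<alpha> :: "'k::field"
  assumes "\<alpha> \<noteq> 0" shows "Areg \<alpha> = rank_one 1 (neg_jumps \<alpha>)"
proof
  let ?f = "fpoly \<alpha>"
  have ok: "right_stable ?f (\<lambda>i. 1 * tail_prod (neg_jumps \<alpha>) i)"
    by (rule right_stable_tail) (use assms in \<open>auto simp: jump_set_neg_jumps\<close>)
  have 1: "1 \<in> rank_one 1 (neg_jumps \<alpha>)"
    by (auto simp: rank_one_def graded_sub_def pcoeff_one tail_neg_jumps_nonneg)
  show "Areg \<alpha> \<subseteq> rank_one 1 (neg_jumps \<alpha>)"
    using graded_sub_mult_feval[OF ok 1[unfolded rank_one_def]] by (auto simp: Areg_range rank_one_def)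
  have pos: "qmon (Fract 1 1) (int n) = feval ?f (fgen GX ^ n)" for n
  proof (induction n)
    case 0
    then show ?case by (simp add: qmon_one One_fract_def[symmetric])
  next
    case (Suc n)
    then show ?case
      by (simp add: power_Suc2 feval_mult feval_GX Suc[symmetric] qmon_mult shift_Fract pcompose_1 add.commute
        del: power_Suc)
  qed
  have neg: "qmon (Fract (tail_prod (neg_jumps \<alpha>) (- int n)) 1) (- int n) = feval ?f (fgen GY ^ n)" for n
  proof (induction n)
    case 0
    then show ?case by (simp add: qmon_one One_fract_def[symmetric] tail_neg_jumps_nonneg)
  next
    case (Suc n)
    have "feval ?f (fgen GY ^ Suc n) =
       qmon (Fract (tail_prod (neg_jumps \<alpha>) (- int n)) 1) (- int n) * qmon (Fract (translate ?f (-1)) 1) (-1)"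
      by (simp add: power_Suc2 feval_mult feval_GY Suc del: power_Suc)
    then have step: "feval ?f (fgen GY ^ Suc n) = qmon (Fract (tail_prod (neg_jumps \<alpha>) (- int n) * translate (translate ?f (-1)) (- int n)) 1) (- int n - 1)"
      by (simp add: qmon_mult shift_Fract pcompose_1 translate_def)
    have e: "- 1 - int n = - int n - 1" by simp
    have "tail_prod (neg_jumps \<alpha>) (- int n) * translate (translate ?f (-1)) (- int n) =
        tail_prod (neg_jumps \<alpha>) (- int n - 1)"
      using tail_neg_jumps_neg[OF assms, of "- int n - 1"] by (simp add: translate_translate mult.commute e)
    with step show ?case by (simp add: e)
  qed
  show "rank_one 1 (neg_jumps \<alpha>) \<subseteq> Areg \<alpha>"
  proof
    fix q assume "q \<in> rank_one 1 (neg_jumps \<alpha>)"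
    then show "q \<in> Areg \<alpha>"
      unfolding rank_one_def
    proof (induction rule: graded_sub_induct)
      case (mon g i)
      have "\<exists>a. qmon (Fract (tail_prod (neg_jumps \<alpha>) i) 1) i = feval ?f a"
        using pos[of "nat i"] neg[of "nat (- i)"]
        by (cases "0 \<le> i") (auto simp: tail_neg_jumps_nonneg)
      then obtain a where a: "qmon (Fract (tail_prod (neg_jumps \<alpha>) i) 1) i = feval ?f a" by blast
      have "qmon (Fract (1 * tail_prod (neg_jumps \<alpha>) i * g) 1) i = feval ?f (fz g * a)"
        unfolding feval_mult feval_fz a[symmetric] by (simp add: qmon_mult mult.commute)
      then show ?case by (simp add: Areg_range)
    next
      case (add q r)
      then show ?case by (auto simp: Areg_range) (metis feval_add rangeI)
    qed
  qed
qed

section \<open>Cyclic modules over the generalized Weyl algebra\<close>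

lemma class_ring_genideal: "ideal (Idl\<^bsub>class_ring\<^esub> R) (class_ring :: 'a::ring_1 ring)"
  by (rule ring.genideal_ideal[OF ring_class_ring]) simp

lemma class_ring_genideal_self: "r \<in> R \<Longrightarrow> r \<in> Idl\<^bsub>class_ring\<^esub> (R :: 'a::ring_1 set)"
  using ring.genideal_self[OF ring_class_ring, of R] by auto

lemma
  assumes "ideal J (class_ring :: 'a::ring_1 ring)"
  shows class_ring_ideal_zero: "0 \<in> J"
    and class_ring_ideal_add: "a \<in> J \<Longrightarrow> b \<in> J \<Longrightarrow> a + b \<in> J"
    and class_ring_ideal_mult_left: "a \<in> J \<Longrightarrow> b * a \<in> J"
    and class_ring_ideal_mult_right: "a \<in> J \<Longrightarrow> a * b \<in> J"
  using additive_subgroup.zero_closed[OF ideal.axioms(1)[OF assms]]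
    additive_subgroup.a_closed[OF ideal.axioms(1)[OF assms], of a b]
    ideal.I_l_closed[OF assms, of a b] ideal.I_r_closed[OF assms, of a b]
  by simp_all

lemma gwa_ideal_ideal: "ideal (gwa_ideal f) class_ring"
  unfolding gwa_ideal_def by (rule class_ring_genideal)

lemmas gwa_ideal_zero = class_ring_ideal_zero[OF gwa_ideal_ideal]
  and gwa_ideal_add = class_ring_ideal_add[OF gwa_ideal_ideal]
  and gwa_ideal_mult_left = class_ring_ideal_mult_left[OF gwa_ideal_ideal]
  and gwa_ideal_mult_right = class_ring_ideal_mult_right[OF gwa_ideal_ideal]

lemma gwa_ideal_rel: "r \<in> gwa_rels f \<Longrightarrow> r \<in> gwa_ideal f"
  unfolding gwa_ideal_def by (rule class_ring_genideal_self)

lemma gwa_mult_cls: "gwa_cls f a \<otimes>\<^bsub>gwa f\<^esub> gwa_cls f b = gwa_cls f (a * b)"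
  using ideal.rcoset_mult_add[OF gwa_ideal_ideal, of a b]
  by (simp add: gwa_def FactRing_def gwa_cls_def)

lemma gwa_add_cls: "gwa_cls f a \<oplus>\<^bsub>gwa f\<^esub> gwa_cls f b = gwa_cls f (a + b)"
  using abelian_subgroup.a_rcos_sum[OF abelian_subgroupI3[OF ideal.axioms(1)[OF gwa_ideal_ideal]
      ring.is_abelian_group[OF ring_class_ring]], of a b]
  by (simp add: gwa_def FactRing_def gwa_cls_def)

lemma gwa_cls_eq_iff: "gwa_cls f a = gwa_cls f b \<longleftrightarrow> a - b \<in> gwa_ideal f"
proof -
  interpret abelian_subgroup "gwa_ideal f" class_ring
    by (rule abelian_subgroupI3[OF ideal.axioms(1)[OF gwa_ideal_ideal]
      ring.is_abelian_group[OF ring_class_ring]])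
  show ?thesis
  proof
    assume "gwa_cls f a = gwa_cls f b"
    then have "a \<in> gwa_ideal f +>\<^bsub>class_ring\<^esub> b"
      unfolding gwa_cls_def using a_rcos_self[of a] by simp
    then show "a - b \<in> gwa_ideal f" 
      by (auto simp: a_r_coset_def')
  next
    assume "a - b \<in> gwa_ideal f"
    then have "a \<in> gwa_ideal f +>\<^bsub>class_ring\<^esub> b"
      by (force simp: a_r_coset_def')
    then show "gwa_cls f a = gwa_cls f b"
      unfolding gwa_cls_def using a_repr_independence'[of a b] by simp
  qed
qed

lemma fconst_commute: "fconst x * a = a * (fconst x :: 'k::field falg)"
  by (induction a rule: poly_mapping_additive_induct)
     (simp_all add: fconst_def mult_single mult.commute distrib_left distrib_right)

lemma fconst_mult: "fconst x * fconst y = fconst (x * y)"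
  by (simp add: fconst_def mult_single)

lemma fconst_add: "fconst x + fconst y = fconst (x + y)"
  by (simp add: fconst_def single_add)

lemma fconst_zero [simp]: "fconst 0 = 0" and fconst_one [simp]: "fconst 1 = 1"
  by (simp_all add: fconst_def)

lemma fconst_uminus: "fconst (- x) = - fconst x"
  by (simp add: fconst_def single_uminus)


text \<open>The preimage in the free algebra of the right ideal generated by the classes of \<open>u\<close> and \<open>w\<close>.
  Working there avoids choosing representatives of cosets of cosets.\<close>

definition ideal_lift :: "'k::field poly \<Rightarrow> 'k falg \<Rightarrow> 'k falg \<Rightarrow> 'k falg set" where
  "ideal_lift f u w = {a. gwa_cls f a \<in> right_ideal2 f (gwa_cls f u) (gwa_cls f w)}"

lemma right_ideal2_cls:
  "right_ideal2 f (gwa_cls f u) (gwa_cls f w) = range (\<lambda>(a, b). gwa_cls f (u * a + w * b))"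
proof -
  have "right_ideal2 f (gwa_cls f u) (gwa_cls f w) =
    {gwa_cls f u \<otimes>\<^bsub>gwa f\<^esub> gwa_cls f a \<oplus>\<^bsub>gwa f\<^esub> gwa_cls f w \<otimes>\<^bsub>gwa f\<^esub> gwa_cls f b | a b. True}"
    unfolding right_ideal2_def gwa_carrier by blast
  then show ?thesis by (auto simp: gwa_mult_cls gwa_add_cls)
qed

lemma ideal_lift_iff: "p \<in> ideal_lift f u w \<longleftrightarrow> (\<exists>a b. p - (u * a + w * b) \<in> gwa_ideal f)"
  by (auto simp: ideal_lift_def right_ideal2_cls gwa_cls_eq_iff image_iff)

lemma ideal_lift_ideal: "p \<in> gwa_ideal f \<Longrightarrow> p \<in> ideal_lift f u w"
  unfolding ideal_lift_iff by (intro exI[of _ 0]) simp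

lemma ideal_lift_gen: "u \<in> ideal_lift f u w" "w \<in> ideal_lift f u w"
proof -
  show "u \<in> ideal_lift f u w"
    unfolding ideal_lift_iff by (intro exI[of _ 1] exI[of _ 0]) (simp add: gwa_ideal_zero)
  show "w \<in> ideal_lift f u w"
    unfolding ideal_lift_iff by (rule exI[of _ 0], rule exI[of _ 1]) (simp add: gwa_ideal_zero)
qed

lemma ideal_lift_add:
  assumes "p \<in> ideal_lift f u w" "q \<in> ideal_lift f u w" shows "p + q \<in> ideal_lift f u w"
proof -
  obtain a b a' b' where "p - (u * a + w * b) \<in> gwa_ideal f" "q - (u * a' + w * b') \<in> gwa_ideal f"
    using assms by (auto simp: ideal_lift_iff)
  then have "p - (u * a + w * b) + (q - (u * a' + w * b')) \<in> gwa_ideal f"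
    by (rule gwa_ideal_add)
  also have "p - (u * a + w * b) + (q - (u * a' + w * b')) = p + q - (u * (a + a') + w * (b + b'))"
    by (simp add: algebra_simps)
  finally show ?thesis unfolding ideal_lift_iff by blast
qed

lemma ideal_lift_mult:
  assumes "p \<in> ideal_lift f u w" shows "p * q \<in> ideal_lift f u w"
proof -
  obtain a b where "p - (u * a + w * b) \<in> gwa_ideal f" using assms by (auto simp: ideal_lift_iff)
  then have "(p - (u * a + w * b)) * q \<in> gwa_ideal f" by (rule gwa_ideal_mult_right)
  also have "(p - (u * a + w * b)) * q = p * q - (u * (a * q) + w * (b * q))"
    by (simp add: algebra_simps)
  finally show ?thesis unfolding ideal_lift_iff by blast
qed

lemma ideal_lift_zero: "0 \<in> ideal_lift f u w"
  by (simp add: ideal_lift_ideal gwa_ideal_zero)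

lemma ideal_lift_uminus: "p \<in> ideal_lift f u w \<Longrightarrow> - p \<in> ideal_lift f u w"
  using ideal_lift_mult[of p f u w "- 1"] by simp

lemma ideal_lift_trans: "p - q \<in> ideal_lift f u w \<Longrightarrow> q - r \<in> ideal_lift f u w \<Longrightarrow> p - r \<in> ideal_lift f u w"
  using ideal_lift_add[of "p - q" f u w "q - r"] by simp

definition module_cls :: "'k::field poly \<Rightarrow> 'k falg \<Rightarrow> 'k falg \<Rightarrow> 'k falg \<Rightarrow> 'k falg set set" where
  "module_cls f u w p = right_ideal2 f (gwa_cls f u) (gwa_cls f w) +>\<^bsub>gwa f\<^esub> gwa_cls f p"

lemma right_ideal2_ideal_lift: "right_ideal2 f (gwa_cls f u) (gwa_cls f w) = gwa_cls f ` ideal_lift f u w"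
  by (auto simp: ideal_lift_def right_ideal2_cls)

lemma module_cls_eq: "module_cls f u w p = (\<lambda>k. gwa_cls f (k + p)) ` ideal_lift f u w"
  by (auto simp: module_cls_def right_ideal2_ideal_lift a_r_coset_def' gwa_add_cls)

lemma module_cls_eq_iff: "module_cls f u w p = module_cls f u w q \<longleftrightarrow> p - q \<in> ideal_lift f u w"
proof
  assume "module_cls f u w p = module_cls f u w q"
  moreover have "gwa_cls f (0 + p) \<in> module_cls f u w p" unfolding module_cls_eq using ideal_lift_zero by blast
  ultimately obtain k where k: "k \<in> ideal_lift f u w" "p - (k + q) \<in> gwa_ideal f"
    by (auto simp: module_cls_eq gwa_cls_eq_iff)
  then have "p - (k + q) + k \<in> ideal_lift f u w" using ideal_lift_add[OF ideal_lift_ideal] by blast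
  then show "p - q \<in> ideal_lift f u w" by simp
next
  have *: "module_cls f u w p \<subseteq> module_cls f u w q" if "p - q \<in> ideal_lift f u w" for p q
  proof
    fix C assume "C \<in> module_cls f u w p"
    then obtain k where "k \<in> ideal_lift f u w" "C = gwa_cls f (k + p)" by (auto simp: module_cls_eq)
    then have "C = gwa_cls f (k + (p - q) + q)" "k + (p - q) \<in> ideal_lift f u w"
      using that by (auto intro: ideal_lift_add)
    then show "C \<in> module_cls f u w q" unfolding module_cls_eq by blast
  qed
  assume "p - q \<in> ideal_lift f u w"
  then show "module_cls f u w p = module_cls f u w q"
    using *[of p q] *[of q p] ideal_lift_uminus[of "p - q"] by auto
qed

lemma module_cls_add: "module_cls f u w p <+>\<^bsub>gwa f\<^esub> module_cls f u w q = module_cls f u w (p + q)"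
proof -
  have "module_cls f u w p <+>\<^bsub>gwa f\<^esub> module_cls f u w q =
      {gwa_cls f (k + p + (l + q)) | k l. k \<in> ideal_lift f u w \<and> l \<in> ideal_lift f u w}"
    by (auto simp: set_add_def' module_cls_eq gwa_add_cls)
  also have "\<dots> = module_cls f u w (p + q)"
  proof (intro subset_antisym subsetI)
    fix C assume "C \<in> {gwa_cls f (k + p + (l + q)) | k l. k \<in> ideal_lift f u w \<and> l \<in> ideal_lift f u w}"
    then obtain k l where "C = gwa_cls f (k + l + (p + q))" "k \<in> ideal_lift f u w" "l \<in> ideal_lift f u w"
      by (auto simp: algebra_simps)
    then show "C \<in> module_cls f u w (p + q)" by (auto simp: module_cls_eq intro: ideal_lift_add)
  next
    fix C assume "C \<in> module_cls f u w (p + q)"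
    then obtain k where "k \<in> ideal_lift f u w" "C = gwa_cls f (k + p + (0 + q))"
      by (auto simp: module_cls_eq algebra_simps)
    then show "C \<in> {gwa_cls f (k + p + (l + q)) | k l. k \<in> ideal_lift f u w \<and> l \<in> ideal_lift f u w}"
      using ideal_lift_zero by blast
  qed
  finally show ?thesis .
qed

text \<open>If modulo a right ideal each word is a scalar multiple of a fixed element depending only on the
  degree of the word, then these elements span; the degrees needed are those of the words present.\<close>

lemma homog_word_sum:
  fixes p :: "'k::field falg"
  assumes "\<And>w. \<exists>x. Poly_Mapping.single w 1 - fconst x * b (wrd_deg w) \<in> ideal_lift f u v"
  shows "\<exists>A x. finite A \<and> A \<subseteq> wrd_deg ` Poly_Mapping.keys p \<and> p - (\<Sum>i\<in>A. fconst (x i) * b i) \<in> ideal_lift f u v"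
proof -
  obtain y where y: "\<And>w. Poly_Mapping.single w 1 - fconst (y w) * b (wrd_deg w) \<in> ideal_lift f u v"
    using assms by metis
  let ?K = "Poly_Mapping.keys p" and ?l = "Poly_Mapping.lookup p"
  let ?x = "\<lambda>i. \<Sum>w\<in>{w\<in>?K. wrd_deg w = i}. ?l w * y w"
  have sum_ideal_lift: "(\<Sum>w\<in>W. g w) \<in> ideal_lift f u v" if "\<And>w. g w \<in> ideal_lift f u v" for W and g :: "wrd \<Rightarrow> 'k falg"
    by (induction W rule: infinite_finite_induct) (auto intro: ideal_lift_zero ideal_lift_add that)
  have p: "p = (\<Sum>w\<in>?K. fconst (?l w) * Poly_Mapping.single w 1)"
    by (rule poly_mapping_eqI)
      (simp add: lookup_sum fconst_def mult_single lookup_single when_def in_keys_iff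
        sum.delta' [where S = "?K"])
  have fsum: "fconst (\<Sum>w\<in>W. g w) = (\<Sum>w\<in>W. fconst (g w))" for W and g :: "wrd \<Rightarrow> 'k"
    by (induction W rule: infinite_finite_induct) (auto simp: fconst_add[symmetric])
  have "(\<Sum>i\<in>wrd_deg ` ?K. fconst (?x i) * b i) =
      (\<Sum>i\<in>wrd_deg ` ?K. \<Sum>w\<in>{w\<in>?K. wrd_deg w = i}. fconst (?l w * y w) * b (wrd_deg w))"
    by (simp add: fsum sum_distrib_right)
  also have "\<dots> = (\<Sum>w\<in>?K. fconst (?l w * y w) * b (wrd_deg w))"
    by (rule sum.image_gen[symmetric]) simp
  finally have "p - (\<Sum>i\<in>wrd_deg ` ?K. fconst (?x i) * b i) =
      (\<Sum>w\<in>?K. fconst (?l w) * (Poly_Mapping.single w 1 - fconst (y w) * b (wrd_deg w)))"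
    by (subst (1) p) (simp add: sum_subtractf right_diff_distrib mult.assoc[symmetric] fconst_mult)
  also have "\<dots> \<in> ideal_lift f u v"
    by (rule sum_ideal_lift, subst fconst_commute, intro ideal_lift_mult y)
  finally show ?thesis by (intro exI[of _ "wrd_deg ` ?K"] exI[of _ ?x]) auto
qed

text \<open>A functional \<open>e\<close> on the free algebra that follows the rules of \<open>weight_model\<close> and kills the
  generators \<open>u\<close>, \<open>w\<close> factors through \<open>A/(u, w)A\<close>. If in addition the quotient is spanned by elements
  \<open>b i\<close> (\<open>i \<in> I\<close>) on which \<open>e\<close> is diagonal and nonzero, then \<open>e\<close> is injective on it, and the quotient
  has no further elements.\<close>

lemma cyclic_weight_model:
  fixes f :: "'k::field poly" and e :: "'k falg \<Rightarrow> int \<Rightarrow> 'k"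
  assumes e_add: "\<And>a b i. e (a + b) i = e a i + e b i"
    and e_const: "\<And>a x i. e (a * fconst x) i = x * e a i"
    and e_GX: "\<And>a i. e (a * fgen GX) i = (if i \<in> I then e a (i - 1) else 0)"
    and e_GY: "\<And>a i. e (a * fgen GY) i = (if i \<in> I then poly f (c + of_int i) * e a (i + 1) else 0)"
    and e_GZ: "\<And>a i. e (a * fgen GZ) i = (c + of_int i) * e a i"
    and e_ideal: "\<And>a i. a \<in> gwa_ideal f \<Longrightarrow> e a i = 0"
    and e_gens: "\<And>i. e u i = 0" "\<And>i. e w i = 0"
    and b: "\<And>i j. e (b i) j = 0 \<longleftrightarrow> i \<noteq> j \<or> i \<notin> I" "\<And>i. i \<notin> I \<Longrightarrow> b i = 0"
    and b_deg: "\<And>i v. v \<in> Poly_Mapping.keys (b i) \<Longrightarrow> wrd_deg v = i"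
    and words: "\<And>v. \<exists>x. Poly_Mapping.single v 1 - fconst x * b (wrd_deg v) \<in> ideal_lift f u w"
  shows "weight_model f (cyclic_module f (right_ideal2 f (gwa_cls f u) (gwa_cls f w))) c I (module_cls f u w) e"
proof -
  let ?S = "cyclic_module f (right_ideal2 f (gwa_cls f u) (gwa_cls f w))"
  have e0: "e 0 i = 0" for i using e_ideal gwa_ideal_zero by blast
  have e_uminus: "e (- a) i = - e a i" for a i
    using e_add[of a "- a" i] e0[of i] by (simp add: eq_neg_iff_add_eq_0 add.commute)
  have e_diff: "e (p - q) i = e p i - e q i" for p q i
    using e_add[of p "- q" i] by (simp add: e_uminus)
  have e_sum: "e (sum g A) i = (\<Sum>a\<in>A. e (g a) i)" for g and A :: "int set" and i
    by (induction A rule: infinite_finite_induct) (auto simp: e0 e_add)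
  have e_mult0: "\<forall>i. e (p * q) i = 0" if "\<forall>i. e p i = 0" for p q
    using that
  proof (induction q arbitrary: p rule: falg_induct)
    case (gen g)
    then show ?case by (cases g) (auto simp: e_GX e_GY e_GZ)
  next
    case (mult q r)
    then show ?case by (metis mult.assoc)
  qed (auto simp: e_const e_add distrib_left)
  have e_ideal_lift: "e p i = 0" if pr: "p \<in> ideal_lift f u w" for p i
  proof -
    obtain a a' where "p - (u * a + w * a') \<in> gwa_ideal f" using pr by (auto simp: ideal_lift_iff)
    from e_ideal[OF this, of i] show ?thesis
      using e_mult0[of u a] e_mult0[of w a'] e_gens by (simp add: e_diff e_add)
  qed
  have e_const': "e (fconst x * a) i = x * e a i" for x a i
    by (simp add: fconst_commute e_const)
  \<comment> \<open>the diagonal entries of \<open>e\<close>\<close>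
  define y where "y = (\<lambda>i. e (b i) i)"
  have nf: "\<exists>A x. finite A \<and> A \<subseteq> wrd_deg ` Poly_Mapping.keys p \<and>
      p - (\<Sum>i\<in>A. fconst (x i) * b i) \<in> ideal_lift f u w \<and>
      (\<forall>j. e p j = (if j \<in> A then x j * y j else 0))" for p
  proof -
    obtain A x where A: "finite A" "A \<subseteq> wrd_deg ` Poly_Mapping.keys p"
        "p - (\<Sum>i\<in>A. fconst (x i) * b i) \<in> ideal_lift f u w"
      using homog_word_sum[OF words, of p] by metis
    have "e p j = (if j \<in> A then x j * y j else 0)" for j
    proof -
      have "e p j = (\<Sum>i\<in>A. x i * e (b i) j)"
        using e_ideal_lift[OF A(3), of j] by (simp add: e_diff e_sum e_const')
      also have "\<dots> = (\<Sum>i\<in>A. if j = i then x j * y j else 0)"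
        by (rule sum.cong) (use b(1) in \<open>auto simp: y_def\<close>)
      finally show ?thesis using A(1) by (simp add: sum.delta)
    qed
    with A show ?thesis by blast
  qed
  have y: "y i \<noteq> 0 \<longleftrightarrow> i \<in> I" for i using b(1)[of i i] by (simp add: y_def)
  have sum_b0: "(\<Sum>i\<in>A. fconst (x i) * b i) = 0" if "\<And>i. i \<in> A \<Longrightarrow> x i * y i = 0" for A x
    using that y b(2) by (intro sum.neutral) fastforce
  have ker: "p \<in> ideal_lift f u w \<longleftrightarrow> (\<forall>i. e p i = 0)" for p
  proof
    assume 0: "\<forall>i. e p i = 0"
    obtain A x where A: "p - (\<Sum>i\<in>A. fconst (x i) * b i) \<in> ideal_lift f u w"
        "\<And>j. e p j = (if j \<in> A then x j * y j else 0)" using nf by metis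
    have "(\<Sum>i\<in>A. fconst (x i) * b i) = 0"
      by (rule sum_b0) (metis A(2) 0)
    then show "p \<in> ideal_lift f u w" using A(1) by simp
  qed (use e_ideal_lift in blast)
  show ?thesis
  proof
    show "carrier ?S = range (module_cls f u w)"
      by (auto simp: cyclic_module_def A_RCOSETS_def' module_cls_def gwa_carrier)
    have "module_cls f u w 0 = right_ideal2 f (gwa_cls f u) (gwa_cls f w)"
      by (simp add: module_cls_eq right_ideal2_ideal_lift)
    then show "\<zero>\<^bsub>?S\<^esub> = module_cls f u w 0" by (simp add: cyclic_module_def)
    show "module_cls f u w p \<oplus>\<^bsub>?S\<^esub> module_cls f u w q = module_cls f u w (p + q)" for p q
      by (simp add: cyclic_module_def module_cls_add)
    show "ract ?S (module_cls f u w p) (gwa_cls f q) = module_cls f u w (p * q)" for p q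
    proof -
      have "ract ?S (module_cls f u w p) (gwa_cls f q) = (\<Union>c\<in>module_cls f u w p.
          right_ideal2 f (gwa_cls f u) (gwa_cls f w) +>\<^bsub>gwa f\<^esub> (c \<otimes>\<^bsub>gwa f\<^esub> gwa_cls f q))"
        by (simp add: cyclic_module_def)
      also have "\<dots> = (\<Union>k\<in>ideal_lift f u w. module_cls f u w ((k + p) * q))"
        unfolding module_cls_eq[of f u w p] by (simp add: gwa_mult_cls module_cls_def)
      also have "\<dots> = (\<Union>k\<in>ideal_lift f u w. module_cls f u w (p * q))"
        by (rule SUP_cong) (simp_all add: module_cls_eq_iff distrib_right ideal_lift_mult)
      also have "\<dots> = module_cls f u w (p * q)" using ideal_lift_zero[of f u w] by auto
      finally show ?thesis .
    qed
    show eq: "module_cls f u w p = module_cls f u w q \<longleftrightarrow> e p = e q" for p q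
      unfolding module_cls_eq_iff ker by (auto simp: e_diff)
    show "component ?S i = module_cls f u w ` {a. \<forall>j. j \<noteq> i \<longrightarrow> e a j = 0}" for i
    proof -
      have "component ?S i = module_cls f u w ` {p. \<forall>v\<in>Poly_Mapping.keys p. wrd_deg v = i}"
        by (auto simp: cyclic_module_def gwa_component_def module_cls_def)
      also have "\<dots> = module_cls f u w ` {a. \<forall>j. j \<noteq> i \<longrightarrow> e a j = 0}"
      proof (intro subset_antisym subsetI)
        fix C assume "C \<in> module_cls f u w ` {p. \<forall>v\<in>Poly_Mapping.keys p. wrd_deg v = i}"
        then obtain p where p: "C = module_cls f u w p" "\<forall>v\<in>Poly_Mapping.keys p. wrd_deg v = i" by blast
        obtain A x where "A \<subseteq> wrd_deg ` Poly_Mapping.keys p"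
          "\<And>j. e p j = (if j \<in> A then x j * y j else 0)" using nf by metis
        then have "\<forall>j. j \<noteq> i \<longrightarrow> e p j = 0" using p(2) by auto
        then show "C \<in> module_cls f u w ` {a. \<forall>j. j \<noteq> i \<longrightarrow> e a j = 0}" using p(1) by blast
      next
        fix C assume "C \<in> module_cls f u w ` {a. \<forall>j. j \<noteq> i \<longrightarrow> e a j = 0}"
        then obtain p where p: "C = module_cls f u w p" "\<forall>j. j \<noteq> i \<longrightarrow> e p j = 0" by blast
        define q where "q = fconst (e p i / y i) * b i"
        have "e p i = 0" if "i \<notin> I"
        proof -
          obtain A x where "\<And>j. e p j = (if j \<in> A then x j * y j else 0)" using nf by metis
          then show ?thesis using y that by auto
        qed
        then have "e q j = e p j" for j
          using p(2) b(1)[of i j] y[of i] by (cases "j = i") (auto simp: q_def e_const' y_def)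
        then have "e q = e p" by blast
        moreover have "\<forall>v\<in>Poly_Mapping.keys q. wrd_deg v = i"
        proof
          fix v assume "v \<in> Poly_Mapping.keys q"
          then obtain v' where "v' \<in> Poly_Mapping.keys (b i)" "v = 0 + v'"
            using keys_mult[of "fconst (e p i / y i)" "b i"]
            by (auto simp: q_def fconst_def split: if_splits)
          then show "wrd_deg v = i" using b_deg by simp
        qed
        ultimately show "C \<in> module_cls f u w ` {p. \<forall>v\<in>Poly_Mapping.keys p. wrd_deg v = i}"
          using p(1) eq by blast
      qed
      finally show ?thesis .
    qed
    show "range e = {v. finite {i. v i \<noteq> 0} \<and> (\<forall>i. i \<notin> I \<longrightarrow> v i = 0)}"
    proof (intro subset_antisym subsetI)
      fix v assume "v \<in> range e"
      then obtain p where v: "v = e p" by auto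
      obtain A x where A: "finite A" "\<And>j. e p j = (if j \<in> A then x j * y j else 0)" using nf by metis
      have "{i. v i \<noteq> 0} \<subseteq> A" using A(2) v by auto
      then have "finite {i. v i \<noteq> 0}" using A(1) by (rule finite_subset)
      moreover have "\<forall>i. i \<notin> I \<longrightarrow> v i = 0" using y A(2) v by auto
      ultimately show "v \<in> {v. finite {i. v i \<noteq> 0} \<and> (\<forall>i. i \<notin> I \<longrightarrow> v i = 0)}" by simp
    next
      fix v :: "int \<Rightarrow> 'k" assume "v \<in> {v. finite {i. v i \<noteq> 0} \<and> (\<forall>i. i \<notin> I \<longrightarrow> v i = 0)}"
      then have v: "finite {i. v i \<noteq> 0}" "\<And>i. i \<notin> I \<Longrightarrow> v i = 0" by auto
      let ?A = "{i. v i \<noteq> 0}"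
      have "e (\<Sum>i\<in>?A. fconst (v i / y i) * b i) j = v j" for j
      proof -
        have "e (\<Sum>i\<in>?A. fconst (v i / y i) * b i) j = (\<Sum>i\<in>?A. v i / y i * e (b i) j)"
          by (simp add: e_sum e_const')
        also have "\<dots> = (\<Sum>i\<in>?A. if j = i then v j else 0)"
          by (rule sum.cong) (use b(1) y v(2) in \<open>auto simp: y_def\<close>)
        finally show ?thesis using v(1) by (simp add: sum.delta)
      qed
      then have "v = e (\<Sum>i\<in>?A. fconst (v i / y i) * b i)" by (intro ext) (rule sym)
      then show "v \<in> range e" by (rule range_eqI)
    qed
  qed (rule e_add e_const e_GX e_GY e_GZ)+
qed

section \<open>The simple modules X and Y\<close>


lemma ideal_lift_left_ideal: "a - b \<in> gwa_ideal f \<Longrightarrow> d * a - d * b \<in> ideal_lift f u w"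
  unfolding right_diff_distrib[symmetric] by (intro ideal_lift_ideal gwa_ideal_mult_left)

lemma ideal_lift_mult_diff: "a - b \<in> ideal_lift f u w \<Longrightarrow> a * d - b * d \<in> ideal_lift f u w"
  unfolding left_diff_distrib[symmetric] by (rule ideal_lift_mult)

text \<open>The common mechanism for \<open>X\<close> and \<open>Y\<close>: \<open>u\<close> is the generator killed in the cyclic module and \<open>v\<close> the
  other one of \<open>x\<close>, \<open>y\<close>. Moving \<open>z\<close> to the left through \<open>v\<^sup>n\<close> shifts it by \<open>n s\<close>, and there it is
  the scalar \<open>c\<close>; \<open>v u\<close> is a polynomial in \<open>z\<close>, hence acts as a scalar as well.\<close>

lemma power_spanning:
  fixes f F :: "'k::field poly" and u v :: gen and s c :: 'k
  assumes vz: "fgen v * fgen GZ - (fgen GZ + fconst s) * fgen v \<in> gwa_ideal f"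
    and vu: "fgen v * fgen u - fz F \<in> gwa_ideal f"
    and w: "w = fgen GZ - fconst c"
  shows "\<exists>x. fgen v ^ n * fgen GZ - fconst x * fgen v ^ n \<in> ideal_lift f (fgen u) w" (is "?Z n")
    and "\<exists>x. fgen v ^ Suc n * fgen u - fconst x * fgen v ^ n \<in> ideal_lift f (fgen u) w"
proof -
  let ?K = "ideal_lift f (fgen u) w" and ?v = "fgen v :: 'k falg" and ?z = "fgen GZ :: 'k falg"
  have Z: "?v ^ n * ?z - fconst (c + of_nat n * s) * ?v ^ n \<in> ?K" for n
  proof (induction n)
    case 0
    then show ?case using ideal_lift_gen(2)[of w f "fgen u"] by (simp add: w)
  next
    case (Suc n)
    let ?x = "fconst (c + of_nat n * s)"
    have "?v ^ n * (?v * ?z) - ?v ^ n * ((?z + fconst s) * ?v) \<in> ?K"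
      by (rule ideal_lift_left_ideal[OF vz])
    moreover have "(?v ^ n * ?z) * ?v - (?x * ?v ^ n) * ?v \<in> ?K"
      by (rule ideal_lift_mult_diff[OF Suc])
    ultimately have "(?v ^ n * (?v * ?z) - ?v ^ n * ((?z + fconst s) * ?v)) +
        ((?v ^ n * ?z) * ?v - (?x * ?v ^ n) * ?v) \<in> ?K"
      by (rule ideal_lift_add)
    also have "(?v ^ n * (?v * ?z) - ?v ^ n * ((?z + fconst s) * ?v)) +
        ((?v ^ n * ?z) * ?v - (?x * ?v ^ n) * ?v) =
        ?v ^ Suc n * ?z - (fconst s + ?x) * ?v ^ Suc n"
      by (simp add: power_Suc2 algebra_simps fconst_commute del: power_Suc)
    finally show ?case by (simp add: fconst_add algebra_simps)
  qed
  then show "?Z n" by blast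
  have pow: "\<exists>x. ?v ^ n * ?z ^ i - fconst x * ?v ^ n \<in> ?K" for i
  proof (induction i)
    case 0
    show ?case by (rule exI[of _ 1]) (simp add: ideal_lift_zero)
  next
    case (Suc i)
    then obtain x where "?v ^ n * ?z ^ i - fconst x * ?v ^ n \<in> ?K" by blast
    then have "?v ^ n * ?z ^ i * ?z - fconst x * ?v ^ n * ?z \<in> ?K" by (rule ideal_lift_mult_diff)
    moreover have "fconst x * ?v ^ n * ?z - fconst x * (fconst (c + of_nat n * s) * ?v ^ n) \<in> ?K"
    proof -
      have "fconst x * (?v ^ n * ?z) - fconst x * (fconst (c + of_nat n * s) * ?v ^ n) \<in> ?K"
      using ideal_lift_mult[OF Z[of n], of "fconst x"]
        by (simp add: left_diff_distrib fconst_commute)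
      then show ?thesis by (simp only: mult.assoc)
    qed
    ultimately have "?v ^ n * ?z ^ i * ?z - fconst x * (fconst (c + of_nat n * s) * ?v ^ n) \<in> ?K"
      by (rule ideal_lift_trans)
    then show ?case
      by (intro exI[of _ "x * (c + of_nat n * s)"])
         (simp only: power_Suc2 mult.assoc fconst_mult[symmetric])
  qed
  have "\<exists>x. ?v ^ n * (\<Sum>i\<le>m. fconst (coeff F i) * ?z ^ i) - fconst x * ?v ^ n \<in> ?K" for m
  proof (induction m)
    case 0
    show ?case by (rule exI[of _ "coeff F 0"]) (simp add: ideal_lift_zero fconst_commute)
  next
    case (Suc m)
    then obtain x where x: "?v ^ n * (\<Sum>i\<le>m. fconst (coeff F i) * ?z ^ i) - fconst x * ?v ^ n \<in> ?K"
      by blast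
    obtain y where "?v ^ n * ?z ^ Suc m - fconst y * ?v ^ n \<in> ?K" using pow by blast
    then have "(?v ^ n * ?z ^ Suc m - fconst y * ?v ^ n) * fconst (coeff F (Suc m)) \<in> ?K"
      by (rule ideal_lift_mult)
    with x have "?v ^ n * (\<Sum>i\<le>m. fconst (coeff F i) * ?z ^ i) - fconst x * ?v ^ n +
        (?v ^ n * ?z ^ Suc m - fconst y * ?v ^ n) * fconst (coeff F (Suc m)) \<in> ?K"
      by (rule ideal_lift_add)
    also have "?v ^ n * (\<Sum>i\<le>m. fconst (coeff F i) * ?z ^ i) - fconst x * ?v ^ n +
        (?v ^ n * ?z ^ Suc m - fconst y * ?v ^ n) * fconst (coeff F (Suc m)) =
        ?v ^ n * (\<Sum>i\<le>Suc m. fconst (coeff F i) * ?z ^ i) -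
        (fconst x + fconst y * fconst (coeff F (Suc m))) * ?v ^ n"
      using fconst_commute[of "coeff F (Suc m)" "?z ^ Suc m"] fconst_commute[of "coeff F (Suc m)" "?v ^ n"]
      by (simp add: algebra_simps del: power_Suc)
    finally show ?case unfolding fconst_mult fconst_add by blast
  qed
  then obtain x where x: "?v ^ n * fz F - fconst x * ?v ^ n \<in> ?K" unfolding fz_def by blast
  have "?v ^ n * (?v * fgen u) - ?v ^ n * fz F \<in> ?K" by (rule ideal_lift_left_ideal[OF vu])
  from ideal_lift_trans[OF this x] show "\<exists>x. ?v ^ Suc n * fgen u - fconst x * ?v ^ n \<in> ?K"
    by (auto simp: power_Suc2 mult.assoc simp del: power_Suc)
qed

text \<open>The power of \<open>v\<close> that has degree \<open>i\<close>, and zero if there is none; it is the element of degree \<open>i\<close> that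
  spans the cyclic module.\<close>

definition gen_pow :: "gen \<Rightarrow> int \<Rightarrow> 'k::field falg" where
  "gen_pow v i = (if 0 \<le> gen_deg v * i then fgen v ^ nat (gen_deg v * i) else 0)"

lemma gen_pow_nat: "v \<noteq> GZ \<Longrightarrow> gen_pow v (gen_deg v * int n) = fgen v ^ n"
  by (cases v) (auto simp: gen_pow_def)

lemma gen_pow_cases:
  assumes "v \<noteq> GZ"
  obtains n where "i = gen_deg v * int n" "(gen_pow v i :: 'k::field falg) = fgen v ^ n"
  | "gen_deg v * i < 0" "(gen_pow v i :: 'k falg) = 0"
proof (cases "0 \<le> gen_deg v * i")
  case True
  have "i = gen_deg v * int (nat (gen_deg v * i))" using True assms by (cases v) auto
  then show ?thesis using that(1) gen_pow_nat[OF assms] by metis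
next
  case False
  then show ?thesis using that(2) by (simp add: gen_pow_def)
qed

text \<open>By induction on the word, appending one letter at a time: the right action of each letter sends
  a power of \<open>v\<close> to a multiple of another one, by \<open>power_spanning\<close>.\<close>

lemma words_spanning:
  fixes f F :: "'k::field poly" and u v :: gen and s c :: 'k
  assumes vz: "fgen v * fgen GZ - (fgen GZ + fconst s) * fgen v \<in> gwa_ideal f"
    and vu: "fgen v * fgen u - fz F \<in> gwa_ideal f"
    and w: "w = fgen GZ - fconst c"
    and uv: "v \<noteq> GZ" "u \<noteq> GZ" "u \<noteq> v"
  shows "\<exists>x. Poly_Mapping.single ww 1 - fconst x * gen_pow v (wrd_deg ww) \<in> ideal_lift f (fgen u) w"
proof -
  let ?K = "ideal_lift f (fgen u) w"
  have step: "\<exists>x. gen_pow v i * fgen g - fconst x * gen_pow v (i + gen_deg g) \<in> ?K" for i g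
  proof (cases rule: gen_pow_cases[OF uv(1), of i, where ?'k = 'k])
    case (1 n)
    consider "g = GZ" | "g = v" | "g = u" using uv by (cases g; cases u; cases v) auto
    then show ?thesis
    proof cases
      case 1
      then show ?thesis using power_spanning(1)[OF vz vu w, of n] \<open>gen_pow v i = _\<close> by simp
    next
      case 2
      have "i + gen_deg v = gen_deg v * int (Suc n)" using 1 by (simp add: algebra_simps)
      then have "(gen_pow v (i + gen_deg v) :: 'k falg) = fgen v ^ Suc n" using gen_pow_nat[OF uv(1)] by metis
      then show ?thesis
        using 1 2 by (intro exI[of _ 1]) (simp add: power_Suc2 ideal_lift_zero del: power_Suc)
    next
      case 3
      show ?thesis
      proof (cases n)
        case 0
        then show ?thesis using 1 3 ideal_lift_gen(1)[of "fgen u" f w] by (intro exI[of _ 0]) simp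
      next
        case (Suc m)
        have "gen_deg u = - gen_deg v" using uv by (cases u; cases v) auto
        then have "i + gen_deg u = gen_deg v * int m" using 1 Suc by (simp add: algebra_simps)
        then have "(gen_pow v (i + gen_deg u) :: 'k falg) = fgen v ^ m" using gen_pow_nat[OF uv(1)] by metis
        then show ?thesis
          using 1 3 Suc power_spanning(2)[OF vz vu w, of m] by simp
      qed
    qed
  next
    case 2
    then show ?thesis by (intro exI[of _ 0]) (simp add: ideal_lift_zero)
  qed
  have "\<exists>x. Poly_Mapping.single (Wrd l) 1 - fconst x * gen_pow v (wrd_deg (Wrd l)) \<in> ?K" for l
  proof (induction l rule: rev_induct)
    case Nil
    have "(gen_pow v 0 :: 'k falg) = 1" "wrd_deg 0 = 0"
      by (simp_all add: gen_pow_def wrd_deg_def zero_wrd_def)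
    then show ?case
      by (intro exI[of _ 1]) (simp add: ideal_lift_zero zero_wrd_def[symmetric])
  next
    case (snoc g l)
    let ?d = "wrd_deg (Wrd l)"
    obtain x where x: "Poly_Mapping.single (Wrd l) 1 - fconst x * gen_pow v ?d \<in> ?K" using snoc by blast
    obtain y where y: "gen_pow v ?d * fgen g - fconst y * gen_pow v (?d + gen_deg g) \<in> ?K" using step by blast
    have "Poly_Mapping.single (Wrd l) 1 * fgen g - fconst x * gen_pow v ?d * fgen g \<in> ?K"
      by (rule ideal_lift_mult_diff[OF x])
    moreover have "(gen_pow v ?d * fgen g - fconst y * gen_pow v (?d + gen_deg g)) * fconst x \<in> ?K"
      by (rule ideal_lift_mult[OF y])
    ultimately have "Poly_Mapping.single (Wrd l) 1 * fgen g - fconst x * gen_pow v ?d * fgen g +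
        (gen_pow v ?d * fgen g - fconst y * gen_pow v (?d + gen_deg g)) * fconst x \<in> ?K"
      by (rule ideal_lift_add)
    also have "Poly_Mapping.single (Wrd l) 1 * fgen g - fconst x * gen_pow v ?d * fgen g +
        (gen_pow v ?d * fgen g - fconst y * gen_pow v (?d + gen_deg g)) * fconst x =
        Poly_Mapping.single (Wrd (l @ [g])) 1 - fconst (y * x) * gen_pow v (?d + gen_deg g)"
      by (simp add: left_diff_distrib mult.assoc fconst_commute[of x] fconst_mult[symmetric]
          fgen_def mult_single plus_wrd_def)
    finally show ?case by (auto simp: wrd_deg_def)
  qed
  from this[of "letters ww"] show ?thesis by simp
qed

lemma gen_pow_keys:
  assumes "v \<noteq> GZ" "k \<in> Poly_Mapping.keys (gen_pow v i :: 'a::field falg)" shows "wrd_deg k = i"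
proof -
  have *: "\<forall>k\<in>Poly_Mapping.keys (fgen v ^ n :: 'a falg). wrd_deg k = gen_deg v * int n" for n
  proof (induction n)
    case 0
    then show ?case by (auto simp: wrd_deg_def zero_wrd_def)
  next
    case (Suc n)
    show ?case
    proof
      fix k assume "k \<in> Poly_Mapping.keys (fgen v ^ Suc n :: 'a falg)"
      then obtain a b where "k = a + b" "a \<in> Poly_Mapping.keys (fgen v :: 'a falg)"
          "b \<in> Poly_Mapping.keys (fgen v ^ n :: 'a falg)"
        using keys_mult[of "fgen v" "fgen v ^ n"] by auto
      then show "wrd_deg k = gen_deg v * int (Suc n)"
        using Suc.IH by (auto simp: fgen_def wrd_deg_def plus_wrd_def algebra_simps)
    qed
  qed
  show ?thesis
  proof (cases rule: gen_pow_cases[OF assms(1), of i, where ?'k = 'a])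
    case (1 n)
    have "k \<in> Poly_Mapping.keys (fgen v ^ n :: 'a falg)" using assms(2) by (simp only: 1(2))
    then show ?thesis using * 1(1) by simp
  next
    case 2
    have "k \<in> Poly_Mapping.keys (0 :: 'a falg)" using assms(2) by (simp only: 2(2))
    then show ?thesis by simp
  qed
qed

text \<open>Evaluation at \<open>c\<close> of the coefficients with index in \<open>I\<close>. It provides the linear functionals that
  show that the spanning elements of the cyclic modules are independent.\<close>

definition eval_at :: "'k::field poly \<Rightarrow> 'k \<Rightarrow> int set \<Rightarrow> 'k falg \<Rightarrow> int \<Rightarrow> 'k" where
  "eval_at f c I a i = (if i \<in> I then poly (pcoeff (feval f a) i) c else 0)"

lemma feval_Areg: "\<alpha> \<noteq> 0 \<Longrightarrow> feval (fpoly \<alpha>) a \<in> rank_one 1 (neg_jumps \<alpha>)"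
  using Areg_eq[of \<alpha>] Areg_range[of \<alpha>] by blast

lemma feval_skew_laurent: "\<alpha> \<noteq> 0 \<Longrightarrow> feval (fpoly \<alpha>) a \<in> skew_laurent"
  using feval_Areg by (auto simp: rank_one_def graded_sub_def)

lemma eval_at_rules:
  assumes "\<alpha> \<noteq> 0"
  shows "eval_at (fpoly \<alpha>) c I (a + b) i = eval_at (fpoly \<alpha>) c I a i + eval_at (fpoly \<alpha>) c I b i"
    and "eval_at (fpoly \<alpha>) c I (a * fconst x) i = x * eval_at (fpoly \<alpha>) c I a i"
    and "eval_at (fpoly \<alpha>) c I (a * fgen GZ) i = (c + of_int i) * eval_at (fpoly \<alpha>) c I a i"
    and "eval_at (fpoly \<alpha>) c I (a * fgen GX) i = (if i \<in> I then poly (pcoeff (feval (fpoly \<alpha>) a) (i - 1)) c else 0)"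
    and "eval_at (fpoly \<alpha>) c I (a * fgen GY) i =
      (if i \<in> I then poly (fpoly \<alpha>) (c + of_int i) * poly (pcoeff (feval (fpoly \<alpha>) a) (i + 1)) c else 0)"
    and "a \<in> gwa_ideal (fpoly \<alpha>) \<Longrightarrow> eval_at (fpoly \<alpha>) c I a i = 0"
  using feval_skew_laurent[OF assms]
  by (simp_all add: eval_at_def feval_add pcoeff_add feval_mult[of _ a] pcoeff_mult_const pcoeff_mult_GX pcoeff_mult_GY
      pcoeff_mult_GZ feval_gwa_ideal algebra_simps)

lemma poly_fpoly: "poly (fpoly \<alpha>) x = x * (x + \<alpha>)"
  by (simp add: fpoly_def algebra_simps)

lemma fpoly_root: "b \<in> {0, \<alpha>} \<Longrightarrow> poly (fpoly \<alpha>) (- b) = 0"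
  by (auto simp: poly_fpoly)

text \<open>These are the scalars by which \<open>y\<close> acts on \<open>X\<^sub>b\<close>; being nonzero, they keep the powers of \<open>y\<close> from
  vanishing there.\<close>

lemma fpoly_nonroot:
  fixes \<alpha> :: "'k::field_char_0"
  assumes "\<alpha> \<notin> \<int>" "b \<in> {0, \<alpha>}" "i \<noteq> 0"
  shows "poly (fpoly \<alpha>) (of_int i - b) \<noteq> 0"
proof -
  have "poly (lin (i, 0)) (- of_int 0 - b) \<noteq> 0" "poly (lin (i, \<alpha>)) (- of_int 0 - b) \<noteq> 0"
    using root_lin_iff[OF assms(1) _ assms(2), of _ i 0] assms(3) by auto
  then have "of_int i - b \<noteq> 0" "of_int i - b + \<alpha> \<noteq> 0"
    by (auto simp: poly_lin algebra_simps)
  then show ?thesis by (simp add: poly_fpoly)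
qed

text \<open>\<open>X\<^sub>b\<close> is spanned by the powers of \<open>y\<close>, so it lives in degrees at most zero. Evaluating coefficients
  at \<open>- b\<close> respects the action because \<open>y\<close> enters degree \<open>0\<close> with the factor \<open>f(z)\<close>, which
  vanishes at \<open>- b\<close>.\<close>

lemma simple_X_model:
  fixes \<alpha> :: "'k::field_char_0"
  assumes \<alpha>: "\<alpha> \<notin> \<int>" and b: "b \<in> {0, \<alpha>}"
  shows "\<exists>\<kappa> e. weight_model (fpoly \<alpha>) (simple_X (fpoly \<alpha>) b) (- b) {..0} \<kappa> e"
proof -
  let ?f = "fpoly \<alpha>" and ?w = "fgen GZ + fconst b :: 'k falg"
  let ?e = "eval_at ?f (- b) {..0}"
  have \<alpha>0: "\<alpha> \<noteq> 0" using \<alpha> by auto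
  note rules = eval_at_rules[OF \<alpha>0, where c = "- b" and I = "{..0}"]
  have GX: "?e (a * fgen GX) i = (if i \<in> {..0} then ?e a (i - 1) else 0)" for a i
    by (simp add: rules) (simp add: eval_at_def)
  have GY: "?e (a * fgen GY) i = (if i \<in> {..0} then poly ?f (- b + of_int i) * ?e a (i + 1) else 0)" for a i
  proof (cases "i = 0")
    case True
    then show ?thesis using fpoly_root[OF b] by (simp add: rules)
  next
    case False
    then show ?thesis by (simp add: rules) (simp add: eval_at_def)
  qed
  have one: "?e 1 i = (if i = 0 then 1 else 0)" for i
    by (simp add: eval_at_def pcoeff_one)
  have pow: "?e (fgen GY ^ n) i = 0 \<longleftrightarrow> i \<noteq> - int n" for n i
  proof (induction n arbitrary: i)
    case (Suc n)
    have "poly ?f (- b + of_int i) \<noteq> 0" if "i = - int (Suc n)"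
      using fpoly_nonroot[OF \<alpha> b, of i] that by simp
    then show ?case
      unfolding power_Suc2 GY using Suc[of "i + 1"] by auto
  qed (simp add: one)
  have "weight_model ?f (cyclic_module ?f (right_ideal2 ?f (gwa_cls ?f (fgen GX)) (gwa_cls ?f ?w)))
    (- b) {..0} (module_cls ?f (fgen GX) ?w) ?e"
  proof (rule cyclic_weight_model[where b = "gen_pow GY"])
    show "?e (fgen GX) i = 0" for i using GX[of 1 i] by (simp add: one)
    show "?e ?w i = 0" for i
      using rules(1)[of "1 * fgen GZ" "1 * fconst b" i] rules(2)[of 1 b i] rules(3)[of 1 i]
      by (auto simp: one)
    show "?e (gen_pow GY i) j = 0 \<longleftrightarrow> i \<noteq> j \<or> i \<notin> {..0}" for i j
      using pow[of "nat (- i)" j] rules(6)[OF gwa_ideal_zero] by (auto simp: gen_pow_def)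
    show "gen_pow GY i = 0" if "i \<notin> {..0}" for i using that by (simp add: gen_pow_def)
    show "\<exists>x. Poly_Mapping.single v 1 - fconst x * gen_pow GY (wrd_deg v) \<in> ideal_lift ?f (fgen GX) ?w" for v
    proof (rule words_spanning[where s = "- 1" and c = "- b" and F = "pcompose ?f [:-1, 1:]"])
      show "fgen GY * fgen GZ - (fgen GZ + fconst (- 1)) * fgen GY \<in> gwa_ideal ?f"
        by (rule gwa_ideal_rel) (simp add: gwa_rels_def fconst_uminus)
      show "fgen GY * fgen GX - fz (pcompose ?f [:-1, 1:]) \<in> gwa_ideal ?f"
        by (rule gwa_ideal_rel) (simp add: gwa_rels_def)
    qed (auto simp: fconst_uminus)
    show "wrd_deg v = i" if "v \<in> Poly_Mapping.keys (gen_pow GY i :: 'k falg)" for i v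
      using gen_pow_keys[OF _ that] by simp
  qed (rule rules(1-3) GX GY | erule rules(6))+
  then show ?thesis unfolding simple_X_def by blast
qed

text \<open>Before the shift \<open>Y\<^sub>b\<close> is spanned by the powers of \<open>x\<close>, in degrees at least zero, and coefficients
  are evaluated at \<open>1 - b\<close>, because \<open>z + b - 1\<close> is killed. What \<open>x\<close> carries into degree \<open>0\<close> comes from
  \<open>A\<^bsub>-1\<^esub> = k[z] f(z - 1) x\<^bsup>-1\<^esup>\<close> and vanishes at \<open>1 - b\<close>.\<close>

lemma simple_Y_model:
  fixes \<alpha> :: "'k::field_char_0"
  assumes \<alpha>: "\<alpha> \<notin> \<int>" and b: "b \<in> {0, \<alpha>}"
  shows "\<exists>\<kappa> e. weight_model (fpoly \<alpha>) (simple_Y (fpoly \<alpha>) b) (- b) {1..} \<kappa> e"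
proof -
  let ?f = "fpoly \<alpha>" and ?w = "fgen GZ + fconst b - 1 :: 'k falg"
  let ?c = "1 - b"
  let ?e = "eval_at ?f ?c {0..}"
  have \<alpha>0: "\<alpha> \<noteq> 0" using \<alpha> by auto
  note rules = eval_at_rules[OF \<alpha>0, where c = ?c and I = "{0..}"]
  have GX: "?e (a * fgen GX) i = (if i \<in> {0..} then ?e a (i - 1) else 0)" for a i
  proof (cases "i = 0")
    case True
    have "tail_prod (neg_jumps \<alpha>) (-1) dvd pcoeff (feval ?f a) (-1)"
      using feval_Areg[OF \<alpha>0, of a] by (simp add: rank_one_def graded_sub_def)
    then have "translate ?f (-1) dvd pcoeff (feval ?f a) (-1)"
      using tail_neg_jumps_neg[OF \<alpha>0, of "-1"] by (simp add: tail_neg_jumps_nonneg)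
    then have "poly (pcoeff (feval ?f a) (-1)) ?c = 0"
      using fpoly_root[OF b] by (auto elim!: dvdE)
    then show ?thesis using True by (simp add: rules) (simp add: eval_at_def)
  next
    case False
    then show ?thesis by (simp add: rules) (simp add: eval_at_def)
  qed
  have GY: "?e (a * fgen GY) i = (if i \<in> {0..} then poly ?f (?c + of_int i) * ?e a (i + 1) else 0)" for a i
    by (simp add: rules) (simp add: eval_at_def)
  have one: "?e 1 i = (if i = 0 then 1 else 0)" for i
    by (simp add: eval_at_def pcoeff_one)
  have pow: "?e (fgen GX ^ n) i = 0 \<longleftrightarrow> i \<noteq> int n" for n i
  proof (induction n arbitrary: i)
    case (Suc n)
    show ?case
      unfolding power_Suc2 GX using Suc[of "i - 1"] by auto
  qed (simp add: one)
  have *: "weight_model ?f (cyclic_module ?f (right_ideal2 ?f (gwa_cls ?f (fgen GY)) (gwa_cls ?f ?w)))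
    ?c {0..} (module_cls ?f (fgen GY) ?w) ?e"
  proof (rule cyclic_weight_model[where b = "gen_pow GX"])
    show "?e (fgen GY) i = 0" for i using GY[of 1 i] by (simp add: one)
    have w: "?w = 1 * fgen GZ + 1 * fconst (b - 1)"
      using fconst_add[of b "- 1"] by (simp add: fconst_uminus)
    show "?e ?w i = 0" for i
      unfolding w rules one by auto
    show "?e (gen_pow GX i) j = 0 \<longleftrightarrow> i \<noteq> j \<or> i \<notin> {0..}" for i j
      using pow[of "nat i" j] rules(6)[OF gwa_ideal_zero] by (auto simp: gen_pow_def)
    show "gen_pow GX i = 0" if "i \<notin> {0..}" for i using that by (simp add: gen_pow_def)
    show "\<exists>x. Poly_Mapping.single v 1 - fconst x * gen_pow GX (wrd_deg v) \<in> ideal_lift ?f (fgen GY) ?w" for v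
    proof (rule words_spanning[where s = 1 and c = ?c and F = ?f])
      show "fgen GX * fgen GZ - (fgen GZ + fconst 1) * fgen GX \<in> gwa_ideal ?f"
        by (rule gwa_ideal_rel) (simp add: gwa_rels_def)
      show "fgen GX * fgen GY - fz ?f \<in> gwa_ideal ?f"
        by (rule gwa_ideal_rel) (simp add: gwa_rels_def)
      have "fconst ?c = 1 - fconst b" using fconst_add[of 1 "- b"] by (simp add: fconst_uminus)
      then show "?w = fgen GZ - fconst ?c" by simp
    qed auto
    show "wrd_deg v = i" if "v \<in> Poly_Mapping.keys (gen_pow GX i :: 'k falg)" for i v
      using gen_pow_keys[OF _ that] by simp
  qed (rule rules(1-3) GX GY | erule rules(6))+
  have "{i. i - 1 \<in> {0..}} = {1::int..}" by auto
  then show ?thesis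
    using weight_model_shift[OF *, of 1] unfolding simple_Y_def by auto
qed

section \<open>The functors on rank one projectives\<close>


lemma shifted_models:
  fixes \<alpha> :: "'k::field_char_0"
  assumes \<alpha>: "\<alpha> \<notin> \<int>" and b: "b \<in> {0, \<alpha>}"
  shows "\<exists>\<kappa> e. weight_model (fpoly \<alpha>) (gr_shift (simple_X (fpoly \<alpha>) b) n) (- of_int n - b) {..n} \<kappa> e"
    and "\<exists>\<kappa> e. weight_model (fpoly \<alpha>) (gr_shift (simple_Y (fpoly \<alpha>) b) n) (- of_int n - b) {n<..} \<kappa> e"
proof -
  have "{i. i - n \<in> {..0}} = {..n}" "{i. i - n \<in> {1..}} = {n<..}" "- b - of_int n = - of_int n - b"
    by auto
  then show "\<exists>\<kappa> e. weight_model (fpoly \<alpha>) (gr_shift (simple_X (fpoly \<alpha>) b) n) (- of_int n - b) {..n} \<kappa> e"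
    and "\<exists>\<kappa> e. weight_model (fpoly \<alpha>) (gr_shift (simple_Y (fpoly \<alpha>) b) n) (- of_int n - b) {n<..} \<kappa> e"
    using weight_model_shift simple_X_model[OF assms] simple_Y_model[OF assms] by metis+
qed

definition toggle :: "(int \<times> 'k::field) set \<Rightarrow> int \<times> 'k \<Rightarrow> (int \<times> 'k) set" where
  "toggle T t = (if t \<in> T then T - {t} else insert t T)"

lemma minus_lin: "[:- (- of_int n - b), 1:] = lin (n, b)"
  by (simp add: lin_def)

text \<open>Multiplying \<open>p\<^sub>i\<close> by \<open>z + n + b\<close> for \<open>i \<le> n\<close> creates the jump \<open>(n, b)\<close>. Multiplying by it for \<open>i > n\<close> is
  the same as multiplying everywhere and deleting the jump.\<close>

lemma toggle_graded_sub:
  assumes T: "jump_set \<alpha> T" and h: "h \<noteq> 0"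
    and I: "I = (if (n, b) \<in> T then {n<..} else {..n})"
  shows "{q \<in> rank_one h T. \<forall>i\<in>I. h * tail_prod T i * lin (n, b) dvd pcoeff q i} =
    rank_one (if (n, b) \<in> T then h * lin (n, b) else h) (toggle T (n, b))" (is "?L = rank_one ?h ?T")
proof -
  have *: "?h * tail_prod ?T i = (if i \<in> I then h * tail_prod T i * lin (n, b) else h * tail_prod T i)" for i
  proof (cases "(n, b) \<in> T")
    case True
    then have "T = insert (n, b) (T - {(n, b)})" by auto
    moreover have "jump_set \<alpha> (T - {(n, b)})" using T by (rule jump_set_subset) auto
    ultimately have "tail_prod T i = (if i \<le> n then lin (n, b) else 1) * tail_prod (T - {(n, b)}) i"
      using tail_prod_insert[of \<alpha> "T - {(n, b)}" "(n, b)" i] by auto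
    then show ?thesis using True by (auto simp: toggle_def I)
  next
    case False
    then show ?thesis using tail_prod_insert[OF T, of "(n, b)" i] by (auto simp: toggle_def I)
  qed
  show ?thesis
    unfolding rank_one_def graded_sub_def * by (auto dest: dvd_mult_left)
qed

text \<open>Exactly one of \<open>X\<^sub>b\<langle>n\<rangle>\<close>, \<open>Y\<^sub>b\<langle>n\<rangle>\<close> is a quotient. The ratio \<open>p\<^sub>n / p\<^bsub>n+1\<^esub>\<close> vanishes at
  \<open>c = - n - b\<close> precisely if \<open>(n, b)\<close> is a jump, and its complement vanishes there precisely if it is
  not; all other ratios are nonzero at \<open>c\<close>. This gives the boundary conditions for one of the two
  surjections and violates them for the other.\<close>

lemma iota1_rank_one:
  fixes \<alpha> :: "'k::field_char_0"
  assumes \<alpha>: "\<alpha> \<notin> \<int>" and b: "b \<in> {0, \<alpha>}" and T: "jump_set \<alpha> T" and h: "h \<noteq> 0"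
  shows "iota1 (fpoly \<alpha>) b n (rank_one h T) =
    rank_one (if (n, b) \<in> T then h * lin (n, b) else h) (toggle T (n, b))" (is "_ = ?K")
proof -
  let ?f = "fpoly \<alpha>" and ?c = "- of_int n - b"
  let ?X = "gr_shift (simple_X ?f b) n" and ?Y = "gr_shift (simple_Y ?f b) n"
  let ?p = "\<lambda>i. h * tail_prod T i"
  have \<alpha>0: "\<alpha> \<noteq> 0" using \<alpha> by auto
  note ok = right_stable_tail[OF T \<alpha>0 h]
  note step = tail_prod_step[OF T] and rs = ratio_mult_coratio[OF T \<alpha>0]
  have ps: "h * tail_prod T i = ratio T i * (h * tail_prod T (i + 1))" for i
    by (simp add: step[of i] mult_ac)
  note rr = ratio_root_iff[OF \<alpha> b T] and cr = coratio_root_iff[OF \<alpha> b T]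
  obtain \<kappa>X eX where X: "weight_model ?f ?X ?c {..n} \<kappa>X eX"
    using shifted_models(1)[OF \<alpha> b] by blast
  obtain \<kappa>Y eY where Y: "weight_model ?f ?Y ?c {n<..} \<kappa>Y eY"
    using shifted_models(2)[OF \<alpha> b] by blast
  interpret X: weight_model ?f ?X ?c "{..n}" \<kappa>X eX by (rule X)
  interpret Y: weight_model ?f ?Y ?c "{n<..}" \<kappa>Y eY by (rule Y)
  define S where "S = (if (n, b) \<in> T then ?Y else ?X)"
  have "\<exists>\<phi>\<in>gr_hom ?f (qgr_sub ?f (graded_sub ?p)) S. \<phi> ` graded_sub ?p = carrier S"
  proof (cases "(n, b) \<in> T")
    case True
    \<comment> \<open>forced by the recursion \<open>lam i = r i (c) lam (i + 1)\<close> and \<open>lam (n + 1) = 1\<close>\<close>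
    let ?lam = "\<lambda>i. inverse (\<Prod>k\<in>{n<..<i}. poly (ratio T k) ?c)"
    have "\<exists>\<phi>\<in>gr_hom ?f (qgr_sub ?f (graded_sub ?p)) ?Y. \<phi> ` graded_sub ?p = carrier ?Y"
    proof (rule Y.surjection_exists[OF ok, where r = "ratio T" and s = "coratio \<alpha> T" and lam = ?lam])
      fix i assume i: "i \<in> {n<..}" "i + 1 \<in> {n<..}"
      then have "{n<..<i + 1} = insert i {n<..<i}" by auto
      then show "?lam i = poly (ratio T i) ?c * ?lam (i + 1)"
        using i rr[of i n] by simp
    qed (rule ps | rule rs | use True in \<open>auto simp: rr cr\<close>)+
    then show ?thesis using True by (simp add: S_def)
  next
    case False
    \<comment> \<open>the same recursion, started from \<open>lam n = 1\<close>\<close>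
    let ?lam = "\<lambda>i. \<Prod>k\<in>{i..<n}. poly (ratio T k) ?c"
    have "\<exists>\<phi>\<in>gr_hom ?f (qgr_sub ?f (graded_sub ?p)) ?X. \<phi> ` graded_sub ?p = carrier ?X"
    proof (rule X.surjection_exists[OF ok, where r = "ratio T" and s = "coratio \<alpha> T" and lam = ?lam])
      fix i assume i: "i \<in> {..n}" "i + 1 \<in> {..n}"
      then have "{i..<n} = insert i {i + 1..<n}" by auto
      then show "?lam i = poly (ratio T i) ?c * ?lam (i + 1)"
        by simp
    qed (rule ps | rule rs | use False in \<open>auto simp: rr cr\<close>)+
    then show ?thesis using False by (simp add: S_def)
  qed
  then obtain \<phi>0 where \<phi>0: "\<phi>0 \<in> gr_hom ?f (qgr_sub ?f (graded_sub ?p)) S" "\<phi>0 ` graded_sub ?p = carrier S" by blast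
  have kernel: "{q \<in> graded_sub ?p. \<phi> q = \<zero>\<^bsub>M\<^esub>} = ?K"
    if M: "M \<in> {?X, ?Y}" and \<phi>: "\<phi> \<in> gr_hom ?f (qgr_sub ?f (graded_sub ?p)) M" "\<phi> ` graded_sub ?p = carrier M" for M \<phi>
  proof -
    have eX: "{q \<in> graded_sub ?p. \<phi> q = \<zero>\<^bsub>M\<^esub>} = {q \<in> graded_sub ?p. \<forall>i\<in>{..n}. ?p i * lin (n, b) dvd pcoeff q i}"
      if "M = ?X" using X.kernel_of_surjection[OF ok, of \<phi>] \<phi> that by (simp only: minus_lin)
    have eY: "{q \<in> graded_sub ?p. \<phi> q = \<zero>\<^bsub>M\<^esub>} = {q \<in> graded_sub ?p. \<forall>i\<in>{n<..}. ?p i * lin (n, b) dvd pcoeff q i}"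
      if "M = ?Y" using Y.kernel_of_surjection[OF ok, of \<phi>] \<phi> that by (simp only: minus_lin)
    have mult: "q * feval ?f a \<in> {q \<in> graded_sub ?p. \<phi> q = \<zero>\<^bsub>M\<^esub>}" if "q \<in> {q \<in> graded_sub ?p. \<phi> q = \<zero>\<^bsub>M\<^esub>}" for q a
      using that M X.kernel_mult_feval[OF ok, of \<phi> q a] Y.kernel_mult_feval[OF ok, of \<phi> q a] \<phi>
        graded_sub_mult_feval[OF ok, of q a] by auto
    define q where "q i = qmon (Fract (?p i) 1) i" for i
    have q: "q i \<in> graded_sub ?p" "pcoeff (q i) j = (if j = i then ?p i else 0)" for i j
      by (auto simp: q_def graded_sub_def pcoeff_qmon)
    have lin_dvd: "lin (n, b) dvd g \<longleftrightarrow> poly g ?c = 0" for g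
      unfolding poly_eq_0_iff_dvd minus_lin ..
    have "M = S"
    proof (cases "(n, b) \<in> T")
      case True
      \<comment> \<open>the generator of degree \<open>n + 1\<close> would lie in the kernel, but not its product with \<open>y\<close>\<close>
      have "M \<noteq> ?X"
      proof
        assume MX: "M = ?X"
        have "q (n + 1) * feval ?f (fgen GY) \<in> {q \<in> graded_sub ?p. \<phi> q = \<zero>\<^bsub>M\<^esub>}"
          by (rule mult) (simp add: eX[OF MX] q)
        then have "\<forall>i\<in>{..n}. ?p i * lin (n, b) dvd pcoeff (q (n + 1) * feval ?f (fgen GY)) i"
          unfolding eX[OF MX] by blast
        then have "?p n * lin (n, b) dvd pcoeff (q (n + 1) * feval ?f (fgen GY)) n" by (rule bspec) simp
        then have "?p n * lin (n, b) dvd ?p (n + 1) * translate ?f n"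
          unfolding pcoeff_mult_GY[OF graded_sub_skew_laurent[OF q(1)]] q(2) by (simp only: if_True refl)
        then have "?p n * lin (n, b) dvd ?p n * coratio \<alpha> T n"
          by (simp add: step[of n] rs[of n, symmetric] mult_ac)
        then have "lin (n, b) dvd coratio \<alpha> T n" using h by (simp only: dvd_mult_cancel_left) simp
        then show False using True cr by (simp add: lin_dvd)
      qed
      then show ?thesis using M True by (simp add: S_def)
    next
      case False
      \<comment> \<open>the generator of degree \<open>n\<close> would lie in the kernel, but not its product with \<open>x\<close>\<close>
      have "M \<noteq> ?Y"
      proof
        assume MY: "M = ?Y"
        have "q n * feval ?f (fgen GX) \<in> {q \<in> graded_sub ?p. \<phi> q = \<zero>\<^bsub>M\<^esub>}"
          by (rule mult) (simp add: eY[OF MY] q)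
        then have "\<forall>i\<in>{n<..}. ?p i * lin (n, b) dvd pcoeff (q n * feval ?f (fgen GX)) i"
          unfolding eY[OF MY] by blast
        then have "?p (n + 1) * lin (n, b) dvd pcoeff (q n * feval ?f (fgen GX)) (n + 1)" by (rule bspec) simp
        then have "?p (n + 1) * lin (n, b) dvd ?p n"
          unfolding pcoeff_mult_GX[OF graded_sub_skew_laurent[OF q(1)]] q(2) by (simp only: add_diff_cancel_right' if_True refl)
        then have "?p (n + 1) * lin (n, b) dvd ?p (n + 1) * ratio T n"
          by (simp add: step[of n] mult_ac)
        then have "lin (n, b) dvd ratio T n" using h by (simp only: dvd_mult_cancel_left) simp
        then show False using False rr by (simp add: lin_dvd)
      qed
      then show ?thesis using M False by (simp add: S_def)
    qed
    then show ?thesis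
      using eX eY toggle_graded_sub[OF T h refl, of n b]
      by (auto simp: S_def rank_one_def split: if_splits)
  qed
  show ?thesis
    unfolding iota1_def
  proof (rule the_equality)
    show "\<exists>S\<in>{?X, ?Y}. \<exists>\<phi>\<in>gr_hom ?f (qgr_sub ?f (rank_one h T)) S.
        \<phi> ` rank_one h T = carrier S \<and> ?K = {p \<in> rank_one h T. \<phi> p = \<zero>\<^bsub>S\<^esub>}"
      using kernel[of S \<phi>0] \<phi>0 unfolding rank_one_def[of h T]
      by (intro bexI[of _ S] bexI[of _ \<phi>0]) (auto simp: S_def)
  next
    fix K assume "\<exists>S\<in>{?X, ?Y}. \<exists>\<phi>\<in>gr_hom ?f (qgr_sub ?f (rank_one h T)) S.
        \<phi> ` rank_one h T = carrier S \<and> K = {p \<in> rank_one h T. \<phi> p = \<zero>\<^bsub>S\<^esub>}"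
    then show "K = ?K" using kernel unfolding rank_one_def[of h T] by blast
  qed
qed


definition symm_diff :: "'a set \<Rightarrow> 'a set \<Rightarrow> 'a set" where
  "symm_diff A B = (A - B) \<union> (B - A)"

definition lin_prod :: "(int \<times> 'k::field) set \<Rightarrow> 'k poly" where
  "lin_prod U = (\<Prod>t\<in>U. lin t)"

lemma lin_prod_nonzero [simp]: "lin_prod U \<noteq> 0"
  by (cases "finite U") (auto simp: lin_prod_def)

lemma jump_set_symm_diff:
  assumes "jump_set \<alpha> T" "finite U" "U \<subseteq> UNIV \<times> {0, \<alpha>}"
  shows "jump_set \<alpha> (symm_diff T U)"
proof -
  obtain N where N: "\<forall>t\<in>T. fst t \<le> N" using assms by (auto simp: jump_set_def)
  have "finite (insert N (fst ` U))" using assms by simp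
  then have "\<forall>t\<in>symm_diff T U. fst t \<le> Max (insert N (fst ` U))"
    using N by (auto simp: symm_diff_def intro: order_trans Max_ge)
  then show ?thesis using assms by (auto simp: jump_set_def symm_diff_def)
qed

lemma foldr_iota1:
  fixes \<alpha> :: "'k::field_char_0"
  assumes \<alpha>: "\<alpha> \<notin> \<int>" and b: "b \<in> {0, \<alpha>}" and T: "jump_set \<alpha> T" and h: "h \<noteq> 0" and d: "distinct ns"
  shows "foldr (iota1 (fpoly \<alpha>) b) ns (rank_one h T) =
    rank_one (h * lin_prod (T \<inter> set ns \<times> {b})) (symm_diff T (set ns \<times> {b}))"
  using d
proof (induction ns)
  case Nil
  then show ?case by (simp add: lin_prod_def symm_diff_def)
next
  case (Cons n ns)
  let ?U = "set ns \<times> {b}"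
  have U: "set (n # ns) \<times> {b} = insert (n, b) ?U" "(n, b) \<notin> ?U" using Cons.prems by auto
  have "foldr (iota1 (fpoly \<alpha>) b) (n # ns) (rank_one h T) =
      iota1 (fpoly \<alpha>) b n (rank_one (h * lin_prod (T \<inter> ?U)) (symm_diff T ?U))"
    using Cons by simp
  also have "\<dots> = rank_one (if (n, b) \<in> symm_diff T ?U then h * lin_prod (T \<inter> ?U) * lin (n, b) else h * lin_prod (T \<inter> ?U))
      (toggle (symm_diff T ?U) (n, b))"
    by (rule iota1_rank_one[OF \<alpha> b jump_set_symm_diff[OF T]]) (use b h in auto)
  also have "toggle (symm_diff T ?U) (n, b) = symm_diff T (insert (n, b) ?U)"
    using U by (auto simp: toggle_def symm_diff_def)
  also have "(if (n, b) \<in> symm_diff T ?U then h * lin_prod (T \<inter> ?U) * lin (n, b) else h * lin_prod (T \<inter> ?U)) =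
      h * lin_prod (T \<inter> insert (n, b) ?U)"
    using U by (auto simp: symm_diff_def lin_prod_def Int_insert_right mult_ac)
  finally show ?case using U by simp
qed

text \<open>The jumps toggled by \<open>\<iota>\<^sub>\<gamma>\<close>. It turns the two components of \<open>\<gamma>\<close> into one subset of
  \<open>\<int> \<times> {0, \<alpha>}\<close>.\<close>

definition gam_jumps :: "'k::field \<Rightarrow> gam \<Rightarrow> (int \<times> 'k) set" where
  "gam_jumps \<alpha> \<gamma> = zset (fst \<gamma>) \<times> {0} \<union> zset (snd \<gamma>) \<times> {\<alpha>}"

lemma finite_zset [simp]: "finite (zset I)"
  using zset by blast

lemma finite_gam_jumps [simp]: "finite (gam_jumps \<alpha> \<gamma>)"
  by (simp add: gam_jumps_def)

lemma gam_jumps_subset: "gam_jumps \<alpha> \<gamma> \<subseteq> UNIV \<times> {0, \<alpha>}"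
  by (auto simp: gam_jumps_def)

text \<open>Toggling commutes, and each removed jump contributes its linear factor to \<open>h\<close>.\<close>

lemma iota_rank_one:
  fixes \<alpha> :: "'k::field_char_0"
  assumes \<alpha>: "\<alpha> \<notin> \<int>" and T: "jump_set \<alpha> T" and h: "h \<noteq> 0"
  shows "iota \<alpha> \<gamma> (rank_one h T) = rank_one (h * lin_prod (T \<inter> gam_jumps \<alpha> \<gamma>)) (symm_diff T (gam_jumps \<alpha> \<gamma>))"
proof -
  let ?I = "zset (fst \<gamma>) \<times> {0}" and ?J = "zset (snd \<gamma>) \<times> {\<alpha>}"
  have \<alpha>0: "\<alpha> \<noteq> 0" using \<alpha> by auto
  have dj: "?I \<inter> ?J = {}" using \<alpha>0 by auto
  have "iota \<alpha> \<gamma> (rank_one h T) =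
      foldr (iota1 (fpoly \<alpha>) 0) (sorted_list_of_set (zset (fst \<gamma>))) (rank_one (h * lin_prod (T \<inter> ?J)) (symm_diff T ?J))"
    unfolding iota_def by (subst foldr_iota1[OF \<alpha> _ T h]) auto
  also have "\<dots> = rank_one (h * lin_prod (T \<inter> ?J) * lin_prod (symm_diff T ?J \<inter> ?I)) (symm_diff (symm_diff T ?J) ?I)"
    by (subst foldr_iota1[OF \<alpha> _ jump_set_symm_diff[OF T]]) (use h in auto)
  also have "symm_diff T ?J \<inter> ?I = T \<inter> ?I" using dj by (auto simp: symm_diff_def)
  also have "symm_diff (symm_diff T ?J) ?I = symm_diff T (gam_jumps \<alpha> \<gamma>)" using dj by (auto simp: symm_diff_def gam_jumps_def)
  also have "h * lin_prod (T \<inter> ?J) * lin_prod (T \<inter> ?I) = h * lin_prod (T \<inter> gam_jumps \<alpha> \<gamma>)"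
  proof -
    have "lin_prod (T \<inter> gam_jumps \<alpha> \<gamma>) = lin_prod (T \<inter> ?I) * lin_prod (T \<inter> ?J)"
      unfolding gam_jumps_def Int_Un_distrib lin_prod_def using dj by (intro prod.union_disjoint) auto
    then show ?thesis by (simp add: mult_ac)
  qed
  finally show ?thesis .
qed

lemma lin_prod_Times: "lin_prod (A \<times> {b}) = (\<Prod>j\<in>A. [:of_int j + b, 1:])"
  unfolding lin_prod_def by (rule prod.reindex_bij_witness[of _ "\<lambda>j. (j, b)" fst]) (auto simp: lin_def)

lemma hpoly_lin_prod: "\<alpha> \<noteq> 0 \<Longrightarrow> hpoly \<alpha> \<gamma> = lin_prod (gam_jumps \<alpha> \<gamma>)"
proof -
  assume "\<alpha> \<noteq> 0"
  then have "lin_prod (gam_jumps \<alpha> \<gamma>) = lin_prod (zset (fst \<gamma>) \<times> {0}) * lin_prod (zset (snd \<gamma>) \<times> {\<alpha>})"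
    unfolding gam_jumps_def lin_prod_def[of "_ \<union> _"] by (subst prod.union_disjoint) (auto simp: lin_prod_def)
  then show ?thesis by (simp add: hpoly_def lin_prod_Times)
qed

section \<open>Homogeneous elements of D\<close>


lemma gam_jumps_plus: "\<alpha> \<noteq> 0 \<Longrightarrow> gam_jumps \<alpha> (\<gamma> + \<delta>) = symm_diff (gam_jumps \<alpha> \<gamma>) (gam_jumps \<alpha> \<delta>)"
  by (auto simp: gam_jumps_def symm_diff_def plus_zfin.rep_eq)

lemma gam_jumps_inter: "\<alpha> \<noteq> 0 \<Longrightarrow> gam_jumps \<alpha> (gam_inter \<gamma> \<delta>) = gam_jumps \<alpha> \<gamma> \<inter> gam_jumps \<alpha> \<delta>"
  by (auto simp: gam_jumps_def gam_inter_def zint.rep_eq)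

lemma gam_jumps_zero [simp]: "gam_jumps \<alpha> 0 = {}"
  by (simp add: gam_jumps_def zero_zfin.rep_eq)

lemma gam_jumps_inject:
  assumes "\<alpha> \<noteq> 0" "gam_jumps \<alpha> \<gamma> = gam_jumps \<alpha> \<delta>" shows "\<gamma> = \<delta>"
proof -
  have "zset (fst x) = {n. (n, 0) \<in> gam_jumps \<alpha> x}" "zset (snd x) = {n. (n, \<alpha>) \<in> gam_jumps \<alpha> x}" for x
    using assms(1) by (auto simp: gam_jumps_def)
  note key = this
  have "zset (fst \<gamma>) = zset (fst \<delta>)" "zset (snd \<gamma>) = zset (snd \<delta>)"
    unfolding key[of \<gamma>] key[of \<delta>] assms(2) by (rule refl)+
  then show ?thesis by (simp add: zset_inject prod_eq_iff)
qed

lemma hpoly_zero [simp]: "hpoly \<alpha> 0 = 1"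
  by (simp add: hpoly_def zero_zfin.rep_eq)

lemma lin_prod_Un_disjoint: "finite U \<Longrightarrow> finite V \<Longrightarrow> U \<inter> V = {} \<Longrightarrow> lin_prod (U \<union> V) = lin_prod U * lin_prod V"
  unfolding lin_prod_def by (rule prod.union_disjoint)

lemma lin_prod_split:
  assumes "finite U" shows "lin_prod U = lin_prod (U - V) * lin_prod (U \<inter> V)"
proof -
  have "lin_prod ((U - V) \<union> (U \<inter> V)) = lin_prod (U - V) * lin_prod (U \<inter> V)"
    by (rule lin_prod_Un_disjoint) (use assms in auto)
  then show ?thesis by (simp only: Un_Diff_Int)
qed

lemma hpoly_nonzero: "\<alpha> \<noteq> 0 \<Longrightarrow> hpoly \<alpha> \<gamma> \<noteq> 0"
  by (simp add: hpoly_lin_prod)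

lemma hpoly_mult:
  assumes "\<alpha> \<noteq> 0"
  shows "hpoly \<alpha> \<gamma> * hpoly \<alpha> \<delta> = hpoly \<alpha> (\<gamma> + \<delta>) * (hpoly \<alpha> (gam_inter \<gamma> \<delta>))\<^sup>2"
proof -
  let ?G = "gam_jumps \<alpha> \<gamma>" and ?D = "gam_jumps \<alpha> \<delta>"
  have "lin_prod ?G = lin_prod (?G - ?D) * lin_prod (?G \<inter> ?D)"
    by (rule lin_prod_split) simp
  moreover have "lin_prod ?D = lin_prod (?D - ?G) * lin_prod (?G \<inter> ?D)"
    using lin_prod_split[of ?D ?G] by (simp add: Int_commute)
  moreover have "lin_prod (symm_diff ?G ?D) = lin_prod (?G - ?D) * lin_prod (?D - ?G)"
    unfolding symm_diff_def by (rule lin_prod_Un_disjoint) auto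
  ultimately show ?thesis
    using assms by (simp add: hpoly_lin_prod gam_jumps_plus gam_jumps_inter power2_eq_square mult_ac)
qed

locale nonintegral =
  fixes \<alpha> :: "'k::field_char_0"
  assumes nonint: "\<alpha> \<notin> \<int>"
begin

lemma alpha_nonzero: "\<alpha> \<noteq> 0"
  using nonint by auto

lemma iota_Areg:
  "iota \<alpha> \<gamma> (Areg \<alpha>) = rank_one (lin_prod (neg_jumps \<alpha> \<inter> gam_jumps \<alpha> \<gamma>)) (symm_diff (neg_jumps \<alpha>) (gam_jumps \<alpha> \<gamma>))"
  by (simp add: Areg_eq alpha_nonzero iota_rank_one[OF nonint jump_set_neg_jumps])

lemma jump_set_symm_diff_neg_jumps: "jump_set \<alpha> (symm_diff (neg_jumps \<alpha>) (gam_jumps \<alpha> \<gamma>))"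
  by (intro jump_set_symm_diff jump_set_neg_jumps finite_gam_jumps gam_jumps_subset)

text \<open>Each jump of \<open>\<epsilon>\<close> is toggled twice and hence removed once: \<open>\<iota>\<^sub>\<epsilon>\<^sup>2 A = h\<^sub>\<epsilon> A\<close>.\<close>

lemma iota_square_Areg: "iota \<alpha> \<epsilon> (iota \<alpha> \<epsilon> (Areg \<alpha>)) = rank_one (hpoly \<alpha> \<epsilon>) (neg_jumps \<alpha>)"
proof -
  let ?E = "gam_jumps \<alpha> \<epsilon>" and ?N = "neg_jumps \<alpha>"
  have "lin_prod ?E = lin_prod (?N \<inter> ?E) * lin_prod (symm_diff ?N ?E \<inter> ?E)"
  proof -
    have "?E = (?N \<inter> ?E) \<union> (symm_diff ?N ?E \<inter> ?E)" by (auto simp: symm_diff_def)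
    moreover have "lin_prod ((?N \<inter> ?E) \<union> (symm_diff ?N ?E \<inter> ?E)) = lin_prod (?N \<inter> ?E) * lin_prod (symm_diff ?N ?E \<inter> ?E)"
      by (rule lin_prod_Un_disjoint) (auto simp: symm_diff_def)
    ultimately show ?thesis by simp
  qed
  moreover have "symm_diff (symm_diff ?N ?E) ?E = ?N" by (auto simp: symm_diff_def)
  ultimately show ?thesis
    by (simp add: iota_Areg iota_rank_one[OF nonint jump_set_symm_diff_neg_jumps] hpoly_lin_prod alpha_nonzero)
qed

text \<open>In degree zero \<open>A\<close> is \<open>k[z]\<close>. A negative jump of \<open>\<gamma>\<close> is removed and contributes its factor to \<open>h\<close>; a
  nonnegative one is created and contributes its factor to the divisor in degree \<open>0\<close>. In both cases
  the factor appears once.\<close>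

lemma degree_zero_part:
  "lin_prod (neg_jumps \<alpha> \<inter> gam_jumps \<alpha> \<gamma>) * tail_prod (symm_diff (neg_jumps \<alpha>) (gam_jumps \<alpha> \<gamma>)) 0 = hpoly \<alpha> \<gamma>"
proof -
  let ?G = "gam_jumps \<alpha> \<gamma>" and ?N = "neg_jumps \<alpha>"
  have "{t \<in> symm_diff ?N ?G. 0 \<le> fst t} = ?G - ?N"
    using gam_jumps_subset[of \<alpha> \<gamma>] by (auto simp: symm_diff_def neg_jumps_def)
  moreover have "lin_prod ((?N \<inter> ?G) \<union> (?G - ?N)) = lin_prod (?N \<inter> ?G) * lin_prod (?G - ?N)"
    by (rule lin_prod_Un_disjoint) auto
  moreover have "(?N \<inter> ?G) \<union> (?G - ?N) = ?G" by auto
  ultimately show ?thesis by (simp add: tail_prod_def lin_prod_def hpoly_lin_prod alpha_nonzero)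
qed

lemma hpoly_mult_Areg:
  assumes "q \<in> Areg \<alpha>" shows "qpoly (hpoly \<alpha> \<gamma> * r) * q \<in> iota \<alpha> \<gamma> (Areg \<alpha>)"
proof -
  obtain a where a: "q = feval (fpoly \<alpha>) a" using assms by (auto simp: Areg_range)
  have "qpoly (hpoly \<alpha> \<gamma> * r) \<in> iota \<alpha> \<gamma> (Areg \<alpha>)"
    by (auto simp: iota_Areg rank_one_def graded_sub_def pcoeff_qmon degree_zero_part)
  then show ?thesis
    unfolding a iota_Areg rank_one_def by (intro graded_sub_mult_feval right_stable_tail jump_set_symm_diff_neg_jumps alpha_nonzero) simp_all
qed

lemma rank_one_qpoly_mult: "q \<in> rank_one h T \<Longrightarrow> qpoly g * q \<in> rank_one (g * h) T"
  by (auto simp: rank_one_def graded_sub_def pcoeff_qpoly_mult mult.assoc)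

lemma Areg_qpoly_mult: "q \<in> Areg \<alpha> \<Longrightarrow> qpoly g * q \<in> Areg \<alpha>"
  by (auto simp: Areg_eq[OF alpha_nonzero] rank_one_def graded_sub_def pcoeff_qpoly_mult)

lemma one_Areg: "1 \<in> Areg \<alpha>"
  unfolding Areg_range by (rule range_eqI[of _ _ 1]) simp

text \<open>The morphism with coordinates \<open>(\<gamma>, r)\<close>. The polynomial \<open>h\<^sub>\<gamma>\<close> is divided out so that \<open>r\<close> is arbitrary.\<close>

definition D_map :: "gam \<Rightarrow> 'k poly \<Rightarrow> 'k qgr \<Rightarrow> 'k qgr" where
  "D_map \<gamma> r = lmul (Areg \<alpha>) (Fract (hpoly \<alpha> \<gamma> * r) 1)"

lemma D_map_in: "q \<in> Areg \<alpha> \<Longrightarrow> D_map \<gamma> r q = qpoly (hpoly \<alpha> \<gamma> * r) * q"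
  and D_map_out: "q \<notin> Areg \<alpha> \<Longrightarrow> D_map \<gamma> r q = 0"
  by (simp_all add: D_map_def lmul_def)

lemma D_map_add: "D_map \<gamma> (r + s) q = D_map \<gamma> r q + D_map \<gamma> s q"
  by (cases "q \<in> Areg \<alpha>") (simp_all add: D_map_in D_map_out distrib_left flip: distrib_right qmon_add)

lemma D_map_zero [simp]: "D_map \<gamma> 0 q = 0"
  by (cases "q \<in> Areg \<alpha>") (simp_all add: D_map_in D_map_out)

lemma D_map_zero_fun [simp]: "D_map \<gamma> 0 = (\<lambda>_. 0)"
  by (rule ext) simp

lemma D_map_sum: "D_map \<gamma> (\<Sum>x\<in>X. g x) q = (\<Sum>x\<in>X. D_map \<gamma> (g x) q)"
  by (induction X rule: infinite_finite_induct) (simp_all add: D_map_add)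

lemma D_map_inject: "D_map \<gamma> r = D_map \<gamma> s \<longleftrightarrow> r = s"
proof
  assume "D_map \<gamma> r = D_map \<gamma> s"
  then have "D_map \<gamma> r 1 = D_map \<gamma> s 1" by simp
  then have "qpoly (hpoly \<alpha> \<gamma> * r) = qpoly (hpoly \<alpha> \<gamma> * s)" by (simp add: D_map_in one_Areg)
  then have "hpoly \<alpha> \<gamma> * r = hpoly \<alpha> \<gamma> * s" by (metis pcoeff_qmon)
  then show "r = s" using hpoly_nonzero[OF alpha_nonzero] by simp
qed simp

text \<open>A morphism out of \<open>A\<close> is left multiplication by the image of \<open>1\<close>, which lies in the degree zero part
  of \<open>\<iota>\<^sub>\<gamma> A\<close>.\<close>

lemma D_hom_eq: "D_hom \<alpha> \<gamma> = range (D_map \<gamma>)"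
proof
  let ?f = "fpoly \<alpha>"
  show "range (D_map \<gamma>) \<subseteq> D_hom \<alpha> \<gamma>"
  proof
    fix \<phi> assume "\<phi> \<in> range (D_map \<gamma>)"
    then obtain r where \<phi>: "\<phi> = D_map \<gamma> r" by auto
    show "\<phi> \<in> D_hom \<alpha> \<gamma>"
      unfolding D_hom_def gr_hom_def \<phi>
    proof (intro CollectI conjI ballI allI impI)
      fix q assume "q \<in> carrier (qgr_sub ?f (Areg \<alpha>))"
      then show "D_map \<gamma> r q \<in> carrier (qgr_sub ?f (iota \<alpha> \<gamma> (Areg \<alpha>)))"
        by (simp add: qgr_sub_def D_map_in hpoly_mult_Areg)
    next
      fix q assume "q \<notin> carrier (qgr_sub ?f (Areg \<alpha>))"
      then show "D_map \<gamma> r q = \<zero>\<^bsub>qgr_sub ?f (iota \<alpha> \<gamma> (Areg \<alpha>))\<^esub>"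
        by (simp add: qgr_sub_def D_map_out)
    next
      fix q q' assume "q \<in> carrier (qgr_sub ?f (Areg \<alpha>))" "q' \<in> carrier (qgr_sub ?f (Areg \<alpha>))"
      then have "q \<in> Areg \<alpha>" "q' \<in> Areg \<alpha>" "q + q' \<in> Areg \<alpha>"
        by (auto simp: qgr_sub_def Areg_eq alpha_nonzero rank_one_def graded_sub_add)
      then show "D_map \<gamma> r (q \<oplus>\<^bsub>qgr_sub ?f (Areg \<alpha>)\<^esub> q') =
          D_map \<gamma> r q \<oplus>\<^bsub>qgr_sub ?f (iota \<alpha> \<gamma> (Areg \<alpha>))\<^esub> D_map \<gamma> r q'"
        by (simp add: qgr_sub_def D_map_in distrib_left)
    next
      fix q a assume "q \<in> carrier (qgr_sub ?f (Areg \<alpha>))" "a \<in> carrier (gwa ?f)"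
      then obtain b c where b: "q = feval ?f b" "a = gwa_cls ?f c"
        by (auto simp: qgr_sub_def Areg_range gwa_carrier)
      then have "q \<in> Areg \<alpha>" "q * feval ?f c \<in> Areg \<alpha>"
        by (auto simp: Areg_range simp flip: feval_mult)
      then show "D_map \<gamma> r (ract (qgr_sub ?f (Areg \<alpha>)) q a) =
          ract (qgr_sub ?f (iota \<alpha> \<gamma> (Areg \<alpha>))) (D_map \<gamma> r q) a"
        by (simp add: b(2) qgr_sub_def gwa_emb_cls D_map_in mult.assoc)
    next
      fix i q assume "q \<in> component (qgr_sub ?f (Areg \<alpha>)) i"
      then show "D_map \<gamma> r q \<in> component (qgr_sub ?f (iota \<alpha> \<gamma> (Areg \<alpha>))) i"
        by (simp add: qgr_sub_def D_map_in hpoly_mult_Areg qmon_component_iff qcoeff_qrat_mult)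
    qed
  qed
  show "D_hom \<alpha> \<gamma> \<subseteq> range (D_map \<gamma>)"
  proof
    fix \<phi> assume "\<phi> \<in> D_hom \<alpha> \<gamma>"
    then have hom: "\<phi> \<in> gr_hom ?f (qgr_sub ?f (Areg \<alpha>)) (qgr_sub ?f (iota \<alpha> \<gamma> (Areg \<alpha>)))"
      by (simp add: D_hom_def)
    have "1 \<in> qgr_component 0" by (simp add: qgr_component_def qgr_one)
    then have "\<phi> 1 \<in> iota \<alpha> \<gamma> (Areg \<alpha>) \<inter> qgr_component 0"
      using hom one_Areg by (auto simp: gr_hom_def qgr_sub_def)
    then have mem: "\<phi> 1 \<in> rank_one (lin_prod (neg_jumps \<alpha> \<inter> gam_jumps \<alpha> \<gamma>)) (symm_diff (neg_jumps \<alpha>) (gam_jumps \<alpha> \<gamma>))"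
        "\<phi> 1 \<in> qgr_component 0"
      by (simp_all add: iota_Areg)
    have "\<phi> 1 \<in> skew_laurent" "hpoly \<alpha> \<gamma> dvd pcoeff (\<phi> 1) 0"
      using mem(1) unfolding degree_zero_part[of \<gamma>, symmetric] by (simp_all add: rank_one_def graded_sub_def)
    moreover have "\<phi> 1 = qrat (qcoeff (\<phi> 1) 0)"
      using mem(2) by (auto simp: qgr_component_def qcoeff_qmon)
    ultimately obtain r where r: "\<phi> 1 = qpoly (hpoly \<alpha> \<gamma> * r)"
      by (metis dvdE qcoeff_pcoeff)
    have "\<phi> q = D_map \<gamma> r q" for q
    proof (cases "q \<in> Areg \<alpha>")
      case True
      then obtain b where b: "q = feval ?f b" by (auto simp: Areg_range)
      have "\<phi> (1 * gwa_emb ?f (gwa_cls ?f b)) = \<phi> 1 * gwa_emb ?f (gwa_cls ?f b)"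
        using hom one_Areg by (auto simp: gr_hom_def qgr_sub_def gwa_carrier)
      then show ?thesis using True by (simp add: gwa_emb_cls b D_map_in r)
    next
      case False
      then show ?thesis using hom by (simp add: gr_hom_def qgr_sub_def D_map_out)
    qed
    then show "\<phi> \<in> range (D_map \<gamma>)" by blast
  qed
qed

lemma qrat_mult: "qrat g * qrat h = qrat (g * h)"
  by (simp add: qmon_mult)

lemma qpoly_qpoly_mult: "qpoly g * (qpoly h * q) = qpoly (g * h) * q"
  by (simp add: mult.assoc[symmetric] qrat_mult)

text \<open>The composite before \<open>\<Theta>\<close> is multiplication by \<open>h\<^sub>\<gamma> r h\<^sub>\<delta> s = h\<^sub>\<epsilon>\<^sup>2 h\<^bsub>\<gamma>+\<delta>\<^esub> r s\<close> with
  \<open>\<epsilon> = \<gamma> \<inter> \<delta>\<close>, and \<open>\<Theta>\<close> divides by \<open>h\<^sub>\<epsilon>\<close>. The maps are zero outside their sources, so each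
  intermediate value has to be located in the source of the next map.\<close>

lemma D_hom_mult_D_map:
  "D_hom_mult \<alpha> \<gamma> \<delta> (D_map \<gamma> r) (D_map \<delta> s) = D_map (\<gamma> + \<delta>) (hpoly \<alpha> (gam_inter \<gamma> \<delta>) * r * s)"
proof
  fix q
  define \<epsilon> where "\<epsilon> = gam_inter \<delta> \<gamma>"
  have \<epsilon>: "\<epsilon> = gam_inter \<gamma> \<delta>" by (simp add: \<epsilon>_def gam_inter_def zset_inject[symmetric] zint.rep_eq Int_commute)
  let ?h = "hpoly \<alpha>"
  have hh: "?h \<gamma> * ?h \<delta> = ?h \<epsilon> * (?h (\<gamma> + \<delta>) * ?h \<epsilon>)"
    using hpoly_mult[OF alpha_nonzero, of \<gamma> \<delta>] by (simp add: \<epsilon> power2_eq_square mult_ac)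
  have h\<epsilon>: "?h \<epsilon> \<noteq> 0" by (rule hpoly_nonzero[OF alpha_nonzero])
  show "D_hom_mult \<alpha> \<gamma> \<delta> (D_map \<gamma> r) (D_map \<delta> s) q = D_map (\<gamma> + \<delta>) (?h (gam_inter \<gamma> \<delta>) * r * s) q"
  proof (cases "q \<in> Areg \<alpha>")
    case True
    define q' where "q' = qpoly (?h (\<gamma> + \<delta>) * (?h \<epsilon> * r * s)) * q"
    have q': "q' \<in> iota \<alpha> (\<gamma> + \<delta>) (Areg \<alpha>)" "q' \<in> Areg \<alpha>"
      using True by (auto simp: q'_def hpoly_mult_Areg Areg_qpoly_mult)
    have "D_map \<delta> s q \<in> iota \<alpha> \<delta> (Areg \<alpha>)" "D_map \<delta> s q \<in> Areg \<alpha>"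
      using True by (simp_all add: D_map_in hpoly_mult_Areg Areg_qpoly_mult)
    then have "iota_mor \<alpha> \<delta> (Areg \<alpha>) (D_map \<gamma> r) (D_map \<delta> s q) = D_map \<gamma> r (D_map \<delta> s q)"
      by (simp add: iota_mor_def)
    also have "\<dots> = qpoly (?h \<epsilon>) * q'"
    proof -
      have "(?h \<gamma> * r) * (?h \<delta> * s) = ?h \<epsilon> * (?h (\<gamma> + \<delta>) * (?h \<epsilon> * r * s))"
      proof -
        have "(?h \<gamma> * r) * (?h \<delta> * s) = (?h \<gamma> * ?h \<delta>) * (r * s)" by (simp add: mult_ac)
        then show ?thesis unfolding hh by (simp only: mult_ac)
      qed
      then show ?thesis
        using True by (simp only: D_map_in Areg_qpoly_mult q'_def qpoly_qpoly_mult)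
    qed
    finally have step: "iota_mor \<alpha> \<delta> (Areg \<alpha>) (D_map \<gamma> r) (D_map \<delta> s q) = qpoly (?h \<epsilon>) * q'" .
    have "qpoly (?h \<epsilon>) * q' \<in> iota \<alpha> (\<gamma> + \<delta>) (iota \<alpha> \<epsilon> (iota \<alpha> \<epsilon> (Areg \<alpha>)))"
      using rank_one_qpoly_mult[OF q'(1)[unfolded iota_Areg], of "?h \<epsilon>"]
      by (simp only: iota_square_Areg iota_rank_one[OF nonint jump_set_neg_jumps h\<epsilon>])
    moreover have "qpoly (?h \<epsilon>) * q' \<in> iota \<alpha> \<epsilon> (iota \<alpha> \<epsilon> (Areg \<alpha>))"
      using rank_one_qpoly_mult[OF q'(2)[unfolded Areg_eq[OF alpha_nonzero]], of "?h \<epsilon>"]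
      by (simp add: iota_square_Areg)
    moreover have "qrat (inverse (Fract (?h \<epsilon>) 1)) * (qpoly (?h \<epsilon>) * q') = q'"
    proof -
      have "inverse (Fract (?h \<epsilon>) 1) * Fract (?h \<epsilon>) 1 = 1"
        using h\<epsilon> by (intro left_inverse) simp
      then show ?thesis by (simp only: mult.assoc[symmetric] qrat_mult qmon_one mult_1_left)
    qed
    ultimately have "Theta \<alpha> \<delta> \<gamma> (qpoly (?h \<epsilon>) * q') = q'"
      by (simp add: Theta_def Let_def \<epsilon>_def[symmetric] iota_mor_def sigma_mor_def lmul_def add.commute)
    then have "D_hom_mult \<alpha> \<gamma> \<delta> (D_map \<gamma> r) (D_map \<delta> s) q = q'"
      by (simp only: D_hom_mult_def comp_apply step)
    then show ?thesis using True by (simp only: q'_def D_map_in \<epsilon>)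
  next
    case False
    then show ?thesis
      by (simp add: D_hom_mult_def D_map_out iota_mor_def Theta_def Let_def sigma_mor_def lmul_def)
         (simp add: D_map_def lmul_def)
  qed
qed


section \<open>D as a twisted group ring\<close>

definition D_family :: "(gam \<Rightarrow>\<^sub>0 'k poly) \<Rightarrow> 'k dfam" where
  "D_family g = (\<lambda>\<gamma>. D_map \<gamma> (Poly_Mapping.lookup g \<gamma>))"

text \<open>The group ring of \<open>\<Gamma>\<close> over \<open>k[z]\<close> with the product twisted by \<open>(\<gamma>, \<delta>) \<mapsto> h\<^bsub>\<gamma>\<inter>\<delta>\<^esub>\<close>.\<close>

definition twist_times :: "(gam \<Rightarrow>\<^sub>0 'k poly) \<Rightarrow> (gam \<Rightarrow>\<^sub>0 'k poly) \<Rightarrow> (gam \<Rightarrow>\<^sub>0 'k poly)" where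
  "twist_times g h = (\<Sum>\<gamma>\<in>Poly_Mapping.keys g. \<Sum>\<delta>\<in>Poly_Mapping.keys h.
     Poly_Mapping.single (\<gamma> + \<delta>) (hpoly \<alpha> (gam_inter \<gamma> \<delta>) * Poly_Mapping.lookup g \<gamma> * Poly_Mapping.lookup h \<delta>))"

lemma D_family_inject: "D_family g = D_family h \<longleftrightarrow> g = h"
proof
  assume "D_family g = D_family h"
  then have "D_map \<gamma> (Poly_Mapping.lookup g \<gamma>) = D_map \<gamma> (Poly_Mapping.lookup h \<gamma>)" for \<gamma>
    unfolding D_family_def by (rule fun_cong)
  then show "g = h" by (intro poly_mapping_eqI) (simp add: D_map_inject)
qed simp

lemma D_map_eq_zero: "D_map \<gamma> r = (\<lambda>_. 0) \<longleftrightarrow> r = 0"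
  using D_map_inject[of \<gamma> r 0] by simp

lemma dsupp_D_family: "dsupp (D_family g) = Poly_Mapping.keys g"
  by (auto simp: dsupp_def D_family_def D_map_eq_zero in_keys_iff)

lemma D_carrier: "carrier (D_ring \<alpha>) = range D_family"
proof
  show "range D_family \<subseteq> carrier (D_ring \<alpha>)"
    by (auto simp: D_ring_def D_hom_eq dsupp_D_family) (simp add: D_family_def)
  show "carrier (D_ring \<alpha>) \<subseteq> range D_family"
  proof
    fix d assume "d \<in> carrier (D_ring \<alpha>)"
    then have d: "\<And>\<gamma>. d \<gamma> \<in> range (D_map \<gamma>)" "finite (dsupp d)"
      by (auto simp: D_ring_def D_hom_eq)
    then have "\<forall>\<gamma>. \<exists>r. d \<gamma> = D_map \<gamma> r" by blast
    from choice[OF this] obtain r where r: "\<And>\<gamma>. d \<gamma> = D_map \<gamma> (r \<gamma>)" by blast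
    then have "finite {\<gamma>. r \<gamma> \<noteq> 0}" using d(2) by (simp add: dsupp_def D_map_eq_zero)
    then have "D_family (Abs_poly_mapping r) = d" by (auto simp: D_family_def r)
    then show "d \<in> range D_family" by blast
  qed
qed

lemma D_family_add: "D_family (g + h) = D_family g \<oplus>\<^bsub>D_ring \<alpha>\<^esub> D_family h"
  by (intro ext) (simp add: D_family_def D_ring_def lookup_add D_map_add)

lemma D_family_zero: "D_family 0 = \<zero>\<^bsub>D_ring \<alpha>\<^esub>"
  by (simp add: D_family_def D_ring_def)

lemma D_family_single: "D_family (Poly_Mapping.single \<gamma> r) = dhomog \<gamma> (D_map \<gamma> r)"
  by (auto simp: D_family_def dhomog_def lookup_single when_def)

lemma D_family_one: "D_family 1 = \<one>\<^bsub>D_ring \<alpha>\<^esub>"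
  unfolding single_one[symmetric]
  by (simp add: D_family_single D_ring_def D_map_def One_fract_def del: single_one)

lemma D_family_mult: "D_family (twist_times g h) = D_family g \<otimes>\<^bsub>D_ring \<alpha>\<^esub> D_family h"
proof (intro ext)
  fix \<epsilon> q
  let ?K = "Poly_Mapping.keys g \<times> Poly_Mapping.keys h"
  let ?t = "\<lambda>\<gamma> \<delta>. hpoly \<alpha> (gam_inter \<gamma> \<delta>) * Poly_Mapping.lookup g \<gamma> * Poly_Mapping.lookup h \<delta>"
  have "(D_family g \<otimes>\<^bsub>D_ring \<alpha>\<^esub> D_family h) \<epsilon> q =
      (\<Sum>(\<gamma>, \<delta>)\<in>{(\<gamma>, \<delta>) \<in> ?K. \<gamma> + \<delta> = \<epsilon>}. D_map (\<gamma> + \<delta>) (?t \<gamma> \<delta>) q)"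
    by (simp add: D_ring_def dsupp_D_family) (simp add: D_family_def D_hom_mult_D_map)
  also have "\<dots> = (\<Sum>x\<in>{x \<in> ?K. fst x + snd x = \<epsilon>}. D_map \<epsilon> (?t (fst x) (snd x)) q)"
    by (rule sum.cong) auto
  also have "\<dots> = D_map \<epsilon> (\<Sum>x\<in>{x \<in> ?K. fst x + snd x = \<epsilon>}. ?t (fst x) (snd x)) q"
    by (simp add: D_map_sum)
  also have "(\<Sum>x\<in>{x \<in> ?K. fst x + snd x = \<epsilon>}. ?t (fst x) (snd x)) =
      (\<Sum>x\<in>?K. if fst x + snd x = \<epsilon> then ?t (fst x) (snd x) else 0)"
    by (rule sum.inter_filter) simp
  also have "\<dots> = (\<Sum>\<gamma>\<in>Poly_Mapping.keys g. \<Sum>\<delta>\<in>Poly_Mapping.keys h. if \<gamma> + \<delta> = \<epsilon> then ?t \<gamma> \<delta> else 0)"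
    by (simp add: sum.cartesian_product case_prod_beta)
  also have "\<dots> = Poly_Mapping.lookup (twist_times g h) \<epsilon>"
    by (simp add: twist_times_def lookup_sum lookup_single when_def)
  finally show "D_family (twist_times g h) \<epsilon> q = (D_family g \<otimes>\<^bsub>D_ring \<alpha>\<^esub> D_family h) \<epsilon> q"
    by (simp add: D_family_def)
qed

lemma D_family_scale: "D_family (Poly_Mapping.map ((*) [:c:]) g) = D_scale c (D_family g)"
proof -
  have "D_map \<gamma> ([:c:] * r) q = qpoly [:c:] * D_map \<gamma> r q" for \<gamma> r q
  proof (cases "q \<in> Areg \<alpha>")
    case True
    then show ?thesis by (simp only: D_map_in qpoly_qpoly_mult mult.left_commute)
  qed (simp add: D_map_out)
  moreover have "Poly_Mapping.lookup (Poly_Mapping.map ((*) [:c:]) g) \<gamma> = [:c:] * Poly_Mapping.lookup g \<gamma>" for \<gamma>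
    by (simp add: Poly_Mapping.map.rep_eq when_def)
  ultimately show ?thesis by (intro ext) (simp only: D_family_def D_scale_def)
qed

lemma twist_times_add_left: "twist_times (g + g') h = twist_times g h + twist_times g' h"
  unfolding twist_times_def
  by (rule setsum_keys_plus_distrib)
     (simp_all add: distrib_left distrib_right single_add sum.distrib)

lemma twist_times_add_right: "twist_times g (h + h') = twist_times g h + twist_times g h'"
proof -
  have "(\<Sum>\<delta>\<in>Poly_Mapping.keys (h + h').
     Poly_Mapping.single (\<gamma> + \<delta>) (hpoly \<alpha> (gam_inter \<gamma> \<delta>) * Poly_Mapping.lookup g \<gamma> * Poly_Mapping.lookup (h + h') \<delta>)) =
    (\<Sum>\<delta>\<in>Poly_Mapping.keys h.
     Poly_Mapping.single (\<gamma> + \<delta>) (hpoly \<alpha> (gam_inter \<gamma> \<delta>) * Poly_Mapping.lookup g \<gamma> * Poly_Mapping.lookup h \<delta>)) +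
    (\<Sum>\<delta>\<in>Poly_Mapping.keys h'.
     Poly_Mapping.single (\<gamma> + \<delta>) (hpoly \<alpha> (gam_inter \<gamma> \<delta>) * Poly_Mapping.lookup g \<gamma> * Poly_Mapping.lookup h' \<delta>))" for \<gamma>
    by (rule setsum_keys_plus_distrib) (simp_all add: distrib_left single_add)
  then show ?thesis by (simp add: twist_times_def sum.distrib)
qed

lemma twist_times_single:
  "twist_times (Poly_Mapping.single \<gamma> r) (Poly_Mapping.single \<delta> s) =
   Poly_Mapping.single (\<gamma> + \<delta>) (hpoly \<alpha> (gam_inter \<gamma> \<delta>) * r * s)"
  unfolding twist_times_def by (cases "r = 0"; cases "s = 0") simp_all

end

section \<open>Coordinates of polynomials in the generators\<close>


lemma pres_ideal_ideal: "ideal (pres_ideal \<alpha>) class_ring"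
  unfolding pres_ideal_def by (rule class_ring_genideal)

lemmas pres_ideal_zero = class_ring_ideal_zero[OF pres_ideal_ideal]
  and pres_ideal_add = class_ring_ideal_add[OF pres_ideal_ideal]
  and pres_ideal_mult = class_ring_ideal_mult_left[OF pres_ideal_ideal]

lemma pres_ideal_uminus: "a \<in> pres_ideal \<alpha> \<Longrightarrow> - a \<in> pres_ideal \<alpha>"
  using pres_ideal_mult[of a \<alpha> "- 1"] by simp

lemma pres_ideal_rel: "r \<in> pres_rels \<alpha> \<Longrightarrow> r \<in> pres_ideal \<alpha>"
  unfolding pres_ideal_def by (rule class_ring_genideal_self)

lemma mconst_zero [simp]: "mconst 0 = 0" and mconst_one: "mconst 1 = 1"
  and mconst_add: "mconst (x + y) = mconst x + mconst y"
  and mconst_mult: "mconst (x * y) = mconst x * mconst y"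
  by (simp_all add: mconst_def single_add mult_single)

lemma mconst_of_int: "mconst (of_int n) = of_int n"
  by (simp add: mconst_def)

text \<open>Substitution of \<open>c\<^sub>0\<^sup>2\<close>, which is the element \<open>z\<close> of the presented algebra.\<close>

definition poly_in_z :: "'k::field poly \<Rightarrow> 'k mpoly" where
  "poly_in_z g = poly (map_poly mconst g) ((mvar (C 0))\<^sup>2)"

lemma poly_in_z_zero [simp]: "poly_in_z 0 = 0"
  by (simp add: poly_in_z_def)

lemma poly_in_z_pCons: "poly_in_z (pCons a g) = mconst a + (mvar (C 0))\<^sup>2 * poly_in_z g"
  by (simp add: poly_in_z_def map_poly_pCons)

lemma poly_in_z_add: "poly_in_z (g + h) = poly_in_z g + poly_in_z h"
  by (induction g h rule: poly_induct2) (simp_all add: poly_in_z_pCons mconst_add algebra_simps)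

lemma poly_in_z_smult: "poly_in_z (smult a g) = mconst a * poly_in_z g"
  by (induction g) (simp_all add: poly_in_z_pCons mconst_mult algebra_simps)

lemma poly_in_z_mult: "poly_in_z (g * h) = poly_in_z g * poly_in_z h"
  by (induction g) (simp_all add: poly_in_z_pCons poly_in_z_add poly_in_z_smult algebra_simps)

lemma poly_in_z_one [simp]: "poly_in_z 1 = 1"
  using poly_in_z_pCons[of 1 0] by (simp add: mconst_one one_pCons)

lemma monomial_induct [case_names zero step]:
  fixes m :: "'v \<Rightarrow>\<^sub>0 nat"
  assumes 0: "P 0" and step: "\<And>m v. P m \<Longrightarrow> P (m + Poly_Mapping.single v 1)"
  shows "P m"
proof -
  have "\<forall>m'. P m' \<longrightarrow> P (m' + m)"
  proof (induction m rule: poly_mapping_additive_induct)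
    case (single v k)
    show ?case
    proof (induction k)
      case (Suc k)
      have "Poly_Mapping.single v (Suc k) = Poly_Mapping.single v k + Poly_Mapping.single v 1"
        by (simp flip: single_add)
      then show ?case using Suc step by (simp add: add.assoc[symmetric])
    qed simp
  next
    case (add a b)
    then show ?case by (simp add: add.assoc[symmetric])
  qed
  from this[rule_format, OF 0] show ?thesis by simp
qed

context nonintegral
begin

fun var_jump :: "var \<Rightarrow> int \<times> 'k" where
  "var_jump (C n) = (n, 0)" | "var_jump (D n) = (n, \<alpha>)"

lemma var_jump_inject: "var_jump v = var_jump v' \<longleftrightarrow> v = v'"
  using alpha_nonzero by (cases v; cases v') auto

lemma gam_jumps_var_deg: "gam_jumps \<alpha> (var_deg v) = {var_jump v}"
  by (cases v) (auto simp: gam_jumps_def zsing.rep_eq zero_zfin.rep_eq)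

lemma monom_deg_add: "monom_deg (m + m') = monom_deg m + monom_deg m'"
  unfolding monom_deg_def
proof (rule setsum_keys_plus_distrib)
  fix a b :: nat and v
  show "(\<Sum>i<a + b. var_deg v) = (\<Sum>i<a. var_deg v) + (\<Sum>i<b. var_deg v)"
    by (induction b) (simp_all add: add.assoc)
qed simp

lemma monom_deg_single: "monom_deg (Poly_Mapping.single v 1) = var_deg v"
  by (simp add: monom_deg_def)

lemma monom_deg_zero [simp]: "monom_deg 0 = 0"
  by (simp add: monom_deg_def)

lemma gam_jumps_monom_deg: "gam_jumps \<alpha> (monom_deg m) = var_jump ` {v. odd (Poly_Mapping.lookup m v)}"
proof (induction m rule: monomial_induct)
  case zero
  then show ?case by simp
next
  case (step m v)
  have "{w. odd (Poly_Mapping.lookup (m + Poly_Mapping.single v 1) w)} =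
      symm_diff {w. odd (Poly_Mapping.lookup m w)} {v}"
    by (auto simp: symm_diff_def lookup_add lookup_single when_def)
  moreover have "var_jump ` symm_diff A {v} = symm_diff (var_jump ` A) {var_jump v}" for A
    by (auto simp: symm_diff_def var_jump_inject)
  ultimately show ?case
    by (simp only: monom_deg_add monom_deg_single gam_jumps_plus[OF alpha_nonzero] gam_jumps_var_deg step)
qed

text \<open>The polynomial in \<open>z\<close> that splits off a monomial when \<open>c\<^sub>n\<^sup>2\<close> is replaced by \<open>z + n\<close> and
  \<open>d\<^sub>n\<^sup>2\<close> by \<open>z + n + \<alpha>\<close> as often as possible.\<close>

definition weight :: "(var \<Rightarrow>\<^sub>0 nat) \<Rightarrow> 'k poly" where
  "weight m = (\<Prod>v\<in>Poly_Mapping.keys m. lin (var_jump v) ^ (Poly_Mapping.lookup m v div 2))"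

lemma weight_superset:
  assumes "finite V" "Poly_Mapping.keys m \<subseteq> V"
  shows "weight m = (\<Prod>v\<in>V. lin (var_jump v) ^ (Poly_Mapping.lookup m v div 2))"
  unfolding weight_def using assms by (intro prod.mono_neutral_left) (auto simp: in_keys_iff)

text \<open>\<open>\<lfloor>(a + b)/2\<rfloor>\<close> exceeds \<open>\<lfloor>a/2\<rfloor> + \<lfloor>b/2\<rfloor>\<close> by one exactly if \<open>a\<close> and \<open>b\<close> are odd, that is, if the
  variable occurs in both degrees.\<close>

lemma weight_add:
  "weight (m + m') = hpoly \<alpha> (gam_inter (monom_deg m) (monom_deg m')) * weight m * weight m'"
proof -
  let ?V = "Poly_Mapping.keys m \<union> Poly_Mapping.keys m'"
  let ?l = "Poly_Mapping.lookup m" and ?l' = "Poly_Mapping.lookup m'"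
  let ?B = "{v. odd (?l v) \<and> odd (?l' v)}"
  have "weight (m + m') = (\<Prod>v\<in>?V. lin (var_jump v) ^ ((?l v + ?l' v) div 2))"
    by (subst weight_superset[of ?V]) (simp_all add: keys_add lookup_add)
  also have "\<dots> = (\<Prod>v\<in>?V. lin (var_jump v) ^ (?l v div 2) * lin (var_jump v) ^ (?l' v div 2) *
      (if v \<in> ?B then lin (var_jump v) else 1))"
  proof (rule prod.cong)
    fix v
    have "(?l v + ?l' v) div 2 = ?l v div 2 + ?l' v div 2 + (if v \<in> ?B then 1 else 0)"
      by (auto elim!: evenE oddE)
    then show "lin (var_jump v) ^ ((?l v + ?l' v) div 2) = lin (var_jump v) ^ (?l v div 2) * lin (var_jump v) ^ (?l' v div 2) *
      (if v \<in> ?B then lin (var_jump v) else 1)"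
      by (simp add: power_add)
  qed simp
  also have "\<dots> = weight m * weight m' * (\<Prod>v\<in>?V. if v \<in> ?B then lin (var_jump v) else 1)"
    by (simp add: prod.distrib weight_superset[of ?V])
  also have "(\<Prod>v\<in>?V. if v \<in> ?B then lin (var_jump v) else 1) = (\<Prod>v\<in>?B. lin (var_jump v))"
  proof -
    have "?B \<subseteq> ?V" by (auto simp: in_keys_iff)
    then show ?thesis by (subst prod.inter_restrict[symmetric]) (simp_all add: Int_absorb1)
  qed
  also have "(\<Prod>v\<in>?B. lin (var_jump v)) = lin_prod (var_jump ` ?B)"
    unfolding lin_prod_def by (subst prod.reindex) (auto simp: inj_on_def var_jump_inject)
  also have "var_jump ` ?B = gam_jumps \<alpha> (gam_inter (monom_deg m) (monom_deg m'))"
    by (auto simp: gam_jumps_inter alpha_nonzero gam_jumps_monom_deg var_jump_inject)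
  finally show ?thesis by (simp add: hpoly_lin_prod alpha_nonzero mult_ac)
qed

lemma weight_zero [simp]: "weight 0 = 1" and weight_var: "weight (Poly_Mapping.single v 1) = 1"
  by (simp_all add: weight_def)

text \<open>The coordinates of a polynomial with respect to the squarefree monomials, in the twisted group ring.\<close>

definition coords :: "'k mpoly \<Rightarrow> gam \<Rightarrow>\<^sub>0 'k poly" where
  "coords p = (\<Sum>m\<in>Poly_Mapping.keys p.
     Poly_Mapping.single (monom_deg m) (smult (Poly_Mapping.lookup p m) (weight m)))"

lemma coords_add: "coords (p + q) = coords p + coords q"
  unfolding coords_def by (rule setsum_keys_plus_distrib) (simp_all add: smult_add_left single_add)

lemma coords_single: "coords (Poly_Mapping.single m x) = Poly_Mapping.single (monom_deg m) (smult x (weight m))"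
  by (simp add: coords_def)

lemma coords_zero [simp]: "coords 0 = 0"
  by (simp add: coords_def)

lemma coords_one: "coords 1 = 1"
  using coords_single[of 0 1] by (simp flip: one_pCons)

lemma coords_uminus: "coords (- p) = - coords p"
  using coords_add[of p "- p"] by (simp add: eq_neg_iff_add_eq_0 add.commute)

lemma coords_diff: "coords (p - q) = coords p - coords q"
  using coords_add[of p "- q"] by (simp add: coords_uminus)

lemma coords_mult: "coords (p * q) = twist_times (coords p) (coords q)"
proof (induction p rule: poly_mapping_additive_induct)
  case (single m x)
  show ?case
  proof (induction q rule: poly_mapping_additive_induct)
    case (single m' x')
    show ?case
      unfolding mult_single coords_single twist_times_single monom_deg_add weight_add
      by (simp add: mult_ac)
  qed (simp add: distrib_left coords_add twist_times_add_right)
qed (simp add: distrib_right coords_add twist_times_add_left)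

lemma coords_mvar: "coords (mvar v) = Poly_Mapping.single (var_deg v) 1"
  by (simp add: mvar_def coords_single monom_deg_single weight_var del: One_nat_def flip: one_pCons)

lemma var_deg_double: "var_deg v + var_deg v = 0"
  by (rule gam_jumps_inject[OF alpha_nonzero]) (simp add: gam_jumps_plus alpha_nonzero symm_diff_def)

lemma coords_mvar_square: "coords ((mvar v)\<^sup>2) = Poly_Mapping.single 0 (lin (var_jump v))"
proof -
  have "hpoly \<alpha> (gam_inter (var_deg v) (var_deg v)) = lin (var_jump v)"
    by (simp add: hpoly_lin_prod gam_jumps_inter alpha_nonzero gam_jumps_var_deg lin_prod_def)
  then show ?thesis
    by (simp add: power2_eq_square coords_mult coords_mvar twist_times_single var_deg_double)
qed

lemma coords_mconst: "coords (mconst x) = Poly_Mapping.single 0 [:x:]"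
  by (simp add: mconst_def coords_single)

lemma coords_mconst_mult: "coords (mconst x * p) = Poly_Mapping.map ((*) [:x:]) (coords p)"
proof (induction p rule: poly_mapping_additive_induct)
  case (single m y)
  show ?case
    by (rule poly_mapping_eqI)
       (simp add: mconst_def mult_single coords_single Poly_Mapping.map.rep_eq lookup_single when_def)
next
  case (add p q)
  have "Poly_Mapping.lookup (Poly_Mapping.map ((*) [:x:]) g) \<gamma> = [:x:] * Poly_Mapping.lookup g \<gamma>"
    for g :: "gam \<Rightarrow>\<^sub>0 'k poly" and \<gamma>
    by (simp add: Poly_Mapping.map.rep_eq when_def)
  then have map_add: "Poly_Mapping.map ((*) [:x:]) (g + h) =
      Poly_Mapping.map ((*) [:x:]) g + Poly_Mapping.map ((*) [:x:]) h" for g h :: "gam \<Rightarrow>\<^sub>0 'k poly"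
    by (intro poly_mapping_eqI) (simp only: lookup_add distrib_left)
  show ?case by (simp only: distrib_left coords_add map_add add)
qed

lemma coords_rels: "r \<in> pres_rels \<alpha> \<Longrightarrow> coords r = 0"
proof -
  have c: "coords (of_int n) = Poly_Mapping.single 0 [:of_int n:]" for n
    using coords_mconst[of "of_int n"] by (simp add: mconst_of_int)
  have l: "lin (n, 0) - [:of_int n:] = [:0, 1:]" "lin (n, \<alpha>) - [:\<alpha>:] = lin (n, 0)" for n
    by (simp_all add: lin_def)
  have "coords ((mvar (C n))\<^sup>2 - of_int n) = Poly_Mapping.single 0 [:0, 1:]"
    "coords ((mvar (D n))\<^sup>2 - mconst \<alpha>) = coords ((mvar (C n))\<^sup>2)" for n
    by (simp_all only: coords_diff coords_mvar_square c coords_mconst var_jump.simps l flip: single_diff)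
  then show "r \<in> pres_rels \<alpha> \<Longrightarrow> coords r = 0"
    unfolding pres_rels_def by (auto simp: coords_diff[of "_ - _"] coords_diff[of "_ ^ 2" "_ - _"])
qed

text \<open>The kernel of a homomorphism into the twisted group ring is an ideal, and it contains the relations.\<close>

lemma coords_ideal:
  assumes "p \<in> pres_ideal \<alpha>" shows "coords p = 0"
proof -
  interpret ring "class_ring :: 'k mpoly ring" by (rule ring_class_ring)
  have minv: "\<ominus>\<^bsub>class_ring\<^esub> a = - a" for a :: "'k mpoly"
    using minus_equality[of "- a" a] by simp
  have tw0: "twist_times 0 g = 0" "twist_times g 0 = 0" for g
    by (simp_all add: twist_times_def)
  have "ideal {p. coords p = 0} (class_ring :: 'k mpoly ring)"
  proof (rule idealI)
    show "subgroup {p. coords p = 0} (add_monoid (class_ring :: 'k mpoly ring))"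
      by (rule add.subgroupI)
         (auto simp: coords_add coords_uminus minv simp flip: a_inv_def intro: exI[of _ 0])
  qed (auto simp: coords_mult tw0 ring_class_ring)
  moreover have "pres_rels \<alpha> \<subseteq> {p. coords p = 0}"
    using coords_rels by auto
  ultimately show ?thesis
    using assms unfolding pres_ideal_def by (auto dest: genideal_minimal)
qed


section \<open>Normal forms modulo the relations\<close>

text \<open>The monomial \<open>c\<^sub>\<gamma>\<close> with one factor \<open>c\<^sub>n\<close> or \<open>d\<^sub>n\<close> for each element of \<open>\<gamma>\<close>.\<close>

definition sqfree_monom :: "gam \<Rightarrow> var \<Rightarrow>\<^sub>0 nat" where
  "sqfree_monom \<gamma> = Abs_poly_mapping (\<lambda>v. if var_jump v \<in> gam_jumps \<alpha> \<gamma> then 1 else 0)"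

lemma lookup_sqfree_monom:
  "Poly_Mapping.lookup (sqfree_monom \<gamma>) v = (if var_jump v \<in> gam_jumps \<alpha> \<gamma> then 1 else 0)"
proof -
  have "finite {v. var_jump v \<in> gam_jumps \<alpha> \<gamma>}"
    using finite_vimageI[OF finite_gam_jumps, of var_jump \<alpha> \<gamma>] by (simp add: inj_def var_jump_inject vimage_def)
  then show ?thesis by (simp add: sqfree_monom_def)
qed

definition basis_elem :: "gam \<Rightarrow> 'k mpoly" where
  "basis_elem \<gamma> = Poly_Mapping.single (sqfree_monom \<gamma>) 1"

lemma monom_deg_sqfree: "monom_deg (sqfree_monom \<gamma>) = \<gamma>"
proof (rule gam_jumps_inject[OF alpha_nonzero])
  have "gam_jumps \<alpha> \<gamma> \<subseteq> range var_jump"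
  proof
    fix t assume "t \<in> gam_jumps \<alpha> \<gamma>"
    then obtain n where "t = var_jump (C n) \<or> t = var_jump (D n)" by (auto simp: gam_jumps_def)
    then show "t \<in> range var_jump" by blast
  qed
  then show "gam_jumps \<alpha> (monom_deg (sqfree_monom \<gamma>)) = gam_jumps \<alpha> \<gamma>"
    by (auto simp: gam_jumps_monom_deg lookup_sqfree_monom)
qed

lemma mvar_square_cong: "(mvar v)\<^sup>2 - poly_in_z (lin (var_jump v)) \<in> pres_ideal \<alpha>"
proof -
  have C: "(mvar (C n))\<^sup>2 - poly_in_z (lin (n, 0)) \<in> pres_ideal \<alpha>" for n
  proof -
    have "((mvar (C n))\<^sup>2 - of_int n) - ((mvar (C 0))\<^sup>2 - of_int 0) \<in> pres_ideal \<alpha>"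
      by (rule pres_ideal_rel, unfold pres_rels_def, rule UnI1, rule CollectI,
          rule exI[of _ 0], rule exI[of _ n]) simp
    moreover have "poly_in_z (lin (n, 0 :: 'k)) = of_int n + (mvar (C 0))\<^sup>2"
      by (simp add: lin_def poly_in_z_pCons mconst_of_int mconst_one)
    ultimately show ?thesis by (simp add: algebra_simps)
  qed
  show ?thesis
  proof (cases v)
    case (C n)
    then show ?thesis using \<open>\<And>n. (mvar (C n))\<^sup>2 - poly_in_z (lin (n, 0)) \<in> pres_ideal \<alpha>\<close> by simp
  next
    case (D n)
    have "(mvar (C n))\<^sup>2 - ((mvar (D n))\<^sup>2 - mconst \<alpha>) \<in> pres_ideal \<alpha>"
      by (rule pres_ideal_rel) (auto simp: pres_rels_def)
    from pres_ideal_add[OF pres_ideal_uminus[OF this] C[of n]]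
    have "(mvar (D n))\<^sup>2 - (mconst \<alpha> + poly_in_z (lin (n, 0))) \<in> pres_ideal \<alpha>"
      by (simp add: algebra_simps)
    moreover have "poly_in_z (lin (n, \<alpha>)) = mconst \<alpha> + poly_in_z (lin (n, 0))"
      by (simp add: lin_def poly_in_z_pCons mconst_add algebra_simps)
    ultimately show ?thesis using D by simp
  qed
qed

text \<open>A variable not in \<open>\<gamma>\<close> is simply appended; a variable in \<open>\<gamma>\<close> becomes a square, which the
  relations turn into a linear polynomial in \<open>z\<close>.\<close>

lemma basis_elem_mvar:
  "basis_elem \<gamma> * mvar v - poly_in_z (hpoly \<alpha> (gam_inter \<gamma> (var_deg v))) * basis_elem (\<gamma> + var_deg v) \<in> pres_ideal \<alpha>"
proof (cases "var_jump v \<in> gam_jumps \<alpha> \<gamma>")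
  case False
  have "sqfree_monom (\<gamma> + var_deg v) = sqfree_monom \<gamma> + Poly_Mapping.single v 1"
    by (rule poly_mapping_eqI)
       (use False in \<open>auto simp: lookup_add lookup_sqfree_monom lookup_single when_def gam_jumps_plus alpha_nonzero gam_jumps_var_deg symm_diff_def var_jump_inject\<close>)
  moreover have "hpoly \<alpha> (gam_inter \<gamma> (var_deg v)) = 1"
    using False by (simp add: hpoly_lin_prod gam_jumps_inter alpha_nonzero gam_jumps_var_deg lin_prod_def)
  ultimately show ?thesis
    by (simp add: basis_elem_def mvar_def mult_single pres_ideal_zero)
next
  case True
  have "sqfree_monom \<gamma> = sqfree_monom (\<gamma> + var_deg v) + Poly_Mapping.single v 1"
    by (rule poly_mapping_eqI)
       (use True in \<open>auto simp: lookup_add lookup_sqfree_monom lookup_single when_def gam_jumps_plus alpha_nonzero gam_jumps_var_deg symm_diff_def var_jump_inject\<close>)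
  then have "basis_elem \<gamma> * mvar v = basis_elem (\<gamma> + var_deg v) * (mvar v)\<^sup>2"
    by (simp add: basis_elem_def mvar_def mult_single power2_eq_square add.assoc)
  moreover have "hpoly \<alpha> (gam_inter \<gamma> (var_deg v)) = lin (var_jump v)"
    using True by (simp add: hpoly_lin_prod gam_jumps_inter alpha_nonzero gam_jumps_var_deg lin_prod_def)
  ultimately show ?thesis
    using pres_ideal_mult[OF mvar_square_cong[of v], of "basis_elem (\<gamma> + var_deg v)"]
    by (simp add: right_diff_distrib mult.commute)
qed

definition normal_form :: "(gam \<Rightarrow>\<^sub>0 'k poly) \<Rightarrow> 'k mpoly" where
  "normal_form g = (\<Sum>\<gamma>\<in>Poly_Mapping.keys g. poly_in_z (Poly_Mapping.lookup g \<gamma>) * basis_elem \<gamma>)"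

lemma normal_form_add: "normal_form (g + h) = normal_form g + normal_form h"
  unfolding normal_form_def by (rule setsum_keys_plus_distrib) (simp_all add: poly_in_z_add distrib_right)

lemma normal_form_single: "normal_form (Poly_Mapping.single \<gamma> r) = poly_in_z r * basis_elem \<gamma>"
  by (simp add: normal_form_def)

lemma monomial_cong: "Poly_Mapping.single m 1 - poly_in_z (weight m) * basis_elem (monom_deg m) \<in> pres_ideal \<alpha>"
proof (induction m rule: monomial_induct)
  case zero
  have "sqfree_monom 0 = 0" by (rule poly_mapping_eqI) (simp add: lookup_sqfree_monom)
  then show ?case by (simp add: basis_elem_def pres_ideal_zero)
next
  case (step m v)
  let ?d = "monom_deg m" and ?h = "hpoly \<alpha> (gam_inter (monom_deg m) (var_deg v))"
  have "mvar v * (Poly_Mapping.single m 1 - poly_in_z (weight m) * basis_elem ?d) \<in> pres_ideal \<alpha>"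
    by (rule pres_ideal_mult[OF step])
  moreover have "poly_in_z (weight m) * (basis_elem ?d * mvar v - poly_in_z ?h * basis_elem (?d + var_deg v)) \<in> pres_ideal \<alpha>"
    by (rule pres_ideal_mult[OF basis_elem_mvar])
  ultimately have "mvar v * (Poly_Mapping.single m 1 - poly_in_z (weight m) * basis_elem ?d) +
      poly_in_z (weight m) * (basis_elem ?d * mvar v - poly_in_z ?h * basis_elem (?d + var_deg v)) \<in> pres_ideal \<alpha>"
    by (rule pres_ideal_add)
  also have "mvar v * (Poly_Mapping.single m 1 - poly_in_z (weight m) * basis_elem ?d) +
      poly_in_z (weight m) * (basis_elem ?d * mvar v - poly_in_z ?h * basis_elem (?d + var_deg v)) =
      Poly_Mapping.single m 1 * mvar v - poly_in_z ?h * poly_in_z (weight m) * basis_elem (?d + var_deg v)"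
    by (simp add: algebra_simps)
  also have "Poly_Mapping.single m 1 * mvar v = Poly_Mapping.single (m + Poly_Mapping.single v 1) (1 :: 'k)"
    by (simp add: mvar_def mult_single)
  finally show ?case
    by (simp add: weight_add monom_deg_add monom_deg_single weight_var poly_in_z_mult del: One_nat_def)
qed

text \<open>So an element with zero coordinates lies in the ideal: this is the half of the presentation saying
  that no relations are missing.\<close>

lemma normal_form_cong: "p - normal_form (coords p) \<in> pres_ideal \<alpha>"
proof (induction p rule: poly_mapping_additive_induct)
  case (single m x)
  have "mconst x * (Poly_Mapping.single m 1 - poly_in_z (weight m) * basis_elem (monom_deg m)) \<in> pres_ideal \<alpha>"
    by (rule pres_ideal_mult[OF monomial_cong])
  moreover have "mconst x * Poly_Mapping.single m 1 = Poly_Mapping.single m x"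
    by (simp add: mconst_def mult_single)
  ultimately show ?case
    by (simp add: coords_single normal_form_single poly_in_z_smult right_diff_distrib mult.assoc)
next
  case (add p q)
  then show ?case
    using pres_ideal_add[OF add] by (simp add: coords_add normal_form_add algebra_simps)
qed

lemma coords_eq_zero_iff: "coords p = 0 \<longleftrightarrow> p \<in> pres_ideal \<alpha>"
  using normal_form_cong[of p] coords_ideal[of p] by (auto simp: normal_form_def)

lemma coords_poly_in_z: "coords (poly_in_z g) = Poly_Mapping.single 0 g"
proof (induction g)
  case (pCons a g)
  have "gam_inter 0 0 = 0" by (rule gam_jumps_inject[OF alpha_nonzero]) (simp add: gam_jumps_inter alpha_nonzero)
  then have "coords (poly_in_z (pCons a g)) = Poly_Mapping.single 0 [:a:] + Poly_Mapping.single 0 (lin (0, 0) * g)"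
    by (simp add: poly_in_z_pCons coords_add coords_mult coords_mvar_square pCons coords_mconst twist_times_single)
  also have "\<dots> = Poly_Mapping.single 0 (pCons a g)"
    by (simp add: lin_def flip: single_add)
  finally show ?case .
qed simp

lemma coords_normal_form_single: "coords (poly_in_z r * basis_elem \<gamma>) = Poly_Mapping.single \<gamma> r"
proof -
  have "weight (sqfree_monom \<gamma>) = 1"
    unfolding weight_def by (rule prod.neutral) (auto simp: lookup_sqfree_monom)
  moreover have "gam_inter 0 \<gamma> = 0" by (rule gam_jumps_inject[OF alpha_nonzero]) (simp add: gam_jumps_inter alpha_nonzero)
  ultimately show ?thesis
    by (simp add: coords_mult coords_poly_in_z basis_elem_def coords_single monom_deg_sqfree twist_times_single)
qed

text \<open>The elements \<open>g(z) c\<^sub>\<gamma>\<close> of the presented algebra already have all possible coordinates.\<close>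

lemma range_coords: "range coords = UNIV"
proof (intro subset_antisym subsetI)
  fix g :: "gam \<Rightarrow>\<^sub>0 'k poly"
  show "g \<in> range coords"
  proof (induction g rule: poly_mapping_additive_induct)
    case (single \<gamma> r)
    show ?case
      by (rule range_eqI[of _ _ "poly_in_z r * basis_elem \<gamma>"]) (simp add: coords_normal_form_single)
  next
    case (add g h)
    then obtain p q where "g = coords p" "h = coords q" by blast
    then have "g + h = coords (p + q)" by (simp add: coords_add)
    then show ?case by blast
  qed
qed simp


section \<open>The isomorphism\<close>

lemma ring_hom_D_family_coords: "(\<lambda>p. D_family (coords p)) \<in> ring_hom class_ring (D_ring \<alpha>)"
  by (rule ring_hom_memI)
     (auto simp: D_carrier coords_mult D_family_mult coords_add D_family_add coords_one D_family_one)

text \<open>The product of \<open>D\<close> is defined by a formula only; its ring axioms are inherited from the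
  polynomial ring through the surjection.\<close>

lemma ring_D: "ring (D_ring \<alpha>)"
proof -
  interpret ring "class_ring :: 'k mpoly ring" by (rule ring_class_ring)
  have "(\<lambda>p. D_family (coords p)) ` carrier class_ring = carrier (D_ring \<alpha>)"
    using range_coords by (simp add: D_carrier image_image[symmetric, of D_family coords])
  then show ?thesis
    using ring_hom_imp_img_ring[OF ring_hom_D_family_coords] by (simp add: D_family_zero)
qed

definition present_iso :: "'k mpoly set \<Rightarrow> 'k dfam" where
  "present_iso X = the_elem ((\<lambda>p. D_family (coords p)) ` X)"

lemma present_iso_cls: "present_iso (pres_cls \<alpha> p) = D_family (coords p)"
proof -
  have "(\<lambda>p. D_family (coords p)) ` pres_cls \<alpha> p = {D_family (coords p)}"
    using pres_ideal_zero by (force simp: pres_cls_def a_r_coset_def' coords_add coords_ideal)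
  then show ?thesis by (simp add: present_iso_def)
qed

lemma present_iso: "present_iso \<in> ring_iso (pres_ring \<alpha>) (D_ring \<alpha>)"
proof -
  interpret h: ring_hom_ring "class_ring :: 'k mpoly ring" "D_ring \<alpha>" "\<lambda>p. D_family (coords p)"
    by (rule ring_hom_ringI2[OF ring_class_ring ring_D ring_hom_D_family_coords])
  have "a_kernel class_ring (D_ring \<alpha>) (\<lambda>p. D_family (coords p)) = pres_ideal \<alpha>"
    unfolding a_kernel_def' D_family_zero[symmetric] D_family_inject coords_eq_zero_iff by simp
  moreover have "(\<lambda>p. D_family (coords p)) ` carrier class_ring = carrier (D_ring \<alpha>)"
    using range_coords by (simp add: D_carrier image_image[symmetric, of D_family coords])
  ultimately show ?thesis
    using h.FactRing_iso_set unfolding pres_ring_def present_iso_def by simp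
qed

text \<open>For the inclusion from right to left the element of degree \<open>\<gamma>\<close> with coordinate \<open>r\<close> is lifted to
  \<open>r(z) c\<^sub>\<gamma>\<close>, which is homogeneous because \<open>z = c\<^sub>0\<^sup>2\<close> has degree zero.\<close>

lemma present_iso_component: "present_iso ` pres_component \<alpha> \<gamma> = D_component \<alpha> \<gamma>"
proof -
  have "present_iso ` pres_component \<alpha> \<gamma> =
      (\<lambda>p. D_family (coords p)) ` {p. \<forall>m\<in>Poly_Mapping.keys p. monom_deg m = \<gamma>}"
    by (simp add: pres_component_def image_image present_iso_cls)
  also have "\<dots> = D_family ` range (Poly_Mapping.single \<gamma>)"
  proof -
    have "coords ` {p. \<forall>m\<in>Poly_Mapping.keys p. monom_deg m = \<gamma>} = range (Poly_Mapping.single \<gamma>)"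
    proof (intro subset_antisym subsetI)
      fix g assume "g \<in> coords ` {p. \<forall>m\<in>Poly_Mapping.keys p. monom_deg m = \<gamma>}"
      then obtain p where p: "g = coords p" "\<forall>m\<in>Poly_Mapping.keys p. monom_deg m = \<gamma>" by blast
      have single_sum: "(\<Sum>m\<in>M. Poly_Mapping.single \<gamma> (r m)) = Poly_Mapping.single \<gamma> (\<Sum>m\<in>M. r m)"
        for M and r :: "(var \<Rightarrow>\<^sub>0 nat) \<Rightarrow> 'k poly"
        by (induction M rule: infinite_finite_induct) (simp_all add: single_add)
      have "g = (\<Sum>m\<in>Poly_Mapping.keys p. Poly_Mapping.single \<gamma> (smult (Poly_Mapping.lookup p m) (weight m)))"
        unfolding p(1) coords_def using p(2) by (intro sum.cong) auto
      then show "g \<in> range (Poly_Mapping.single \<gamma>)" unfolding single_sum by blast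
    next
      fix g :: "gam \<Rightarrow>\<^sub>0 'k poly"
      assume "g \<in> range (Poly_Mapping.single \<gamma>)"
      then obtain r where r: "g = Poly_Mapping.single \<gamma> r" by blast
      have z: "\<forall>m\<in>Poly_Mapping.keys (poly_in_z r). monom_deg m = 0"
      proof (induction r)
        case (pCons a r)
        let ?c = "mvar (C 0) :: 'k mpoly"
        have var2: "\<forall>m\<in>Poly_Mapping.keys (?c\<^sup>2). monom_deg m = 0"
        proof -
          show ?thesis
            by (simp add: mvar_def power2_eq_square mult_single monom_deg_add monom_deg_single
                var_deg_double del: One_nat_def var_deg.simps)
        qed
        show ?case
        proof
          fix m assume "m \<in> Poly_Mapping.keys (poly_in_z (pCons a r))"
          then have "m \<in> Poly_Mapping.keys (mconst a) \<union> Poly_Mapping.keys (?c\<^sup>2 * poly_in_z r)"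
            unfolding poly_in_z_pCons using keys_add[of "mconst a" "?c\<^sup>2 * poly_in_z r"] by blast
          then consider "m = 0" | a b where "m = a + b" "a \<in> Poly_Mapping.keys (?c\<^sup>2)"
              "b \<in> Poly_Mapping.keys (poly_in_z r)"
            using keys_mult[of "?c\<^sup>2" "poly_in_z r"] by (fastforce simp: mconst_def split: if_splits)
          then show "monom_deg m = 0"
            by cases (use var2 pCons.IH in \<open>simp_all add: monom_deg_add\<close>)
        qed
      qed simp
      have "\<forall>m\<in>Poly_Mapping.keys (poly_in_z r * basis_elem \<gamma>). monom_deg m = \<gamma>"
      proof
        fix m assume "m \<in> Poly_Mapping.keys (poly_in_z r * basis_elem \<gamma>)"
        then obtain a where "m = a + sqfree_monom \<gamma>" "a \<in> Poly_Mapping.keys (poly_in_z r)"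
          using keys_mult[of "poly_in_z r" "basis_elem \<gamma>"] by (auto simp: basis_elem_def)
        then show "monom_deg m = \<gamma>" using z by (simp add: monom_deg_add monom_deg_sqfree)
      qed
      then show "g \<in> coords ` {p. \<forall>m\<in>Poly_Mapping.keys p. monom_deg m = \<gamma>}"
        unfolding r by (intro image_eqI[of _ _ "poly_in_z r * basis_elem \<gamma>"]) (simp_all add: coords_normal_form_single)
    qed
    then show ?thesis by (metis image_image)
  qed
  also have "\<dots> = D_component \<alpha> \<gamma>"
    by (simp add: D_component_def D_hom_eq image_image D_family_single)
  finally show ?thesis .
qed

end

theorem proposition4p12:
  fixes \<alpha> :: "'k::{alg_closed_field, field_char_0}"
  assumes "\<alpha> \<notin> \<int>"
  shows "ring (D_ring \<alpha>) \<and>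
    (\<exists>\<Phi> \<in> ring_iso (pres_ring \<alpha>) (D_ring \<alpha>).
       (\<forall>c p. \<Phi> (pres_cls \<alpha> (mconst c * p)) = D_scale c (\<Phi> (pres_cls \<alpha> p))) \<and>
       (\<forall>\<gamma>. \<Phi> ` pres_component \<alpha> \<gamma> = D_component \<alpha> \<gamma>) \<and>
       (\<forall>n. \<Phi> (pres_cls \<alpha> (mvar (C n))) =
          dhomog (zsing n, 0) (lmul (Areg \<alpha>) (Fract [:of_int n, 1:] 1))) \<and>
       (\<forall>n. \<Phi> (pres_cls \<alpha> (mvar (D n))) =
          dhomog (0, zsing n) (lmul (Areg \<alpha>) (Fract [:of_int n + \<alpha>, 1:] 1))))"
proof -
  interpret nonintegral \<alpha> by unfold_locales (rule assms)
  have var: "present_iso (pres_cls \<alpha> (mvar v)) =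
      dhomog (var_deg v) (lmul (Areg \<alpha>) (Fract (lin (var_jump v)) 1))" for v
    by (simp add: present_iso_cls coords_mvar D_family_single D_map_def hpoly_lin_prod alpha_nonzero gam_jumps_var_deg lin_prod_def)
  show ?thesis
  proof (intro conjI bexI[of _ present_iso] allI)
    show "ring (D_ring \<alpha>)" by (rule ring_D)
    show "present_iso (pres_cls \<alpha> (mconst c * p)) = D_scale c (present_iso (pres_cls \<alpha> p))" for c p
      by (simp add: present_iso_cls coords_mconst_mult D_family_scale)
    show "present_iso ` pres_component \<alpha> \<gamma> = D_component \<alpha> \<gamma>" for \<gamma>
      by (rule present_iso_component)
    show "present_iso (pres_cls \<alpha> (mvar (C n))) =
        dhomog (zsing n, 0) (lmul (Areg \<alpha>) (Fract [:of_int n, 1:] 1))" for n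
      using var[of "C n"] by (simp add: lin_def)
    show "present_iso (pres_cls \<alpha> (mvar (D n))) =
        dhomog (0, zsing n) (lmul (Areg \<alpha>) (Fract [:of_int n + \<alpha>, 1:] 1))" for n
      using var[of "D n"] by (simp add: lin_def)
  qed (rule present_iso)
qed

end
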